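(* Let $S\subseteq\mathbb{R}^d$ be closed, $w^1\in S\cap\overline{B}_\beta$, $\rho>1$, $\tau=0$, $\eta=\frac{\alpha}{3\rho\sqrt{d}L_0}$, $C_1=\frac{2(1+3\rho)}{\rho-1}+3\rho$, $C_2=\frac{2(1+3\rho)}{\rho-1}+3$, let $\upsilon=d$ if the Stochastic Projected Algorithm (SPA) uses update (1) and $\upsilon=1$ if it uses update (2), and let $\Delta>0$ satisfy $\Delta\ge f_\alpha(w^1)-f_\alpha(w^*_\alpha)$, where $w^*_\alpha$ is a minimizer of $f_\alpha$ over $S\cap\overline{B}_\beta$. (a) Let $\epsilon_1,\epsilon_2>0$. Running SPA with $$\alpha=\frac{\epsilon_1}{L_0\sqrt{d/12}},\qquad K=\Big\lceil C_1\sqrt{\tfrac43}\,\frac{dL_0^2\Delta}{\epsilon_1\epsilon_2^2}\Big\rceil,\qquad M=\Big\lceil C_2\frac{2\upsilon Q}{\epsilon_2^2}\Big\rceil$$ guarantees that its output is an expected $(\epsilon_1,\epsilon_2)$-stationary point. (b) Let $\epsilon_3,\epsilon_4>0$ and assume $\kappa>\beta+\epsilon_3$. Running SPA with $$\alpha=\frac{2\epsilon_3}{\sqrt d},\qquad K=\Big\lceil C_1\frac{2dL_0\Delta}{\epsilon_3\epsilon_4^2}\Big\rceil,\qquad M=\Big\lceil C_2\frac{2\upsilon Q}{\epsilon_4^2}\Big\rceil$$ guarantees that its output is an expected $(\epsilon_3,\epsilon_4)$-stationary point. With these choices, the gradient call complexities are $O(\epsilon_1^{-1}\epsilon_2^{-4})$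 and $O(\epsilon_3^{-1}\epsilon_4^{-4})$, and the projection operator complexities are $O(\epsilon_1^{-1}\epsilon_2^{-2})$ and $O(\epsilon_3^{-1}\epsilon_4^{-2})$, to achieve an expected $(\epsilon_1,\epsilon_2)$- and $(\epsilon_3,\epsilon_4)$-stationary point, respectively.
   Context: Notation: $\overline{B}_r:=\{z\in\mathbb{R}^d:|z_i|\le r,\ i=1,\dots,d\}$; $\overline{B}(x,r)$ is the closed Euclidean ball. Setting: $\alpha>0$, $\beta>0$, $\kappa>\beta+\frac{\alpha}{2}$. $\xi$ is a random vector in $\mathbb{R}^p$ with law $P_\xi$. $F:\overline{B}_\kappa\times\mathbb{R}^p\to\mathbb{R}$ is Borel measurable, $F(w,\xi)$ is integrable for each $w$, and $F(\cdot,\xi)$ is continuous on $\overline{B}_\kappa$ for each $\xi\in\mathbb{R}^p$. There is a measurable function $L_0(\cdot)$ on $\mathbb{R}^p$ with $|F(w,\xi)-F(w',\xi)|\le L_0(\xi)\|w-w'\|_2$ for all $w,w'\in\overline{B}_\kappa$ and all $\xi$ outside a $P_\xi$-null Borel set. Set $Q:=\mathbb{E}[L_0(\xi)^2]<\infty$, $L_0:=\mathbb{E}[L_0(\xi)]$ with $L_0>0$, and $f(w):=\mathbb{E}[F(w,\xi)]$. The random vector $u$ is uniform on $\overline{B}_{\alpha/2}$ with law $P_u$, independent of $\xi$, and $f_\alpha(w):=\mathbb{E}[f(w+u)]$. (If the Lipschitz condition holds for all $w,w'\in\mathbb{R}^d$, the case $\beta=\infty$, i.e. $\overline{B}_\beta=\overline{B}_\kappa=\mathbb{R}^d$,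 is allowed.) Stationarity: a random point $\overline w$ is an expected $(\epsilon_1,\epsilon_2)$-stationary point if $|f_\alpha(w)-f(w)|\le\epsilon_1$ for all $w\in\overline{B}_\beta$ and $\mathbb{E}[\mathrm{dist}(0,\nabla f_\alpha(\overline w)+N(\overline w,S\cap\overline{B}_\beta))]\le\epsilon_2$. It is an expected $(\epsilon_3,\epsilon_4)$-stationary point if $\widehat\alpha:=\sqrt d\frac\alpha2\le\epsilon_3$ and $\mathbb{E}[\mathrm{dist}(0,\overline{\partial}_{\widehat\alpha}f(\overline w)+N(\overline w,S\cap\overline{B}_\beta))]\le\epsilon_4$. Here $\overline{\partial}_\epsilon f(w):=\mathrm{co}\{\overline{\partial}f(x):x\in\overline{B}(w,\epsilon)\}$ with $\overline{\partial}f$ the Clarke subdifferential. Gradient estimators: $\widetilde{\nabla}F:\overline{B}_{\beta+\alpha/2}\times\mathbb{R}^p\to\mathbb{R}^d$ is a Borel measurable function such that for every $w\in\overline{B}_\beta$, $\widetilde{\nabla}F(w+u,\xi)=\nabla F(w+u,\xi)$ (gradient in the first argument) for $P_u\times P_\xi$-almost every $(u,\xi)$. The finite difference $dF(w,u,\xi)\in\mathbb{R}^d$ has $i$-th component $dF_i:=F(w_1+u_1,\dots,w_{i-1}+u_{i-1},w_i+\frac\alpha2,w_{i+1}+u_{i+1},\dots,w_d+u_d,\xi)-F(w_1+u_1,\dots,w_{i-1}+u_{i-1},w_i-\frac\alpha2,w_{i+1}+u_{i+1},\dots,w_d+u_d,\xi)$. Algorithm SPA: inputs $w^1\in S\cap\overline{B}_\beta$,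 $\eta>0$, $K,M\in\mathbb{Z}_{>0}$. Draw $R$ uniformly from $\{2,\dots,K+1\}$ (independently of everything else). For $k=1,\dots,R-1$: draw independent samples $u^{k,i}\sim P_u$, $\xi^{k,i}\sim P_\xi$, $i=1,\dots,M$, and set either (1) $w^{k+1}\in\Pi_{S\cap\overline{B}_\beta}\big(w^k-\frac{\eta}{M\alpha}\sum_{i=1}^M dF(w^k,u^{k,i},\xi^{k,i})\big)$, or (2) $w^{k+1}\in\Pi_{S\cap\overline{B}_\beta}\big(w^k-\frac{\eta}{M}\sum_{i=1}^M\widetilde{\nabla}F(w^k+u^{k,i},\xi^{k,i})\big)$, the same option being used throughout. Output $w^R$. Here $\Pi_A(x)$ is the (set-valued) Euclidean projection onto a closed set $A$; a Borel measurable selection of it is used. Complexity: a gradient call is one evaluation of $dF(w^k,u^{k,i},\xi^{k,i})$ (update (1)) or of $\widetilde\nabla F(w^k+u^{k,i},\xi^{k,i})$ (update (2)); the gradient call complexity is the total number of gradient calls and the projection operator complexity is the total number of projections, as functions of the $\epsilon$'s with all other quantities ($d,L_0,Q,\Delta,\rho$) treated as constants. Normal cone: for $w\in A$, $\widehat N(w,A):=\{y:\limsup_{x\to w,\,x\in A}\frac{\langle y,x-w\rangle}{\|x-w\|_2}\le0\}$, and $N(w,A)$ (Mordukhovich normal cone) is the set of limits $y$ of sequences $y_k\in\widehat N(x_k,A)$ with $x_k\in A$, $x_k\to w$. $\mathrm{dist}$ is Euclidean distance. *)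

theory Defs
  imports "HOL-Probability.Probability" "HOL-Library.Landau_Symbols"
begin

section \<open>Variational notions\<close>

text \<open>The radius is extended real so that an infinite radius gives the whole space.\<close>

definition cube :: "ereal \<Rightarrow> (real ^ 'd) set" where
  "cube r = {z. \<forall>i. ereal \<bar>z $ i\<bar> \<le> r}"

definition gradient :: "('a::real_inner \<Rightarrow> real) \<Rightarrow> 'a \<Rightarrow> 'a" where
  "gradient g w = (THE v. GDERIV g w :> v)"

text \<open>Set-valued Euclidean projection.\<close>

definition projection :: "'a::metric_space set \<Rightarrow> 'a \<Rightarrow> 'a set" where
  "projection A x = {y \<in> A. \<forall>z\<in>A. dist x y \<le> dist x z}"

text \<open>At an isolated point of \<open>A\<close> the filter is trivial, the upper limit is \<open>-\<infinity>\<close>, and every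
  vector is normal.\<close>

definition frechet_normal_cone :: "'a::real_inner \<Rightarrow> 'a set \<Rightarrow> 'a set" where
  "frechet_normal_cone w A =
     {y. Limsup (at w within A) (\<lambda>x. ereal (inner y (x - w) / norm (x - w))) \<le> 0}"

definition mordukhovich_normal_cone :: "'a::real_inner \<Rightarrow> 'a set \<Rightarrow> 'a set" where
  "mordukhovich_normal_cone w A =
     {y. \<exists>x ys. (\<forall>k. x k \<in> A \<and> ys k \<in> frechet_normal_cone (x k) A)
                \<and> x \<longlonglongrightarrow> w \<and> ys \<longlonglongrightarrow> y}"

text \<open>Clarke's generalized directional derivative: the upper limit as \<open>y \<rightarrow> x\<close> and \<open>t \<down> 0\<close>.\<close>

definition clarke_dir_deriv :: "('a::real_inner \<Rightarrow> real) \<Rightarrow> 'a \<Rightarrow> 'a \<Rightarrow> ereal" where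
  "clarke_dir_deriv g x v =
     Limsup (nhds x \<times>\<^sub>F at_right 0) (\<lambda>(y, t). ereal ((g (y + t *\<^sub>R v) - g y) / t))"

definition clarke_subdifferential :: "('a::real_inner \<Rightarrow> real) \<Rightarrow> 'a \<Rightarrow> 'a set" where
  "clarke_subdifferential g x = {\<zeta>. \<forall>v. ereal (inner \<zeta> v) \<le> clarke_dir_deriv g x v}"

definition clarke_eps_subdifferential ::
    "real \<Rightarrow> ('a::real_inner \<Rightarrow> real) \<Rightarrow> 'a \<Rightarrow> 'a set" where
  "clarke_eps_subdifferential \<epsilon> g w = convex hull (\<Union>x\<in>cball w \<epsilon>. clarke_subdifferential g x)"

text \<open>Unlike \<^const>\<open>infdist\<close>, the distance to the empty set is \<open>\<infinity>\<close> here.\<close>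

definition set_dist :: "'a::metric_space \<Rightarrow> 'a set \<Rightarrow> ennreal" where
  "set_dist x C = (INF y\<in>C. ennreal (dist x y))"


section \<open>Problem and smoothing\<close>

text \<open>\<open>F\<close> and \<open>G\<close> below are total functions, but nothing is assumed about their values outside
  the stated domains. The law \<open>uniform_cube\<close> lives on the cube itself (not on the whole space), so
  that those values do not interfere with measurability.\<close>

definition uniform_cube :: "real \<Rightarrow> (real ^ 'd) measure" where
  "uniform_cube r = uniform_measure (restrict_space lborel (cube (ereal r))) (cube (ereal r))"

locale stochastic_lipschitz = prob_space P
  for P :: "(real ^ 'p) measure" +
  fixes F :: "real ^ 'd \<Rightarrow> real ^ 'p \<Rightarrow> real"
    and ell :: "real ^ 'p \<Rightarrow> real"
    and \<kappa> :: ereal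
  assumes sets_P: "sets P = sets borel"
    and F_measurable:
      "(\<lambda>(w, x). F w x) \<in> borel_measurable (restrict_space borel (cube \<kappa> \<times> UNIV))"
    and F_integrable: "\<And>w. w \<in> cube \<kappa> \<Longrightarrow> integrable P (F w)"
    and F_continuous: "\<And>x. continuous_on (cube \<kappa>) (\<lambda>w. F w x)"
    and ell_measurable: "ell \<in> borel_measurable borel"
    and F_lipschitz:
      "AE x in P. \<forall>w\<in>cube \<kappa>. \<forall>w'\<in>cube \<kappa>. \<bar>F w x - F w' x\<bar> \<le> ell x * norm (w - w')"
    and ell_square_integrable: "integrable P (\<lambda>x. (ell x)\<^sup>2)"

definition expected_loss ::
    "(real ^ 'p) measure \<Rightarrow> (real ^ 'd \<Rightarrow> real ^ 'p \<Rightarrow> real) \<Rightarrow> real ^ 'd \<Rightarrow> real" where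
  "expected_loss P F w = (\<integral>x. F w x \<partial>P)"

definition smoothing :: "real \<Rightarrow> (real ^ 'd \<Rightarrow> real) \<Rightarrow> real ^ 'd \<Rightarrow> real" where
  "smoothing \<alpha> f w = (\<integral>u. f (w + u) \<partial>uniform_cube (\<alpha> / 2))"

text \<open>The requirement \<open>\<kappa> > \<beta> + r\<close> on finite radii, or else both cubes are the whole space.\<close>

definition room :: "real \<Rightarrow> ereal \<Rightarrow> ereal \<Rightarrow> bool" where
  "room r \<beta> \<kappa> \<longleftrightarrow> (\<beta> + ereal r < \<kappa> \<and> \<kappa> < \<infinity>) \<or> (\<beta> = \<infinity> \<and> \<kappa> = \<infinity>)"


section \<open>Expected stationarity\<close>

text \<open>The nonnegative integral of a nonmeasurable function is only a lower integral, hence the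
  explicit measurability requirement.\<close>

definition expected_dist_le :: "'a measure \<Rightarrow> ('a \<Rightarrow> 'v::real_normed_vector set) \<Rightarrow> real \<Rightarrow> bool" where
  "expected_dist_le \<Omega> C \<epsilon> \<longleftrightarrow>
     (\<lambda>\<omega>. set_dist 0 (C \<omega>)) \<in> borel_measurable \<Omega> \<and>
     (\<integral>\<^sup>+\<omega>. set_dist 0 (C \<omega>) \<partial>\<Omega>) \<le> ennreal \<epsilon>"

definition smoothed_stationary ::
    "'a measure \<Rightarrow> real \<Rightarrow> ereal \<Rightarrow> (real ^ 'd) set \<Rightarrow> (real ^ 'd \<Rightarrow> real) \<Rightarrow> real \<Rightarrow> real
      \<Rightarrow> ('a \<Rightarrow> real ^ 'd) \<Rightarrow> bool" where
  "smoothed_stationary \<Omega> \<alpha> \<beta> S f \<epsilon>\<^sub>1 \<epsilon>\<^sub>2 w \<longleftrightarrow>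
     w \<in> borel_measurable \<Omega> \<and>
     (\<forall>v\<in>cube \<beta>. \<bar>smoothing \<alpha> f v - f v\<bar> \<le> \<epsilon>\<^sub>1) \<and>
     expected_dist_le \<Omega>
       (\<lambda>\<omega>. {gradient (smoothing \<alpha> f) (w \<omega>) + y | y.
               y \<in> mordukhovich_normal_cone (w \<omega>) (S \<inter> cube \<beta>)}) \<epsilon>\<^sub>2"

definition clarke_stationary ::
    "'a measure \<Rightarrow> real \<Rightarrow> ereal \<Rightarrow> (real ^ 'd) set \<Rightarrow> (real ^ 'd \<Rightarrow> real) \<Rightarrow> real \<Rightarrow> real
      \<Rightarrow> ('a \<Rightarrow> real ^ 'd) \<Rightarrow> bool" where
  "clarke_stationary \<Omega> \<alpha> \<beta> S f \<epsilon>\<^sub>3 \<epsilon>\<^sub>4 w \<longleftrightarrow>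
     (let \<alpha>' = sqrt (real CARD('d)) * (\<alpha> / 2) in
       w \<in> borel_measurable \<Omega> \<and>
       \<alpha>' \<le> \<epsilon>\<^sub>3 \<and>
       expected_dist_le \<Omega>
         (\<lambda>\<omega>. {g + y | g y. g \<in> clarke_eps_subdifferential \<alpha>' f (w \<omega>) \<and>
                 y \<in> mordukhovich_normal_cone (w \<omega>) (S \<inter> cube \<beta>)}) \<epsilon>\<^sub>4)"


section \<open>The stochastic projected algorithm\<close>

datatype spa_update = Finite_Difference | Approximate_Gradient

definition finite_difference ::
    "real \<Rightarrow> (real ^ 'd \<Rightarrow> real ^ 'p \<Rightarrow> real) \<Rightarrow> real ^ 'd \<Rightarrow> real ^ 'd \<Rightarrow> real ^ 'p \<Rightarrow> real ^ 'd" where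
  "finite_difference \<alpha> F w u x =
     (\<chi> i. F (\<chi> j. if j = i then w $ i + \<alpha> / 2 else w $ j + u $ j) x
         - F (\<chi> j. if j = i then w $ i - \<alpha> / 2 else w $ j + u $ j) x)"

definition approximate_gradient ::
    "(real ^ 'p) measure \<Rightarrow> (real ^ 'd \<Rightarrow> real ^ 'p \<Rightarrow> real) \<Rightarrow> real \<Rightarrow> ereal
      \<Rightarrow> (real ^ 'd \<Rightarrow> real ^ 'p \<Rightarrow> real ^ 'd) \<Rightarrow> bool" where
  "approximate_gradient P F \<alpha> \<beta> G \<longleftrightarrow>
     (\<lambda>(w, x). G w x)
       \<in> borel_measurable (restrict_space borel (cube (\<beta> + ereal (\<alpha> / 2)) \<times> UNIV)) \<and>
     (\<forall>w\<in>cube \<beta>. AE (u, x) in uniform_cube (\<alpha> / 2) \<Otimes>\<^sub>M P.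
        GDERIV (\<lambda>y. F y x) (w + u) :> G (w + u) x)"

text \<open>The step taken from \<open>w\<close> before projecting, for the samples \<open>us i\<close>, \<open>xs i\<close>, \<open>i = 1, \<dots>, M\<close>.\<close>

definition spa_step ::
    "spa_update \<Rightarrow> (real ^ 'd \<Rightarrow> real ^ 'p \<Rightarrow> real) \<Rightarrow> (real ^ 'd \<Rightarrow> real ^ 'p \<Rightarrow> real ^ 'd)
      \<Rightarrow> real \<Rightarrow> real \<Rightarrow> nat \<Rightarrow> (nat \<Rightarrow> real ^ 'd) \<Rightarrow> (nat \<Rightarrow> real ^ 'p) \<Rightarrow> real ^ 'd \<Rightarrow> real ^ 'd" where
  "spa_step upd F G \<alpha> \<eta> M us xs w =
     (case upd of
        Finite_Difference \<Rightarrow>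
          w - (\<eta> / (real M * \<alpha>)) *\<^sub>R (\<Sum>i = 1..M. finite_difference \<alpha> F w (us i) (xs i))
      | Approximate_Gradient \<Rightarrow>
          w - (\<eta> / real M) *\<^sub>R (\<Sum>i = 1..M. G (w + us i) (xs i)))"

text \<open>\<open>spa_iterate step proj w1 k\<close> is the \<open>k\<close>-th iterate for \<open>k \<ge> 1\<close>, the first one being \<open>w1\<close>;
  index 0 is a dummy. Here \<open>step k\<close> is the \<open>k\<close>-th step and \<open>proj k\<close> the projection applied to it.\<close>

primrec spa_iterate ::
    "(nat \<Rightarrow> 'v \<Rightarrow> 'v) \<Rightarrow> (nat \<Rightarrow> 'v \<Rightarrow> 'v) \<Rightarrow> 'v \<Rightarrow> nat \<Rightarrow> 'v" where
  "spa_iterate step proj w1 0 = w1"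
| "spa_iterate step proj w1 (Suc k) =
     (if k = 0 then w1 else proj k (step k (spa_iterate step proj w1 k)))"

definition projection_selection :: "'v::metric_space set \<Rightarrow> ('v \<Rightarrow> 'v) \<Rightarrow> bool" where
  "projection_selection A proj \<longleftrightarrow>
     proj \<in> borel_measurable borel \<and> (\<forall>x. proj x \<in> projection A x)"

text \<open>The joint law of the index \<open>R\<close> and all samples \<open>(U k i, X k i)\<close> is the product of the uniform
  law on \<open>{2..K+1}\<close>, and, for each \<open>k \<in> {1..K}\<close> and \<open>i \<in> {1..M}\<close>, of the laws of \<open>u\<close> and \<open>\<xi>\<close>: all
  these variables are mutually independent with the prescribed distributions. (Samples with
  \<open>k \<ge> R\<close> do not influence the output.)\<close>

definition spa_law ::
    "(real ^ 'p) measure \<Rightarrow> real \<Rightarrow> nat \<Rightarrow> nat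
      \<Rightarrow> (nat \<times> (nat \<times> nat \<Rightarrow> (real ^ 'd) \<times> (real ^ 'p))) measure" where
  "spa_law P \<alpha> K M =
     uniform_count_measure {2..K + 1}
       \<Otimes>\<^sub>M PiM ({1..K} \<times> {1..M}) (\<lambda>_. uniform_cube (\<alpha> / 2) \<Otimes>\<^sub>M P)"

definition spa_sampling ::
    "'a measure \<Rightarrow> (real ^ 'p) measure \<Rightarrow> real \<Rightarrow> nat \<Rightarrow> nat
      \<Rightarrow> (nat \<Rightarrow> nat \<Rightarrow> 'a \<Rightarrow> real ^ 'd) \<Rightarrow> (nat \<Rightarrow> nat \<Rightarrow> 'a \<Rightarrow> real ^ 'p) \<Rightarrow> ('a \<Rightarrow> nat) \<Rightarrow> bool" where
  "spa_sampling \<Omega> P \<alpha> K M U X R \<longleftrightarrow>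
     prob_space \<Omega> \<and>
     (let T = (\<lambda>\<omega>. (R \<omega>, \<lambda>(k, i)\<in>{1..K} \<times> {1..M}. (U k i \<omega>, X k i \<omega>))) in
       T \<in> measurable \<Omega> (spa_law P \<alpha> K M) \<and>
       distr \<Omega> (spa_law P \<alpha> K M) T = spa_law P \<alpha> K M)"

definition spa_output ::
    "spa_update \<Rightarrow> (real ^ 'd \<Rightarrow> real ^ 'p \<Rightarrow> real) \<Rightarrow> (real ^ 'd \<Rightarrow> real ^ 'p \<Rightarrow> real ^ 'd)
      \<Rightarrow> real \<Rightarrow> real \<Rightarrow> nat \<Rightarrow> (nat \<Rightarrow> real ^ 'd \<Rightarrow> real ^ 'd) \<Rightarrow> real ^ 'd
      \<Rightarrow> (nat \<Rightarrow> nat \<Rightarrow> 'a \<Rightarrow> real ^ 'd) \<Rightarrow> (nat \<Rightarrow> nat \<Rightarrow> 'a \<Rightarrow> real ^ 'p) \<Rightarrow> ('a \<Rightarrow> nat)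
      \<Rightarrow> 'a \<Rightarrow> real ^ 'd" where
  "spa_output upd F G \<alpha> \<eta> M proj w1 U X R \<omega> =
     spa_iterate (\<lambda>k. spa_step upd F G \<alpha> \<eta> M (\<lambda>i. U k i \<omega>) (\<lambda>i. X k i \<omega>)) proj w1 (R \<omega>)"

text \<open>A run with index \<open>r\<close> performs iterations \<open>k = 1, \<dots>, r - 1\<close>, each with one gradient call per
  sample and one projection. The complexities are the worst case over the possible values of the
  random index.\<close>

definition gradient_calls :: "nat \<Rightarrow> nat \<Rightarrow> nat" where
  "gradient_calls M r = card {(k, i). k \<in> {1..<r} \<and> i \<in> {1..M}}"

definition projections :: "nat \<Rightarrow> nat" where
  "projections r = card {1..<r}"

definition gradient_call_complexity :: "nat \<Rightarrow> nat \<Rightarrow> nat" where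
  "gradient_call_complexity K M = (MAX r\<in>{2..K + 1}. gradient_calls M r)"

definition projection_complexity :: "nat \<Rightarrow> nat" where
  "projection_complexity K = (MAX r\<in>{2..K + 1}. projections r)"

end

theory Submission
  imports Defs
begin

text \<open>The smoothed objective has an explicit gradient, the mean of the central finite difference, because
  shifting a cube along a coordinate only exchanges two slabs; this gradient is Lipschitz with constant
  \<open>L = 2 \<surd>d L\<^sub>0 / \<alpha>\<close>, and both estimators are unbiased for it with second moment at most \<open>\<upsilon> Q\<close>. The
  optimality of the projection on the possibly nonconvex set yields a Frechet normal vector at the new
  iterate, and together with the descent inequality bounds the squared stationarity residual of one
  step by \<open>C\<^sub>1 L\<close> times the decrease of the smoothed objective plus \<open>C\<^sub>2\<close> times the squared sampling error.
  These bounds telescope along a run. In case (b) a separation argument shows that the gradient of the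
  smoothing lies in the convex hull of the Clarke subdifferentials at nearby points, without Rademacher's
  theorem.\<close>

section \<open>Averages over a cube\<close>

text \<open>Three obstacles shape the argument. \<open>f\<close> is Lipschitz only on
  \<open>cube \<kappa>\<close>, so every box that is averaged over must keep some distance from the
  boundary of that cube; \<open>room\<close> supplies it. On a nonconvex set a projection can be
  compared with feasible points by distance only; the comparison point is the current iterate, and
  the step size \<open>2 / (3 * \<rho> * L)\<close> with \<open>\<rho> > 1\<close> leaves enough
  decrease to pay for the squared step length. Finally, stationarity demands that the distance to a
  set-valued map be measurable: Borel sets are not stable under projection, but sigma-compact sets
  are, and the graphs of the maps that occur are sigma-compact. The parameters divide the error
  evenly: \<open>K\<close> makes the descent part and the batch size the sampling part at most half
  of the squared tolerance. In (a), \<open>\<alpha> * sqrt (d / 12)\<close> is the root mean square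
  norm of the perturbation; in (b), \<open>sqrt d * (\<alpha> / 2)\<close> is the half diagonal of
  its cube.\<close>

definition put :: "'d \<Rightarrow> real \<Rightarrow> real ^ 'd \<Rightarrow> real ^ 'd" where
  "put i t u = (\<chi> j. if j = i then t else u $ j)"

lemma put_nth [simp]: "put i t u $ j = (if j = i then t else u $ j)"
  by (simp add: put_def)

section \<open>Cubes and their uniform law\<close>

lemma mem_cube: "z \<in> cube r \<longleftrightarrow> (\<forall>i. ereal \<bar>z $ i\<bar> \<le> r)"
  by (simp add: cube_def)

lemma mem_cube_ereal [simp]: "z \<in> cube (ereal r) \<longleftrightarrow> (\<forall>i. \<bar>z $ i\<bar> \<le> r)"
  by (simp add: cube_def)

lemma cube_ereal_eq_cbox: "cube (ereal r) = cbox (\<chi> i. - r) (\<chi> i. r)"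
  by (auto simp: mem_box_cart abs_le_iff minus_le_iff)

lemma cube_infinity [simp]: "cube \<infinity> = UNIV"
  by (auto simp: mem_cube)

lemma closed_cube: "closed (cube r :: (real ^ 'd) set)"
proof (cases r)
  case (real x)
  then show ?thesis by (simp add: cube_ereal_eq_cbox closed_cbox convex_box)
next
  case MInf
  then have "(cube r :: (real ^ 'd) set) = {}" by (auto simp: mem_cube)
  then show ?thesis by simp
qed simp

lemma convex_cube: "convex (cube r :: (real ^ 'd) set)"
proof (cases r)
  case (real x)
  then show ?thesis by (simp add: cube_ereal_eq_cbox closed_cbox convex_box)
next
  case MInf
  then have "(cube r :: (real ^ 'd) set) = {}" by (auto simp: mem_cube)
  then show ?thesis by simp
qed simp

lemma compact_cube: "compact (cube (ereal r))"
  by (simp add: cube_ereal_eq_cbox)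

lemma sets_cube [measurable]: "cube r \<in> sets borel"
  by (simp add: closed_cube borel_closed)

lemma emeasure_cube:
  assumes "0 \<le> r"
  shows "emeasure lborel (cube (ereal r) :: (real ^ 'd) set) = ennreal ((2 * r) ^ CARD('d))"
proof -
  have "emeasure lborel (cbox (\<chi> i. - r) (\<chi> i. r) :: (real ^ 'd) set) =
      (\<Prod>b\<in>(Basis :: (real ^ 'd) set). ((\<chi> i. r) - (\<chi> i. - r)) \<bullet> b)"
    using assms by (intro emeasure_lborel_cbox) (auto simp: Basis_vec_def inner_axis)
  also have "... = (\<Prod>b\<in>(Basis :: (real ^ 'd) set). 2 * r)"
    by (rule arg_cong[where f = ennreal], rule prod.cong) (auto simp: Basis_vec_def inner_axis)
  finally show ?thesis by (simp add: cube_ereal_eq_cbox)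
qed

lemma space_uniform_cube [simp]: "space (uniform_cube r) = cube (ereal r)"
  by (simp add: uniform_cube_def space_restrict_space)

lemma sets_uniform_cube [measurable_cong]:
  "sets (uniform_cube r) = sets (restrict_space borel (cube (ereal r)))"
  by (simp add: uniform_cube_def sets_restrict_space)

lemma prob_space_uniform_cube:
  assumes "0 < r"
  shows "prob_space (uniform_cube r :: (real ^ 'd) measure)"
proof -
  let ?C = "cube (ereal r) :: (real ^ 'd) set"
  have "emeasure (restrict_space lborel ?C) ?C = ennreal ((2 * r) ^ CARD('d))"
    using assms by (simp add: emeasure_restrict_space emeasure_cube)
  then show ?thesis
    unfolding uniform_cube_def using assms by (intro prob_space_uniform_measure) simp_all
qed

lemma borel_measurable_uniform_cube:
  fixes f :: "real ^ 'd \<Rightarrow> 'b::topological_space"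
  assumes "continuous_on (cube (ereal r)) f"
  shows "f \<in> borel_measurable (uniform_cube r)"
proof -
  have "f \<in> borel_measurable (restrict_space borel (cube (ereal r)))"
    by (rule borel_measurable_continuous_on_restrict[OF assms])
  then show ?thesis by (simp add: measurable_cong_sets[OF sets_uniform_cube refl])
qed

lemma integrable_uniform_cube:
  fixes f :: "real ^ 'd \<Rightarrow> 'b::{banach, second_countable_topology}"
  assumes "0 < r" "continuous_on (cube (ereal r)) f"
  shows "integrable (uniform_cube r) f"
proof -
  interpret U: prob_space "uniform_cube r :: (real ^ 'd) measure"
    by (rule prob_space_uniform_cube[OF assms(1)])
  obtain B where B: "\<forall>x\<in>cube (ereal r). norm (f x) \<le> B"
    using compact_imp_bounded[OF compact_continuous_image[OF assms(2) compact_cube]]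
    by (auto simp: bounded_iff simp del: mem_cube_ereal)
  show ?thesis
    using B by (intro U.integrable_const_bound[where B = B] borel_measurable_uniform_cube assms) auto
qed

text \<open>The uniform law has the constant density \<open>1 / (2 * r) ^ CARD('d)\<close> on the
  cube. This passes to \<open>lborel\<close>, where changes of variables are available.\<close>

lemma integral_uniform_cube:
  fixes f :: "real ^ 'd \<Rightarrow> real"
  assumes r: "0 < r" and f: "f \<in> borel_measurable (uniform_cube r)"
  shows "(\<integral>u. f u \<partial>uniform_cube r) =
    (LINT u:cube (ereal r)|lborel. f u) / (2 * r) ^ CARD('d)"
proof -
  let ?C = "cube (ereal r) :: (real ^ 'd) set"
  let ?R = "restrict_space lborel ?C"
  have e: "emeasure ?R ?C = ennreal ((2 * r) ^ CARD('d))"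
    using r by (simp add: emeasure_restrict_space emeasure_cube)
  have ind: "(indicator ?C :: _ \<Rightarrow> real) \<in> borel_measurable ?R" "(indicator ?C :: _ \<Rightarrow> ennreal) \<in> borel_measurable ?R"
    by (rule measurable_restrict_space1, simp)+
  have fm: "f \<in> borel_measurable ?R"
    using f by (simp add: uniform_cube_def)
  have "uniform_cube r = density ?R (\<lambda>x. ennreal (indicator ?C x / (2 * r) ^ CARD('d)))"
    unfolding uniform_cube_def uniform_measure_def e
  proof (rule density_cong)
    show "AE x in ?R. indicator ?C x / ennreal ((2 * r) ^ CARD('d)) =
      ennreal (indicator ?C x / (2 * r) ^ CARD('d))"
      using r by (intro AE_I2) (simp add: divide_ennreal[symmetric] ennreal_indicator)
  qed (use ind in auto)
  then have "(\<integral>u. f u \<partial>uniform_cube r) =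
      (\<integral>u. (indicator ?C u / (2 * r) ^ CARD('d)) *\<^sub>R f u \<partial>?R)"
    using r by (simp only:) (rule integral_density, use fm ind in auto)
  also have "... = (\<integral>u. f u / (2 * r) ^ CARD('d) \<partial>?R)"
    by (rule Bochner_Integration.integral_cong) (auto simp: space_restrict_space)
  also have "... = (\<integral>u. f u \<partial>?R) / (2 * r) ^ CARD('d)" by simp
  also have "(\<integral>u. f u \<partial>?R) = (LINT u:?C|lborel. f u)"
    by (simp add: integral_restrict_space set_lebesgue_integral_def)
  finally show ?thesis .
qed

text \<open>Change of variables along a diagonal affine map, whose Jacobian is the product of the
  \<open>c j\<close>. It expresses the integral over any box as an average over the one fixed
  cube.\<close>

lemma uniform_cube_affine:
  fixes f :: "real ^ 'd \<Rightarrow> real" and c :: "'d \<Rightarrow> real"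
  assumes r: "0 < r" and c: "\<And>j. 0 < c j"
    and f: "continuous_on {x. \<forall>j. \<bar>x $ j - t $ j\<bar> \<le> c j * r} f"
  shows "(\<Prod>j\<in>UNIV. c j) * (\<integral>u. f (t + (\<chi> j. c j * u $ j)) \<partial>uniform_cube r) =
    (LINT x:{x. \<forall>j. \<bar>x $ j - t $ j\<bar> \<le> c j * r}|lborel. f x) / (2 * r) ^ CARD('d)"
proof -
  let ?B = "{x. \<forall>j. \<bar>x $ j - t $ j\<bar> \<le> c j * r}"
  let ?T = "\<lambda>x. t + (\<chi> j. c j * x $ j)"
  have B: "?B = cbox (\<chi> j. t $ j - c j * r) (\<chi> j. t $ j + c j * r)"
    by (auto simp: mem_box_cart abs_le_iff algebra_simps)
  \<comment> \<open>Extended by zero, \<open>f\<close> becomes an integrand on the whole space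
    although its continuity is known on the box only.\<close>
  define g where "g x = indicator ?B x *\<^sub>R f x" for x
  have gi: "integrable lborel g"
    unfolding g_def using B f by (intro borel_integrable_compact) auto
  have Tin: "?T x \<in> ?B \<longleftrightarrow> x \<in> cube (ereal r)" for x
    using c by (simp add: abs_mult abs_of_pos)
  have Tcont: "continuous_on A ?T" for A
    by (intro continuous_intros)
  have basis: "(Basis :: (real ^ 'd) set) = (\<lambda>j. axis j 1) ` UNIV"
    by (auto simp: Basis_vec_def)
  \<comment> \<open>\<open>lborel_affine_euclidean\<close> indexes the scaling factors by basis
    vectors; \<open>THE j. b = axis j 1\<close> recovers the coordinate that belongs to
    \<open>b\<close>.\<close>
  have "(\<lambda>x. t + (\<Sum>b\<in>(Basis :: (real ^ 'd) set). ((c (THE j. b = axis j 1)) * (x \<bullet> b)) *\<^sub>R b)) = ?T"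
  proof
    fix x
    have "(\<Sum>b\<in>(Basis :: (real ^ 'd) set). ((c (THE j. b = axis j 1)) * (x \<bullet> b)) *\<^sub>R b)
        = (\<Sum>j\<in>UNIV. (c j * x $ j) *\<^sub>R axis j 1)"
      unfolding basis by (subst sum.reindex) (auto simp: inj_on_def axis_eq_axis inner_axis)
    also have "... = (\<chi> j. c j * x $ j)"
      by (simp add: vec_eq_iff axis_def if_distrib cong: if_cong)
    finally show "t + (\<Sum>b\<in>(Basis :: (real ^ 'd) set). ((c (THE j. b = axis j 1)) * (x \<bullet> b)) *\<^sub>R b) = ?T x"
      by simp
  qed
  moreover have "(\<Prod>b\<in>(Basis :: (real ^ 'd) set). \<bar>c (THE j. b = axis j 1)\<bar>) = (\<Prod>j\<in>UNIV. c j)"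
    unfolding basis using c by (subst prod.reindex) (auto simp: inj_on_def axis_eq_axis abs_of_pos)
  moreover have "lborel = density (distr lborel borel (\<lambda>x. t + (\<Sum>b\<in>(Basis :: (real ^ 'd) set).
      ((c (THE j. b = axis j 1)) * (x \<bullet> b)) *\<^sub>R b)))
      (\<lambda>_. ennreal (\<Prod>b\<in>(Basis :: (real ^ 'd) set). \<bar>c (THE j. b = axis j 1)\<bar>))"
    using c by (intro lborel_affine_euclidean) (simp add: less_imp_neq[symmetric])
  ultimately have L: "lborel = density (distr lborel borel ?T) (\<lambda>_. ennreal (\<Prod>j\<in>UNIV. c j))"
    by simp
  have Tm: "?T \<in> borel_measurable borel"
    by (rule borel_measurable_continuous_onI[OF Tcont])
  have "(\<integral>x. g x \<partial>lborel) = (\<integral>x. g x \<partial>density (distr lborel borel ?T) (\<lambda>_. ennreal (\<Prod>j\<in>UNIV. c j)))"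
    using L by simp
  also have "... = (\<integral>x. (\<Prod>j\<in>UNIV. c j) *\<^sub>R g x \<partial>distr lborel borel ?T)"
    using gi c by (intro integral_density) (auto intro!: AE_I2 prod_pos less_imp_le)
  also have "... = (\<integral>x. (\<Prod>j\<in>UNIV. c j) *\<^sub>R g (?T x) \<partial>lborel)"
    using gi Tm by (intro integral_distr) auto
  also have "... = (\<Prod>j\<in>UNIV. c j) * (\<integral>x. indicator (cube (ereal r)) x *\<^sub>R f (?T x) \<partial>lborel)"
    using Tin by (simp add: g_def indicator_def)
  also have "(\<integral>x. indicator (cube (ereal r)) x *\<^sub>R f (?T x) \<partial>lborel) =
      (2 * r) ^ CARD('d) * (\<integral>u. f (?T u) \<partial>uniform_cube r)"
  proof -
    have "continuous_on (cube (ereal r)) (\<lambda>x. f (?T x))"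
      by (rule continuous_on_compose2[OF f Tcont]) (use Tin in blast)
    then show ?thesis
      using r by (subst integral_uniform_cube[OF r borel_measurable_uniform_cube])
        (auto simp: set_lebesgue_integral_def)
  qed
  finally show ?thesis
    using r by (simp add: set_lebesgue_integral_def g_def field_simps)
qed

text \<open>The shifted interval gains a piece of length \<open>h\<close> on the right and loses one
  on the left. For \<open>h > 2 * r\<close> the two pieces overlap and cancel on the overlap, so the
  identity persists. The excluded values are the endpoints, where closed intervals would spoil it;
  they form a null set in the integral.\<close>

lemma interval_shift_slabs:
  fixes x h r :: real
  assumes "0 < h" "0 < r" "x \<noteq> r" "x \<noteq> - r" "x \<noteq> r + h" "x \<noteq> - r + h"
  shows "of_bool (\<bar>x - h\<bar> \<le> r) - of_bool (\<bar>x\<bar> \<le> r) =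
    (of_bool (\<bar>x - (r + h / 2)\<bar> \<le> h / 2) - of_bool (\<bar>x - (- r + h / 2)\<bar> \<le> h / 2) :: real)"
proof -
  have 1: "\<bar>x - h\<bar> \<le> r \<longleftrightarrow> - r + h < x \<and> x < r + h"
    "\<bar>x\<bar> \<le> r \<longleftrightarrow> - r < x \<and> x < r"
    using assms by linarith+
  have 2: "\<bar>x - (r + h / 2)\<bar> \<le> h / 2 \<longleftrightarrow> r < x \<and> x < r + h"
    using assms unfolding abs_le_iff by linarith
  have 3: "\<bar>x - (- r + h / 2)\<bar> \<le> h / 2 \<longleftrightarrow> - r < x \<and> x < - r + h"
    using assms unfolding abs_le_iff by linarith
  show ?thesis
    unfolding 1 2 3 using assms by (cases "x < r"; cases "x < - r"; cases "x < r + h"; cases "x < - r + h") auto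
qed

text \<open>Shifting the cube by \<open>h\<close> along a coordinate adds one slab of width \<open>h\<close> and removes another;
  each slab is an affine image of the cube.\<close>

lemma uniform_cube_shift:
  fixes f :: "real ^ 'd \<Rightarrow> real"
  assumes r: "0 < r" and h: "0 < h"
    and f: "continuous_on (cube (ereal (r + h))) f"
  shows "(\<integral>u. f (u + h *\<^sub>R axis i 1) \<partial>uniform_cube r) - (\<integral>u. f u \<partial>uniform_cube r) =
    h / (2 * r) * ((\<integral>u. f (put i (r + h * (u $ i + r) / (2 * r)) u) \<partial>uniform_cube r)
                 - (\<integral>u. f (put i (- r + h * (u $ i + r) / (2 * r)) u) \<partial>uniform_cube r))"
proof -
  let ?B = "\<lambda>t c. {x :: real ^ 'd. \<forall>j. \<bar>x $ j - t $ j\<bar> \<le> c j * r}"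
  let ?e = "axis i 1 :: real ^ 'd"
  let ?one = "\<lambda>_ :: 'd. 1 :: real"
  \<comment> \<open>The factor \<open>h / (2 * r)\<close> in direction \<open>i\<close> squeezes a
    cube of side \<open>2 * r\<close> to a slab of thickness \<open>h\<close>. The slabs are centred
    at \<open>(r + h / 2)\<close> and \<open>(- r + h / 2)\<close> times \<open>?e\<close>.\<close>
  let ?c = "\<lambda>j. if j = i then h / (2 * r) else 1"
  let ?I = "\<lambda>t c. LINT x:?B t c|lborel. f x"
  have box: "?B t c = cbox (\<chi> j. t $ j - c j * r) (\<chi> j. t $ j + c j * r)" for t c
    by (auto simp: mem_box_cart abs_le_iff algebra_simps)
  have int: "set_integrable lborel (?B t c) f" if "?B t c \<subseteq> cube (ereal (r + h))" for t c
    unfolding set_integrable_def using box continuous_on_subset[OF f that]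
    by (intro borel_integrable_compact) auto
  have sub0: "?B t c \<subseteq> cube (ereal (r + h))" if "\<And>j. \<bar>t $ j\<bar> + c j * r \<le> r + h" for t c
  proof clarsimp
    fix x j assume "\<forall>j. \<bar>x $ j - t $ j\<bar> \<le> c j * r"
    then have "\<bar>x $ j - t $ j\<bar> \<le> c j * r" by blast
    then show "\<bar>x $ j\<bar> \<le> r + h" using that[of j] by linarith
  qed
  have sub: "?B 0 ?one \<subseteq> cube (ereal (r + h))" "?B (h *\<^sub>R ?e) ?one \<subseteq> cube (ereal (r + h))"
    "?B ((r + h / 2) *\<^sub>R ?e) ?c \<subseteq> cube (ereal (r + h))"
    "?B ((- r + h / 2) *\<^sub>R ?e) ?c \<subseteq> cube (ereal (r + h))"
    by (rule sub0; use h r in \<open>simp add: axis_def abs_if\<close>)+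
  have pos: "0 < ?c j" for j using r h by simp
  have prods: "(\<Prod>j\<in>UNIV. ?c j) = h / (2 * r)"
    by (simp add: prod.delta)
  have "(\<integral>u. f u \<partial>uniform_cube r) = ?I 0 ?one / (2 * r) ^ CARD('d)"
    using uniform_cube_affine[of r ?one 0 f] r continuous_on_subset[OF f sub(1)]
    by (simp add: vec_nth_inverse)
  moreover have "(\<integral>u. f (u + h *\<^sub>R ?e) \<partial>uniform_cube r) = ?I (h *\<^sub>R ?e) ?one / (2 * r) ^ CARD('d)"
    using uniform_cube_affine[of r ?one "h *\<^sub>R ?e" f] r continuous_on_subset[OF f sub(2)]
    by (simp add: vec_nth_inverse add.commute)
  moreover have "h / (2 * r) * (\<integral>u. f (put i (r + h * (u $ i + r) / (2 * r)) u) \<partial>uniform_cube r) =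
      ?I ((r + h / 2) *\<^sub>R ?e) ?c / (2 * r) ^ CARD('d)"
  proof -
    have eq: "(r + h / 2) *\<^sub>R ?e + (\<chi> j. ?c j * u $ j) = put i (r + h * (u $ i + r) / (2 * r)) u" for u
      using r by (auto simp: vec_eq_iff axis_def field_simps)
    show ?thesis
      using uniform_cube_affine[where c = ?c, OF r pos continuous_on_subset[OF f sub(3)]]
      unfolding prods eq .
  qed
  moreover have "h / (2 * r) * (\<integral>u. f (put i (- r + h * (u $ i + r) / (2 * r)) u) \<partial>uniform_cube r) =
      ?I ((- r + h / 2) *\<^sub>R ?e) ?c / (2 * r) ^ CARD('d)"
  proof -
    have eq: "(- r + h / 2) *\<^sub>R ?e + (\<chi> j. ?c j * u $ j) = put i (- r + h * (u $ i + r) / (2 * r)) u" for u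
      using r by (auto simp: vec_eq_iff axis_def field_simps)
    show ?thesis
      using uniform_cube_affine[where c = ?c, OF r pos continuous_on_subset[OF f sub(4)]]
      unfolding prods eq .
  qed
  moreover have "?I (h *\<^sub>R ?e) ?one - ?I 0 ?one =
      ?I ((r + h / 2) *\<^sub>R ?e) ?c - ?I ((- r + h / 2) *\<^sub>R ?e) ?c"
  proof -
    let ?i = "\<lambda>t c x. indicator (?B t c) x *\<^sub>R f x"
    note ints = int[OF sub(1), unfolded set_integrable_def] int[OF sub(2), unfolded set_integrable_def]
      int[OF sub(3), unfolded set_integrable_def] int[OF sub(4), unfolded set_integrable_def]
    have ae: "AE x in lborel. x $ i \<noteq> s" for s :: real
    proof -
      have "negligible {x :: real ^ 'd. x $ i = s}" 
        using negligible_hyperplane[of "axis i 1 :: real ^ 'd" s] by (simp add: inner_axis' axis_eq_0_iff)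
      then have "{x :: real ^ 'd. x $ i = s} \<in> null_sets lebesgue" by (simp add: negligible_iff_null_sets)
      moreover have "closed {x :: real ^ 'd. x $ i = s}"
        by (intro closed_Collect_eq continuous_intros)
      then have "{x :: real ^ 'd. x $ i = s} \<in> sets lborel" by simp
      ultimately have "{x :: real ^ 'd. x $ i = s} \<in> null_sets lborel"
        using null_sets_completion_iff by blast
      then show ?thesis by (rule AE_I'[of _ lborel]) auto
    qed
    have "(\<integral>x. ?i (h *\<^sub>R ?e) ?one x - ?i 0 ?one x \<partial>lborel) =
      (\<integral>x. ?i ((r + h / 2) *\<^sub>R ?e) ?c x - ?i ((- r + h / 2) *\<^sub>R ?e) ?c x \<partial>lborel)"
    proof (rule integral_cong_AE)
      show "AE x in lborel. ?i (h *\<^sub>R ?e) ?one x - ?i 0 ?one x =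
        ?i ((r + h / 2) *\<^sub>R ?e) ?c x - ?i ((- r + h / 2) *\<^sub>R ?e) ?c x"
        using ae[of r] ae[of "- r"] ae[of "r + h"] ae[of "- r + h"]
      proof eventually_elim
        case (elim x)
        \<comment> \<open>Membership in each of the four boxes is this common condition on the other
          coordinates together with an interval condition on coordinate \<open>i\<close>, which
          reduces the claim to one dimension.\<close>
        let ?o = "\<forall>j. j \<noteq> i \<longrightarrow> \<bar>x $ j\<bar> \<le> r"
        have m: "x \<in> ?B (s *\<^sub>R ?e) c \<longleftrightarrow> ?o \<and> \<bar>x $ i - s\<bar> \<le> q"
          if "\<And>j. j \<noteq> i \<Longrightarrow> c j = 1" "c i * r = q" for s c q
          using that by (auto simp: axis_def)
        have m0: "x \<in> ?B 0 ?one \<longleftrightarrow> ?o \<and> \<bar>x $ i\<bar> \<le> r"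
          by auto
        have ci: "?c i * r = h / 2" using r by simp
        have mm: "x \<in> ?B (h *\<^sub>R ?e) ?one \<longleftrightarrow> ?o \<and> \<bar>x $ i - h\<bar> \<le> r"
          "x \<in> ?B ((r + h / 2) *\<^sub>R ?e) ?c \<longleftrightarrow> ?o \<and> \<bar>x $ i - (r + h / 2)\<bar> \<le> h / 2"
          "x \<in> ?B ((- r + h / 2) *\<^sub>R ?e) ?c \<longleftrightarrow> ?o \<and> \<bar>x $ i - (- r + h / 2)\<bar> \<le> h / 2"
          by (rule m[where c = ?one] m[where c = ?c, OF _ ci]; simp)+
        have "(indicator (?B (h *\<^sub>R ?e) ?one) x :: real) - indicator (?B 0 ?one) x =
            indicator (?B ((r + h / 2) *\<^sub>R ?e) ?c) x - indicator (?B ((- r + h / 2) *\<^sub>R ?e) ?c) x"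
        proof (cases ?o)
          case True
          then show ?thesis
            unfolding indicator_def m0 mm by (simp only: eqTrueI[OF True] simp_thms interval_shift_slabs[OF h r elim])
        next
          case False
          show ?thesis
            unfolding indicator_def m0 mm by (simp only: False simp_thms)
        qed
        then show ?case by (simp only: scaleR_diff_left[symmetric])
      qed
    qed (intro borel_measurable_diff ints[THEN borel_measurable_integrable])+
    then show ?thesis
      unfolding set_lebesgue_integral_def
      by (simp only: Bochner_Integration.integral_diff[OF ints(2) ints(1)]
          Bochner_Integration.integral_diff[OF ints(3) ints(4)])
  qed
  ultimately show ?thesis
    by (simp add: right_diff_distrib diff_divide_distrib[symmetric])
qed

section \<open>The gradient of the smoothing\<close>

text \<open>The flux form of the derivative of an average over a cube: difference of the means over
  two opposite faces, divided by their distance \<open>\<alpha>\<close>. The integrand ignores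
  coordinate \<open>i\<close> of \<open>u\<close>, so averaging over the whole cube averages over a
  face. It is also the mean of the finite difference estimator.\<close>

definition smoothing_gradient :: "real \<Rightarrow> (real ^ 'd \<Rightarrow> real) \<Rightarrow> real ^ 'd \<Rightarrow> real ^ 'd" where
  "smoothing_gradient \<alpha> f w =
     (\<chi> i. (\<integral>u. f (w + put i (\<alpha> / 2) u) - f (w + put i (- (\<alpha> / 2)) u) \<partial>uniform_cube (\<alpha> / 2)) / \<alpha>)"

abbreviation box_around :: "real ^ 'd \<Rightarrow> real \<Rightarrow> (real ^ 'd) set" where
  "box_around w r \<equiv> {z. z - w \<in> cube (ereal r)}"

lemma box_around_mono: "r \<le> s \<Longrightarrow> box_around w r \<subseteq> box_around w s"
  by (auto intro: order_trans)

lemma lipschitz_integrable: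
  fixes f :: "real ^ 'd \<Rightarrow> real"
  assumes "0 < r" "L-lipschitz_on X f" "continuous_on UNIV T" "\<And>u. u \<in> cube (ereal r) \<Longrightarrow> T u \<in> X"
  shows "integrable (uniform_cube r) (\<lambda>u. f (T u))"
proof (rule integrable_uniform_cube[OF assms(1)])
  show "continuous_on (cube (ereal r)) (\<lambda>u. f (T u))"
    by (rule continuous_on_compose2[OF lipschitz_on_continuous_on[OF assms(2)]
          continuous_on_subset[OF assms(3)]]) (use assms(4) in auto)
qed

lemma continuous_on_put [continuous_intros]:
  assumes "continuous_on A g" "continuous_on A h"
  shows "continuous_on A (\<lambda>u. put i (g u) (h u))"
  unfolding put_def
proof (rule continuous_on_vec_lambda)
  fix j
  show "continuous_on A (\<lambda>u. if j = i then g u else h u $ j)"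
    using assms by (cases "j = i") (auto intro!: continuous_intros)
qed

lemma norm_axis: "norm (axis i x) = norm x"
  by (simp add: norm_vec_def L2_set_def axis_def if_distrib[of norm] if_distrib[of "\<lambda>x. x ^ 2"] cong: if_cong)

lemma norm_put_diff: "norm (put i s u - put i t u) = \<bar>s - t\<bar>"
proof -
  have "put i s u - put i t u = axis i (s - t)"
    by (auto simp: vec_eq_iff axis_def)
  then show ?thesis by (simp add: norm_axis)
qed

lemma abs_integral_le:
  fixes f :: "'a \<Rightarrow> real"
  assumes "prob_space M" "integrable M f" "\<And>x. x \<in> space M \<Longrightarrow> \<bar>f x\<bar> \<le> B"
  shows "\<bar>\<integral>x. f x \<partial>M\<bar> \<le> B"
proof -
  interpret prob_space M by fact
  have "(\<integral>x. f x \<partial>M) \<le> (\<integral>x. B \<partial>M)" "(\<integral>x. - B \<partial>M) \<le> (\<integral>x. f x \<partial>M)"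
    using assms(2,3) by (intro integral_mono; force simp: abs_le_iff)+
  then show ?thesis by (simp add: prob_space abs_le_iff)
qed

context
  fixes \<alpha> L :: real and f :: "real ^ 'd \<Rightarrow> real"
  assumes alpha: "0 < \<alpha>"
begin

text \<open>The slab formula is exact; it differs from the claimed derivative only in that faces are
  replaced by slabs of thickness \<open>h\<close>. Moving a slab point to its face costs at most
  \<open>L * h\<close>, for two faces \<open>2 * L * h\<close>, and the prefactor
  \<open>h / \<alpha>\<close> makes the error quadratic.\<close>

lemma smoothing_coordinate_increment_pos:
  assumes h: "0 < h" and f: "L-lipschitz_on (box_around w (\<alpha> / 2 + h)) f"
  shows "\<bar>smoothing \<alpha> f (w + h *\<^sub>R axis i 1) - smoothing \<alpha> f w - h * smoothing_gradient \<alpha> f w $ i\<bar>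
    \<le> 2 * L * h\<^sup>2 / \<alpha>"
proof -
  let ?r = "\<alpha> / 2" and ?X = "box_around w (\<alpha> / 2 + h)"
  let ?U = "uniform_cube (\<alpha> / 2) :: (real ^ 'd) measure"
  interpret U: prob_space ?U by (rule prob_space_uniform_cube) (use alpha in simp)
  \<comment> \<open>\<open>s u\<close> is the depth inside the slab: it runs from 0 to
    \<open>h\<close> as \<open>u $ i\<close> runs through
    \<open>[- \<alpha> / 2, \<alpha> / 2]\<close>.\<close>
  define s where "s u = h * (u $ i + ?r) / \<alpha>" for u :: "real ^ 'd"
  have s: "0 \<le> s u" "s u \<le> h" if "u \<in> cube (ereal ?r)" for u
  proof -
    have "\<bar>u $ i\<bar> \<le> ?r" using that by simp
    then have "- ?r \<le> u $ i" "u $ i \<le> ?r" by linarith+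
    then show "0 \<le> s u" "s u \<le> h"
      using alpha h mult_left_mono[of "u $ i + ?r" \<alpha> h] by (simp_all add: s_def divide_le_eq)
  qed
  have scont: "continuous_on UNIV s"
    unfolding s_def using alpha by (intro continuous_intros) auto
  let ?f1 = "\<lambda>u. f (w + put i (?r + s u) u)" and ?f2 = "\<lambda>u. f (w + put i (- ?r + s u) u)"
  let ?f3 = "\<lambda>u. f (w + put i ?r u)" and ?f4 = "\<lambda>u. f (w + put i (- ?r) u)"
  have X: "w + put i (?r + s u) u \<in> ?X" "w + put i (- ?r + s u) u \<in> ?X"
    "w + put i ?r u \<in> ?X" "w + put i (- ?r) u \<in> ?X" if u: "u \<in> cube (ereal ?r)" for u
  proof -
    have "\<bar>u $ j\<bar> \<le> ?r + h" for j using u h by (metis add.commute add_increasing less_imp_le mem_cube_ereal)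
    then show "w + put i (?r + s u) u \<in> ?X" "w + put i (- ?r + s u) u \<in> ?X"
      "w + put i ?r u \<in> ?X" "w + put i (- ?r) u \<in> ?X"
      using s[OF u] alpha by auto
  qed
  have int: "integrable ?U ?f1" "integrable ?U ?f2" "integrable ?U ?f3" "integrable ?U ?f4"
    using X alpha by (auto intro!: lipschitz_integrable[OF _ f] continuous_intros scont)
  have fc: "continuous_on (cube (ereal (?r + h))) (\<lambda>u. f (w + u))"
    by (rule continuous_on_compose2[OF lipschitz_on_continuous_on[OF f]]) (auto intro!: continuous_intros)
  have e1: "smoothing \<alpha> f (w + h *\<^sub>R axis i 1) - smoothing \<alpha> f w = h / \<alpha> * ((\<integral>u. ?f1 u \<partial>?U) - (\<integral>u. ?f2 u \<partial>?U))"
    using uniform_cube_shift[of ?r h "\<lambda>u. f (w + u)" i] fc alpha h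
    by (simp add: smoothing_def s_def add.assoc add.left_commute add.commute)
  have e2: "h / \<alpha> * ((\<integral>u. ?f1 u \<partial>?U) - (\<integral>u. ?f2 u \<partial>?U)) - h * smoothing_gradient \<alpha> f w $ i = h / \<alpha> * (\<integral>u. (?f1 u - ?f2 u) - (?f3 u - ?f4 u) \<partial>?U)"
    using int by (simp add: smoothing_gradient_def right_diff_distrib diff_divide_distrib)
  have eq: "smoothing \<alpha> f (w + h *\<^sub>R axis i 1) - smoothing \<alpha> f w - h * smoothing_gradient \<alpha> f w $ i =
    h / \<alpha> * (\<integral>u. (?f1 u - ?f2 u) - (?f3 u - ?f4 u) \<partial>?U)"
    unfolding e1 e2 ..
  have "\<bar>\<integral>u. (?f1 u - ?f2 u) - (?f3 u - ?f4 u) \<partial>?U\<bar> \<le> 2 * L * h"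
  proof (rule abs_integral_le)
    fix u assume "u \<in> space ?U"
    then have u: "u \<in> cube (ereal ?r)" by simp
    have L: "0 \<le> L" using lipschitz_on_nonneg[OF f] .
    have "\<bar>?f1 u - ?f3 u\<bar> \<le> L * s u"
      using lipschitz_onD[OF f X(1)[OF u] X(3)[OF u]] s(1)[OF u] by (simp add: dist_norm norm_put_diff)
    moreover have "\<bar>?f2 u - ?f4 u\<bar> \<le> L * s u"
      using lipschitz_onD[OF f X(2)[OF u] X(4)[OF u]] s(1)[OF u] by (simp add: dist_norm norm_put_diff)
    moreover have "L * s u \<le> L * h" using s(2)[OF u] L by (rule mult_left_mono)
    ultimately show "\<bar>(?f1 u - ?f2 u) - (?f3 u - ?f4 u)\<bar> \<le> 2 * L * h" by linarith
  qed (use int in \<open>auto intro: U.prob_space_axioms\<close>)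
  then have "h / \<alpha> * \<bar>\<integral>u. (?f1 u - ?f2 u) - (?f3 u - ?f4 u) \<partial>?U\<bar> \<le> h / \<alpha> * (2 * L * h)"
    using alpha h by (intro mult_left_mono) auto
  then show ?thesis
    unfolding eq using alpha h by (simp add: abs_mult power2_eq_square field_simps)
qed

text \<open>Both faces are translated by \<open>w - w'\<close>, and each of the two translations
  costs \<open>L * norm (w - w')\<close>; hence the factor 2.\<close>

lemma smoothing_gradient_component_lipschitz:
  assumes f: "L-lipschitz_on X f" and w: "box_around w (\<alpha> / 2) \<subseteq> X" "box_around w' (\<alpha> / 2) \<subseteq> X"
  shows "\<bar>smoothing_gradient \<alpha> f w $ i - smoothing_gradient \<alpha> f w' $ i\<bar> \<le> 2 * L / \<alpha> * norm (w - w')"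
proof -
  let ?r = "\<alpha> / 2"
  let ?U = "uniform_cube (\<alpha> / 2) :: (real ^ 'd) measure"
  interpret U: prob_space ?U by (rule prob_space_uniform_cube) (use alpha in simp)
  have X: "w + put i ?r u \<in> X" "w + put i (- ?r) u \<in> X" "w' + put i ?r u \<in> X" "w' + put i (- ?r) u \<in> X"
    if "u \<in> cube (ereal ?r)" for u
    using that w alpha by (auto simp: subset_iff)
  let ?f1 = "\<lambda>u. f (w + put i ?r u)" and ?f2 = "\<lambda>u. f (w + put i (- ?r) u)"
  let ?f3 = "\<lambda>u. f (w' + put i ?r u)" and ?f4 = "\<lambda>u. f (w' + put i (- ?r) u)"
  have int: "integrable ?U ?f1" "integrable ?U ?f2" "integrable ?U ?f3" "integrable ?U ?f4"
    using X alpha by (auto intro!: lipschitz_integrable[OF _ f] continuous_intros)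
  have "\<bar>\<integral>u. (?f1 u - ?f2 u) - (?f3 u - ?f4 u) \<partial>?U\<bar> \<le> 2 * L * norm (w - w')"
  proof (rule abs_integral_le)
    fix u assume "u \<in> space ?U"
    then have u: "u \<in> cube (ereal ?r)" by simp
    have "\<bar>?f1 u - ?f3 u\<bar> \<le> L * norm (w - w')"
      using lipschitz_onD[OF f X(1)[OF u] X(3)[OF u]] by (simp add: dist_norm)
    moreover have "\<bar>?f2 u - ?f4 u\<bar> \<le> L * norm (w - w')"
      using lipschitz_onD[OF f X(2)[OF u] X(4)[OF u]] by (simp add: dist_norm)
    ultimately show "\<bar>(?f1 u - ?f2 u) - (?f3 u - ?f4 u)\<bar> \<le> 2 * L * norm (w - w')" by linarith
  qed (use int in \<open>auto intro: U.prob_space_axioms\<close>)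
  moreover have "smoothing_gradient \<alpha> f w $ i - smoothing_gradient \<alpha> f w' $ i =
      (\<integral>u. (?f1 u - ?f2 u) - (?f3 u - ?f4 u) \<partial>?U) / \<alpha>"
    using int by (simp add: smoothing_gradient_def diff_divide_distrib)
  ultimately show ?thesis
    using alpha by (simp add: abs_divide divide_right_mono)
qed

text \<open>All components obey the same bound, so the Euclidean norm contributes
  \<open>sqrt (real CARD('d))\<close>. This is the smoothness constant from which the step size is
  derived.\<close>

lemma smoothing_gradient_lipschitz:
  assumes f: "L-lipschitz_on X f" and w: "box_around w (\<alpha> / 2) \<subseteq> X" "box_around w' (\<alpha> / 2) \<subseteq> X"
  shows "norm (smoothing_gradient \<alpha> f w - smoothing_gradient \<alpha> f w')
    \<le> 2 * sqrt (real CARD('d)) * L / \<alpha> * norm (w - w')"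
proof -
  let ?c = "2 * L / \<alpha> * norm (w - w')"
  have c: "0 \<le> ?c" using lipschitz_on_nonneg[OF f] alpha by simp
  have "norm (smoothing_gradient \<alpha> f w - smoothing_gradient \<alpha> f w') \<le> sqrt (\<Sum>i\<in>(UNIV :: 'd set). ?c\<^sup>2)"
    unfolding norm_vec_def[of "smoothing_gradient \<alpha> f w - smoothing_gradient \<alpha> f w'"] L2_set_def vector_minus_component real_norm_def
    by (intro real_sqrt_le_mono sum_mono power_mono smoothing_gradient_component_lipschitz[OF assms]) simp
  also have "... = sqrt (real CARD('d)) * ?c"
    using c by (simp only: sum_constant real_sqrt_mult real_sqrt_abs abs_of_nonneg)
  finally show ?thesis by (simp add: mult_ac)
qed

text \<open>For negative \<open>h\<close> the positive case is applied from the shifted point back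
  to \<open>w\<close>. Replacing the gradient at the shifted point by the one at \<open>w\<close>
  adds another \<open>2 * L * h\<^sup>2 / \<alpha>\<close>, hence the 4. The box grows by one
  \<open>\<bar>h\<bar>\<close> for the shifted centre and one for the step.\<close>

lemma smoothing_coordinate_increment:
  assumes f: "L-lipschitz_on (box_around w (\<alpha> / 2 + 2 * \<bar>h\<bar>)) f"
  shows "\<bar>smoothing \<alpha> f (w + h *\<^sub>R axis i 1) - smoothing \<alpha> f w - h * smoothing_gradient \<alpha> f w $ i\<bar>
    \<le> 4 * L * h\<^sup>2 / \<alpha>"
proof -
  have L: "0 \<le> L * h\<^sup>2 / \<alpha>" using lipschitz_on_nonneg[OF f] alpha by simp
  consider "h = 0" | "0 < h" | "h < 0" by linarith
  then show ?thesis
  proof cases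
    case 1
    then show ?thesis using L by simp
  next
    case 2
    have "L-lipschitz_on (box_around w (\<alpha> / 2 + h)) f"
      using 2 by (intro lipschitz_on_subset[OF f]) (auto intro: order_trans)
    from smoothing_coordinate_increment_pos[OF 2 this, of i] show ?thesis using L by simp
  next
    case 3
    let ?w = "w + h *\<^sub>R axis i 1"
    have sub: "box_around ?w (\<alpha> / 2 + - h) \<subseteq> box_around w (\<alpha> / 2 + 2 * \<bar>h\<bar>)"
    proof (clarsimp)
      fix x j assume "\<forall>j. \<bar>x $ j - (w $ j + h * axis i 1 $ j)\<bar> \<le> \<alpha> / 2 - h"
      then have "\<bar>x $ j - (w $ j + h * axis i 1 $ j)\<bar> \<le> \<alpha> / 2 - h" by blast
      then show "\<bar>x $ j - w $ j\<bar> \<le> \<alpha> / 2 + 2 * \<bar>h\<bar>"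
        using 3 by (auto simp: axis_def split: if_splits)
    qed
    have "L-lipschitz_on (box_around ?w (\<alpha> / 2 + - h)) f"
      by (rule lipschitz_on_subset[OF f sub])
    from smoothing_coordinate_increment_pos[OF _ this, of i] 3
    have "\<bar>smoothing \<alpha> f w - smoothing \<alpha> f ?w + h * smoothing_gradient \<alpha> f ?w $ i\<bar> \<le> 2 * L * h\<^sup>2 / \<alpha>"
      by simp
    moreover have "\<bar>smoothing_gradient \<alpha> f ?w $ i - smoothing_gradient \<alpha> f w $ i\<bar> \<le> 2 * L / \<alpha> * norm (?w - w)"
    proof (rule smoothing_gradient_component_lipschitz[OF f])
      show "box_around ?w (\<alpha> / 2) \<subseteq> box_around w (\<alpha> / 2 + 2 * \<bar>h\<bar>)"
        using 3 by (intro order_trans[OF box_around_mono sub]) simp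
    qed (rule box_around_mono, simp)
    then have "\<bar>h\<bar> * \<bar>smoothing_gradient \<alpha> f ?w $ i - smoothing_gradient \<alpha> f w $ i\<bar> \<le> \<bar>h\<bar> * (2 * L / \<alpha> * \<bar>h\<bar>)"
      by (intro mult_left_mono) (auto simp: norm_axis)
    then have "\<bar>h * smoothing_gradient \<alpha> f ?w $ i - h * smoothing_gradient \<alpha> f w $ i\<bar> \<le> 2 * L * h\<^sup>2 / \<alpha>"
      by (simp add: right_diff_distrib[symmetric] abs_mult power2_eq_square mult_ac)
    moreover have "4 * L * h\<^sup>2 / \<alpha> = 2 * L * h\<^sup>2 / \<alpha> + 2 * L * h\<^sup>2 / \<alpha>"
      by simp
    ultimately show ?thesis by linarith
  qed
qed

text \<open>Walk from \<open>w\<close> to \<open>w + v\<close> one coordinate at a time.\<close>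

lemma smoothing_increment:
  assumes f: "L-lipschitz_on (box_around w (\<alpha> / 2 + 3 * e)) f" and v: "norm v \<le> e"
  shows "\<bar>smoothing \<alpha> f (w + v) - smoothing \<alpha> f w - inner (smoothing_gradient \<alpha> f w) v\<bar>
    \<le> real CARD('d) * (6 * L / \<alpha>) * (norm v)\<^sup>2"
proof -
  \<comment> \<open>\<open>p I\<close> is the point reached after moving along the coordinates in
    \<open>I\<close>; \<open>p UNIV\<close> is \<open>v\<close>.\<close>
  define p where "p I = (\<chi> j. if j \<in> I then v $ j else 0)" for I :: "'d set"
  let ?D = "smoothing_gradient \<alpha> f"
  have L: "0 \<le> L" using lipschitz_on_nonneg[OF f] .
  have vj: "\<bar>v $ j\<bar> \<le> e" for j using component_le_norm_cart[of v j] v by linarith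
  have e: "0 \<le> e" using v norm_ge_zero order_trans by blast
  have pn: "norm (p I) \<le> norm v" for I
    unfolding norm_vec_def L2_set_def p_def by (intro real_sqrt_le_mono sum_mono) auto
  have "\<bar>smoothing \<alpha> f (w + p I) - smoothing \<alpha> f w - (\<Sum>i\<in>I. v $ i * ?D w $ i)\<bar>
      \<le> real (card I) * (6 * L / \<alpha>) * (norm v)\<^sup>2" if "finite I" for I
    using that
  proof (induction I)
    case empty
    have "p {} = 0" by (simp add: p_def vec_eq_iff)
    then show ?case by simp
  next
    case (insert i I)
    have pe: "w + p (insert i I) = (w + p I) + v $ i *\<^sub>R axis i 1"
      using insert.hyps by (auto simp: p_def vec_eq_iff axis_def)
    \<comment> \<open>The \<open>3 * e\<close> is spent here: \<open>e\<close> for the distance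
      already travelled and \<open>2 * e\<close> for the next coordinate step.\<close>
    have sub: "box_around (w + p I) (\<alpha> / 2 + 2 * \<bar>v $ i\<bar>) \<subseteq> box_around w (\<alpha> / 2 + 3 * e)"
    proof (clarsimp)
      fix x j assume "\<forall>j. \<bar>x $ j - (w $ j + p I $ j)\<bar> \<le> \<alpha> / 2 + 2 * \<bar>v $ i\<bar>"
      then have "\<bar>x $ j - (w $ j + p I $ j)\<bar> \<le> \<alpha> / 2 + 2 * \<bar>v $ i\<bar>" by blast
      moreover have "\<bar>p I $ j\<bar> \<le> e" using vj[of j] e by (auto simp: p_def)
      ultimately show "\<bar>x $ j - w $ j\<bar> \<le> \<alpha> / 2 + 3 * e"
        using vj[of i] by linarith
    qed
    have "\<bar>smoothing \<alpha> f (w + p (insert i I)) - smoothing \<alpha> f (w + p I) - v $ i * ?D (w + p I) $ i\<bar>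
        \<le> 4 * L * (v $ i)\<^sup>2 / \<alpha>"
      unfolding pe by (rule smoothing_coordinate_increment[OF lipschitz_on_subset[OF f sub]])
    also have "... \<le> 4 * L * (norm v)\<^sup>2 / \<alpha>"
      using L alpha component_le_norm_cart[of v i]
      by (intro divide_right_mono mult_left_mono) (auto simp: abs_le_square_iff[symmetric])
    finally have 1: "\<bar>smoothing \<alpha> f (w + p (insert i I)) - smoothing \<alpha> f (w + p I) - v $ i * ?D (w + p I) $ i\<bar>
        \<le> 4 * L / \<alpha> * (norm v)\<^sup>2" by simp
    have "\<bar>?D (w + p I) $ i - ?D w $ i\<bar> \<le> 2 * L / \<alpha> * norm ((w + p I) - w)"
    proof (rule smoothing_gradient_component_lipschitz[OF f])
      show "box_around (w + p I) (\<alpha> / 2) \<subseteq> box_around w (\<alpha> / 2 + 3 * e)"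
        by (intro order_trans[OF box_around_mono sub]) simp
    qed (rule box_around_mono, use e in simp)
    also have "... \<le> 2 * L / \<alpha> * norm v"
      using pn L alpha by (intro mult_left_mono) auto
    finally have "\<bar>v $ i\<bar> * \<bar>?D (w + p I) $ i - ?D w $ i\<bar> \<le> norm v * (2 * L / \<alpha> * norm v)"
      using component_le_norm_cart[of v i] by (intro mult_mono) auto
    then have 2: "\<bar>v $ i * ?D (w + p I) $ i - v $ i * ?D w $ i\<bar> \<le> 2 * L / \<alpha> * (norm v)\<^sup>2"
      by (simp add: right_diff_distrib[symmetric] abs_mult power2_eq_square mult_ac)
    \<comment> \<open>The 6 is 4 from the coordinate increment plus 2 from replacing the gradient at
      the intermediate point by the gradient at \<open>w\<close>.\<close>
    have "real (card (insert i I)) * (6 * L / \<alpha>) * (norm v)\<^sup>2 =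
        real (card I) * (6 * L / \<alpha>) * (norm v)\<^sup>2 + 4 * L / \<alpha> * (norm v)\<^sup>2 + 2 * L / \<alpha> * (norm v)\<^sup>2"
      using insert.hyps by (simp add: algebra_simps add_divide_distrib[symmetric])
    then show ?case
      using 1 2 insert.IH insert.hyps by simp
  qed
  from this[of UNIV] show ?thesis
    by (simp add: p_def inner_vec_def vec_lambda_eta mult.commute)
qed

text \<open>The remainder in \<open>smoothing_increment\<close> is quadratic in
  \<open>norm v\<close>, so after division by \<open>norm v\<close> it vanishes. The threshold
  \<open>e / 3\<close> matches the threefold room required there.\<close>

lemma smoothing_GDERIV:
  assumes f: "L-lipschitz_on (box_around w (\<alpha> / 2 + e)) f" and e: "0 < e"
  shows "GDERIV (smoothing \<alpha> f) w :> smoothing_gradient \<alpha> f w"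
proof -
  let ?D = "smoothing_gradient \<alpha> f w" and ?C = "real CARD('d) * (6 * L / \<alpha>)"
  have inc: "\<bar>smoothing \<alpha> f (w + v) - smoothing \<alpha> f w - inner ?D v\<bar> \<le> ?C * (norm v)\<^sup>2" if "norm v \<le> e / 3" for v
    using smoothing_increment[of w "e / 3" v] f that alpha by simp
  have "((\<lambda>v. norm (smoothing \<alpha> f (w + v) - smoothing \<alpha> f w - inner v ?D) / norm v) \<longlongrightarrow> 0) (at 0)"
  proof (rule Lim_null_comparison)
    show "((\<lambda>v. ?C * norm v) \<longlongrightarrow> 0) (at (0 :: real ^ 'd))"
      by (intro tendsto_mult_right_zero tendsto_norm_zero tendsto_ident_at)
    have "\<forall>\<^sub>F v in at (0 :: real ^ 'd). norm v \<le> e / 3"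
      unfolding eventually_at using e by (intro exI[of _ "e / 3"]) auto
    moreover have "\<forall>\<^sub>F v in at (0 :: real ^ 'd). v \<noteq> 0"
      by (simp add: eventually_at_filter)
    ultimately show "\<forall>\<^sub>F v in at 0. norm (norm (smoothing \<alpha> f (w + v) - smoothing \<alpha> f w - inner v ?D) / norm v)
        \<le> ?C * norm v"
    proof eventually_elim
      case (elim v)
      then have "0 < norm v" by simp
      have "\<bar>smoothing \<alpha> f (w + v) - smoothing \<alpha> f w - inner v ?D\<bar> \<le> ?C * norm v * norm v"
        using inc[OF elim(1)] by (simp only: inner_commute power2_eq_square mult.assoc)
      then have "\<bar>smoothing \<alpha> f (w + v) - smoothing \<alpha> f w - inner v ?D\<bar> / norm v \<le> ?C * norm v"
        using \<open>0 < norm v\<close> by (simp only: pos_divide_le_eq)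
      then show ?case
        by simp
    qed
  qed
  then show ?thesis
    unfolding gderiv_def has_derivative_at by (auto simp: bounded_linear_inner_left)
qed

end

lemma gradient_eq:
  assumes "GDERIV f w :> v"
  shows "gradient f w = v"
  unfolding gradient_def
proof (rule the_equality)
  show "GDERIV f w :> v" by fact
next
  fix v' assume "GDERIV f w :> v'"
  then have "(\<lambda>h. inner h v') = (\<lambda>h. inner h v)"
    using assms has_derivative_unique unfolding gderiv_def by blast
  then have "inner (v' - v) (v' - v) = 0" by (metis inner_diff_right right_minus_eq)
  then show "v' = v" by simp
qed

section \<open>Mini-batches\<close>

text \<open>Induction on the index set: integrating out the new coordinate first kills the cross
  term because \<open>Y\<close> has mean zero. With nonnegative integrals, integrability on the
  product space is never an issue.\<close>

lemma nn_integral_norm_sum_PiM: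
  fixes Y :: "'b \<Rightarrow> 'v::euclidean_space"
  assumes \<nu>: "prob_space \<nu>" and Y: "integrable \<nu> Y" "integrable \<nu> (\<lambda>x. (norm (Y x))\<^sup>2)"
    and mean: "(\<integral>x. Y x \<partial>\<nu>) = 0" and J: "finite J"
  shows "(\<integral>\<^sup>+y. ennreal ((norm (\<Sum>i\<in>J. Y (y i)))\<^sup>2) \<partial>PiM J (\<lambda>_. \<nu>)) =
    ennreal (real (card J) * (\<integral>x. (norm (Y x))\<^sup>2 \<partial>\<nu>))"
  using J
proof (induction J)
  case empty
  interpret product_sigma_finite "\<lambda>_. \<nu>"
    using \<nu> by (simp add: product_sigma_finite_def prob_space_imp_sigma_finite)
  show ?case by (simp add: nn_integral_empty)
next
  case (insert j J)
  interpret \<nu>: prob_space \<nu> by fact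
  interpret product_sigma_finite "\<lambda>_. \<nu>"
    using \<nu> by (simp add: product_sigma_finite_def prob_space_imp_sigma_finite)
  interpret J: prob_space "PiM J (\<lambda>_. \<nu>)"
    by (rule prob_space_PiM) (rule \<nu>)
  let ?s = "\<integral>x. (norm (Y x))\<^sup>2 \<partial>\<nu>"
  have Ym [measurable]: "Y \<in> borel_measurable \<nu>" using Y(1) by simp
  have inner_int: "(\<integral>\<^sup>+t. ennreal ((norm (a + Y t))\<^sup>2) \<partial>\<nu>) = ennreal ((norm a)\<^sup>2) + ennreal ?s" for a
  proof -
    have eq: "(norm (a + Y t))\<^sup>2 = (norm a)\<^sup>2 + (2 * inner a (Y t) + (norm (Y t))\<^sup>2)" for t
      by (simp add: power2_norm_eq_inner inner_add_left inner_add_right inner_commute)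
    have "(\<integral>\<^sup>+t. ennreal ((norm (a + Y t))\<^sup>2) \<partial>\<nu>) =
        ennreal (\<integral>t. (norm a)\<^sup>2 + (2 * inner a (Y t) + (norm (Y t))\<^sup>2) \<partial>\<nu>)"
      unfolding eq
    proof (rule nn_integral_eq_integral)
      show "AE t in \<nu>. 0 \<le> (norm a)\<^sup>2 + (2 * inner a (Y t) + (norm (Y t))\<^sup>2)"
        unfolding eq[symmetric] by simp
    qed (use Y in simp)
    also have "(\<integral>t. (norm a)\<^sup>2 + (2 * inner a (Y t) + (norm (Y t))\<^sup>2) \<partial>\<nu>) = (norm a)\<^sup>2 + ?s"
      using Y mean by (simp add: \<nu>.prob_space)
    finally show ?thesis by (simp add: ennreal_plus)
  qed
  have "(\<integral>\<^sup>+y. ennreal ((norm (\<Sum>i\<in>insert j J. Y (y i)))\<^sup>2) \<partial>PiM (insert j J) (\<lambda>_. \<nu>)) =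
      (\<integral>\<^sup>+x. \<integral>\<^sup>+t. ennreal ((norm (\<Sum>i\<in>insert j J. Y ((x(j := t)) i)))\<^sup>2) \<partial>\<nu> \<partial>PiM J (\<lambda>_. \<nu>))"
    using insert.hyps by (intro product_nn_integral_insert) measurable
  also have "... = (\<integral>\<^sup>+x. ennreal ((norm (\<Sum>i\<in>J. Y (x i)))\<^sup>2) + ennreal ?s \<partial>PiM J (\<lambda>_. \<nu>))"
  proof (rule nn_integral_cong)
    fix x
    have "(\<Sum>i\<in>insert j J. Y ((x(j := t)) i)) = (\<Sum>i\<in>J. Y (x i)) + Y t" for t
    proof -
      have "(\<Sum>i\<in>J. Y ((x(j := t)) i)) = (\<Sum>i\<in>J. Y (x i))"
        using insert.hyps by (intro sum.cong) auto
      then show ?thesis using insert.hyps by (simp add: add.commute)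
    qed
    then show "(\<integral>\<^sup>+t. ennreal ((norm (\<Sum>i\<in>insert j J. Y ((x(j := t)) i)))\<^sup>2) \<partial>\<nu>) =
        ennreal ((norm (\<Sum>i\<in>J. Y (x i)))\<^sup>2) + ennreal ?s"
      by (simp only: inner_int)
  qed
  also have "... = ennreal (real (card J) * ?s) + ennreal ?s"
    by (subst nn_integral_add) (simp_all add: insert.IH J.emeasure_space_1)
  also have "... = ennreal (real (card (insert j J)) * ?s)"
    using insert.hyps by (subst ennreal_plus[symmetric]) (auto simp: algebra_simps)
  finally show ?case .
qed

lemma integrable_of_norm_square:
  fixes Z :: "'b \<Rightarrow> 'v::euclidean_space"
  assumes "prob_space \<nu>" "Z \<in> borel_measurable \<nu>" "integrable \<nu> (\<lambda>x. (norm (Z x))\<^sup>2)"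
  shows "integrable \<nu> Z"
proof (rule Bochner_Integration.integrable_bound)
  interpret prob_space \<nu> by fact
  show "integrable \<nu> (\<lambda>x. 1 + (norm (Z x))\<^sup>2)"
    using assms(3) by simp
  have "t \<le> 1 + t\<^sup>2" for t :: real
    using zero_le_power2[of "t - 1 / 2"] by (simp add: power2_eq_square algebra_simps)
  then show "AE x in \<nu>. norm (Z x) \<le> norm (1 + (norm (Z x))\<^sup>2)"
    by (intro AE_I2) (simp add: add_nonneg_nonneg)
qed (fact assms(2))

text \<open>After centering, the sum formula gives \<open>1 / m\<^sup>2\<close> times
  \<open>m\<close> times the variance, \<open>m\<close> being the batch size. The variance is at
  most the second moment, which is the quantity that the Lipschitz bound controls.\<close>

lemma minibatch_variance:
  fixes Z :: "'b \<Rightarrow> 'v::euclidean_space"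
  assumes \<nu>: "prob_space \<nu>" and Z: "Z \<in> borel_measurable \<nu>" "integrable \<nu> (\<lambda>x. (norm (Z x))\<^sup>2)"
    and J: "finite J" "J \<noteq> {}"
  shows "(\<integral>\<^sup>+y. ennreal ((norm ((1 / real (card J)) *\<^sub>R (\<Sum>i\<in>J. Z (y i)) - (\<integral>x. Z x \<partial>\<nu>)))\<^sup>2)
      \<partial>PiM J (\<lambda>_. \<nu>)) \<le> ennreal ((\<integral>x. (norm (Z x))\<^sup>2 \<partial>\<nu>) / real (card J))"
proof -
  interpret \<nu>: prob_space \<nu> by fact
  let ?\<mu> = "\<integral>x. Z x \<partial>\<nu>" and ?m = "real (card J)"
  define Y where "Y x = Z x - ?\<mu>" for x
  have m: "0 < ?m" using J by (simp add: card_gt_0_iff)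
  have Zi: "integrable \<nu> Z" by (rule integrable_of_norm_square) fact+
  have Ym: "Y \<in> borel_measurable \<nu>" unfolding Y_def using Z(1) by simp
  have Ymi: "(\<lambda>y. Y (y i)) \<in> borel_measurable (PiM J (\<lambda>_. \<nu>))" if "i \<in> J" for i
    by (rule measurable_compose[OF measurable_component_singleton[OF that] Ym])
  have [measurable]: "(\<lambda>y. \<Sum>i\<in>J. Y (y i)) \<in> borel_measurable (PiM J (\<lambda>_. \<nu>))"
    by (intro borel_measurable_sum Ymi)
  have eq: "(norm (Y x))\<^sup>2 = (norm (Z x))\<^sup>2 + ((norm ?\<mu>)\<^sup>2 - 2 * inner ?\<mu> (Z x))" for x
    unfolding Y_def by (simp add: power2_norm_eq_inner inner_diff_left inner_diff_right inner_commute)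
  have Y: "integrable \<nu> Y" "integrable \<nu> (\<lambda>x. (norm (Y x))\<^sup>2)"
    unfolding eq using Zi Z(2) by (auto simp: Y_def[abs_def])
  have mean: "(\<integral>x. Y x \<partial>\<nu>) = 0" unfolding Y_def using Zi by (simp add: \<nu>.prob_space)
  have "(\<integral>x. (norm (Y x))\<^sup>2 \<partial>\<nu>) = (\<integral>x. (norm (Z x))\<^sup>2 \<partial>\<nu>) - (norm ?\<mu>)\<^sup>2"
    unfolding eq using Zi Z(2) by (simp add: \<nu>.prob_space power2_norm_eq_inner)
  then have var: "(\<integral>x. (norm (Y x))\<^sup>2 \<partial>\<nu>) \<le> (\<integral>x. (norm (Z x))\<^sup>2 \<partial>\<nu>)" by simp
  have sum_eq: "(norm ((1 / ?m) *\<^sub>R (\<Sum>i\<in>J. Z (y i)) - ?\<mu>))\<^sup>2 = (1 / ?m\<^sup>2) * (norm (\<Sum>i\<in>J. Y (y i)))\<^sup>2" for y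
  proof -
    have "(1 / ?m) *\<^sub>R (\<Sum>i\<in>J. Y (y i)) = (1 / ?m) *\<^sub>R (\<Sum>i\<in>J. Z (y i)) - ?\<mu>"
      unfolding Y_def using m by (simp add: sum_subtractf scaleR_diff_right sum_constant_scaleR)
    then have "(norm ((1 / ?m) *\<^sub>R (\<Sum>i\<in>J. Z (y i)) - ?\<mu>))\<^sup>2 = (norm ((1 / ?m) *\<^sub>R (\<Sum>i\<in>J. Y (y i))))\<^sup>2"
      by simp
    then show ?thesis by (simp add: power_mult_distrib power_divide)
  qed
  have "(\<integral>\<^sup>+y. ennreal ((norm ((1 / ?m) *\<^sub>R (\<Sum>i\<in>J. Z (y i)) - ?\<mu>))\<^sup>2) \<partial>PiM J (\<lambda>_. \<nu>)) =
      (\<integral>\<^sup>+y. ennreal (1 / ?m\<^sup>2) * ennreal ((norm (\<Sum>i\<in>J. Y (y i)))\<^sup>2) \<partial>PiM J (\<lambda>_. \<nu>))"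
    unfolding sum_eq by (intro nn_integral_cong ennreal_mult) simp_all
  also have "... = ennreal (1 / ?m\<^sup>2) * (\<integral>\<^sup>+y. ennreal ((norm (\<Sum>i\<in>J. Y (y i)))\<^sup>2) \<partial>PiM J (\<lambda>_. \<nu>))"
    by (intro nn_integral_cmult) measurable
  also have "... = ennreal (1 / ?m\<^sup>2 * (?m * (\<integral>x. (norm (Y x))\<^sup>2 \<partial>\<nu>)))"
    unfolding nn_integral_norm_sum_PiM[OF \<nu> Y mean J(1)] by (rule ennreal_mult[symmetric]) auto
  also have "... \<le> ennreal ((\<integral>x. (norm (Z x))\<^sup>2 \<partial>\<nu>) / ?m)"
    using m var by (intro ennreal_leI) (simp add: power2_eq_square divide_right_mono)
  finally show ?thesis .
qed

section \<open>One projected step\<close>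

lemma GDERIV_line:
  assumes "GDERIV g (x + t *\<^sub>R v) :> D"
  shows "((\<lambda>t. g (x + t *\<^sub>R v)) has_real_derivative inner D v) (at t)"
proof -
  have "((\<lambda>t. x + t *\<^sub>R v) has_derivative (\<lambda>h. h *\<^sub>R v)) (at t)"
    by (auto intro!: derivative_eq_intros)
  from has_derivative_compose[OF this] assms
  have "((\<lambda>t. g (x + t *\<^sub>R v)) has_derivative (\<lambda>h. inner (h *\<^sub>R v) D)) (at t)"
    unfolding gderiv_def by blast
  then show ?thesis
    unfolding has_field_derivative_def by (simp add: inner_commute mult.commute[of _ "inner _ _"])
qed

lemma GDERIV_quotient:
  assumes "GDERIV g x :> D"
  shows "((\<lambda>t. (g (x + t *\<^sub>R v) - g x) / t) \<longlongrightarrow> inner D v) (at 0)"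
  using GDERIV_line[of g x 0 v D] assms by (simp add: DERIV_def)

text \<open>Along the segment from \<open>x\<close> to \<open>y\<close>, \<open>?\<phi>\<close> is
  \<open>g\<close> minus its quadratic upper model up to a constant. Its derivative at
  \<open>t\<close> is \<open>inner (D z - D x) (y - x)\<close> minus \<open>L * t\<close> times the
  squared length, with \<open>z\<close> the point at \<open>t\<close>, and the Lipschitz bound makes
  this nonpositive.\<close>

lemma descent_lemma:
  fixes g :: "'a::real_inner \<Rightarrow> real"
  assumes B: "convex B" "x \<in> B" "y \<in> B"
    and D: "\<And>z. z \<in> B \<Longrightarrow> GDERIV g z :> D z"
    and L: "\<And>z. z \<in> B \<Longrightarrow> norm (D z - D x) \<le> L * norm (z - x)"
  shows "g y \<le> g x + inner (D x) (y - x) + L / 2 * (norm (y - x))\<^sup>2"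
proof -
  let ?v = "y - x"
  let ?\<phi> = "\<lambda>t. g (x + t *\<^sub>R ?v) - t * inner (D x) ?v - L / 2 * (norm ?v)\<^sup>2 * t\<^sup>2"
  have "?\<phi> 1 \<le> ?\<phi> 0"
  proof (rule DERIV_nonpos_imp_nonincreasing[of 0 1 ?\<phi>])
    fix t :: real assume t: "0 \<le> t" "t \<le> 1"
    let ?z = "x + t *\<^sub>R ?v"
    have z: "?z \<in> B"
      using convexD_alt[OF B t] by (simp add: algebra_simps)
    have "(?\<phi> has_real_derivative inner (D ?z) ?v - inner (D x) ?v - L * (norm ?v)\<^sup>2 * t) (at t)"
      by (auto intro!: derivative_eq_intros GDERIV_line D z)
    moreover have "inner (D ?z - D x) ?v \<le> L * (norm ?v)\<^sup>2 * t"
    proof -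
      have "inner (D ?z - D x) ?v \<le> norm (D ?z - D x) * norm ?v" by (rule norm_cauchy_schwarz)
      also have "... \<le> L * norm (?z - x) * norm ?v"
        by (intro mult_right_mono L z) simp
      finally show ?thesis using t by (simp add: power2_eq_square mult_ac)
    qed
    ultimately show "\<exists>d. (?\<phi> has_real_derivative d) (at t) \<and> d \<le> 0"
      by (intro exI[of _ "inner (D ?z) ?v - inner (D x) ?v - L * (norm ?v)\<^sup>2 * t"])
        (simp add: inner_diff_left)
  qed simp
  then show ?thesis by simp
qed

text \<open>Proximal normals are Frechet normals: expanding the square in
  \<open>dist x y \<le> dist x z\<close> bounds \<open>inner (x - y) (z - y)\<close> by
  \<open>(norm (z - y))\<^sup>2 / 2\<close>, and divided by \<open>norm (z - y)\<close> this tends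
  to 0.\<close>

lemma projection_frechet_normal:
  fixes x y :: "'a::real_inner"
  assumes y: "y \<in> projection A x" and c: "0 \<le> c"
  shows "c *\<^sub>R (x - y) \<in> frechet_normal_cone y A"
proof -
  have le: "inner (c *\<^sub>R (x - y)) (z - y) \<le> c / 2 * (norm (z - y))\<^sup>2" if "z \<in> A" for z
  proof -
    have "dist x y \<le> dist x z" using y that by (simp add: projection_def)
    then have "(norm (x - y))\<^sup>2 \<le> (norm ((x - y) - (z - y)))\<^sup>2" by (simp add: dist_norm)
    also have "... = (norm (x - y))\<^sup>2 - 2 * inner (x - y) (z - y) + (norm (z - y))\<^sup>2"
      by (simp only: power2_norm_eq_inner inner_diff_left inner_diff_right inner_commute) simp
    finally have "inner (x - y) (z - y) \<le> (norm (z - y))\<^sup>2 / 2" by simp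
    from mult_left_mono[OF this c] show ?thesis by simp
  qed
  have "\<forall>\<^sub>F z in at y within A. ereal (inner (c *\<^sub>R (x - y)) (z - y) / norm (z - y)) < e"
    if "0 < e" for e :: ereal
  proof -
    obtain r where r: "0 < r" "ereal r \<le> e"
      using \<open>0 < e\<close> by (cases e) (auto intro: that[of "1"])
    have "\<forall>\<^sub>F z in at y within A. c / 2 * norm (z - y) < r"
    proof (rule order_tendstoD)
      have "((\<lambda>z. c / 2 * norm (z - y)) \<longlongrightarrow> c / 2 * norm (y - y)) (at y within A)"
        by (intro tendsto_intros)
      then show "((\<lambda>z. c / 2 * norm (z - y)) \<longlongrightarrow> 0) (at y within A)" by simp
    qed (fact r)
    moreover have "\<forall>\<^sub>F z in at y within A. z \<in> A \<and> z \<noteq> y"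
      by (auto simp: eventually_at_filter)
    ultimately show ?thesis
    proof eventually_elim
      case (elim z)
      then have n: "0 < norm (z - y)" by simp
      have "inner (c *\<^sub>R (x - y)) (z - y) \<le> c / 2 * norm (z - y) * norm (z - y)"
        using le[of z] elim by (simp add: power2_eq_square)
      then have "inner (c *\<^sub>R (x - y)) (z - y) / norm (z - y) \<le> c / 2 * norm (z - y)"
        using n by (simp only: pos_divide_le_eq)
      then have "inner (c *\<^sub>R (x - y)) (z - y) / norm (z - y) < r" using elim by linarith
      then show ?case using r(2) by (meson ereal_less_eq(3) less_ereal.simps(1) less_le_trans)
    qed
  qed
  then show ?thesis
    unfolding frechet_normal_cone_def by (simp only: mem_Collect_eq Limsup_le_iff) blast
qed

lemma frechet_subset_mordukhovich:
  "w \<in> A \<Longrightarrow> frechet_normal_cone w A \<subseteq> mordukhovich_normal_cone w A"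
  unfolding mordukhovich_normal_cone_def
  by (auto intro!: exI[of _ "\<lambda>_. w"] exI[of _ "\<lambda>_. y" for y])

text \<open>With \<open>q = 1 / \<eta>\<close>: the optimality of the projection against the competitor \<open>w\<close> and the descent
  inequality bound \<open>inner (G - D) (w' - w)\<close>; the weights \<open>3 / 2\<close> and \<open>3\<close> of the two error terms and
  the weights \<open>L / 4\<close> and \<open>1 / L\<close> of the final cross term produce the constants.\<close>

lemma projected_step_bound:
  fixes w w' G D D' :: "'a::real_inner"
  assumes L: "0 < L" and \<rho>: "1 < \<rho>" and \<eta>: "\<eta> = 2 / (3 * \<rho> * L)"
    and w: "w \<in> A" and w': "w' \<in> projection A (w - \<eta> *\<^sub>R G)"
    and desc: "g' \<le> g + inner D (w' - w) + L / 2 * (norm (w' - w))\<^sup>2"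
    and lip: "norm (D' - D) \<le> L * norm (w' - w)"
  shows "(norm (D' + (1 / \<eta>) *\<^sub>R (w - \<eta> *\<^sub>R G - w')))\<^sup>2 \<le>
    (2 * (1 + 3 * \<rho>) / (\<rho> - 1) + 3 * \<rho>) * L * (g - g') +
    (2 * (1 + 3 * \<rho>) / (\<rho> - 1) + 3) * (norm (G - D))\<^sup>2"
proof -
  let ?k = "2 * (1 + 3 * \<rho>) / (\<rho> - 1)"
  define q where "q = 3 * \<rho> * L / 2"
  define a where "a = D' - D"
  define b where "b = G - D"
  define v where "v = w' - w"
  let ?X = "inner v v" and ?P = "inner b v" and ?N = "inner b b"
  have q: "0 < q" "1 / \<eta> = q" using L \<rho> by (simp_all add: q_def \<eta>)
  have \<eta>0: "0 < \<eta>" using L \<rho> by (simp add: \<eta>)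
  have opt: "inner G v \<le> - q / 2 * ?X"
  proof -
    have "norm (w - \<eta> *\<^sub>R G - w') \<le> norm (w - \<eta> *\<^sub>R G - w)"
      using w w' unfolding projection_def dist_norm by blast
    moreover have "w - \<eta> *\<^sub>R G - w' = - (v + \<eta> *\<^sub>R G)" "w - \<eta> *\<^sub>R G - w = - (\<eta> *\<^sub>R G)"
      by (simp_all add: v_def)
    ultimately have "norm (v + \<eta> *\<^sub>R G) \<le> norm (\<eta> *\<^sub>R G)" by (simp only: norm_minus_cancel)
    then have "(norm (v + \<eta> *\<^sub>R G))\<^sup>2 \<le> (norm (\<eta> *\<^sub>R G))\<^sup>2"
      by (rule power_mono) simp
    then have "?X + 2 * \<eta> * inner G v \<le> 0"
      unfolding power2_norm_eq_inner by (simp add: inner_add_left inner_add_right inner_commute)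
    then have "inner G v \<le> - ?X / (2 * \<eta>)" using \<eta>0 by (simp add: field_simps)
    also have "... = - q / 2 * ?X" using q(2) \<eta>0 by (simp add: field_simps)
    finally show ?thesis .
  qed
  have P: "?P \<le> (g - g') - (q - L) / 2 * ?X"
  proof -
    have "?P = inner G v - inner D v" by (simp add: b_def inner_diff_left)
    moreover have "g' \<le> g + inner D v + L / 2 * ?X"
      using desc by (simp add: v_def power2_norm_eq_inner)
    moreover have "(q - L) / 2 * ?X = q / 2 * ?X - L / 2 * ?X"
      by (simp add: algebra_simps diff_divide_distrib)
    ultimately show ?thesis using opt by linarith
  qed
  have aX: "(norm a)\<^sup>2 \<le> L\<^sup>2 * ?X"
    using power_mono[OF lip, of 2] by (simp add: a_def v_def power_mult_distrib power2_norm_eq_inner)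
  have "\<bar>inner a v\<bar> \<le> norm a * norm v" by (rule Cauchy_Schwarz_ineq2)
  also have "... \<le> (L * norm v) * norm v"
    using lip by (intro mult_right_mono) (simp_all add: a_def v_def)
  finally have av: "- inner a v \<le> L * ?X" by (simp add: power2_norm_eq_inner[symmetric] power2_eq_square)
  \<comment> \<open>The right side exceeds the left by exactly half the squared norm of
    \<open>a + 2 *\<^sub>R b\<close>.\<close>
  have ad: "(norm (a - b))\<^sup>2 \<le> 3 / 2 * (norm a)\<^sup>2 + 3 * ?N"
  proof -
    have "0 \<le> (norm (a + 2 *\<^sub>R b))\<^sup>2 / 2" by simp
    then show ?thesis
      by (simp add: power2_norm_eq_inner inner_add_left inner_add_right inner_diff_left inner_diff_right inner_commute)
  qed
  \<comment> \<open>Completing the square of \<open>(L / 2) *\<^sub>R v + b\<close>. The weight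
    \<open>L / 4\<close> is small enough to be absorbed by the term \<open>(q - L) / 2\<close> of
    \<open>P\<close>.\<close>
  have young: "- ?P \<le> L / 4 * ?X + ?N / L"
  proof -
    have "0 \<le> (norm ((L / 2) *\<^sub>R v + b))\<^sup>2 / L" using L by simp
    also have "... = (L\<^sup>2 / 4 * ?X + L * ?P + ?N) / L"
      unfolding power2_norm_eq_inner
      by (simp add: inner_add_left inner_add_right inner_commute power2_eq_square)
    also have "... = L / 4 * ?X + ?P + ?N / L"
      using L by (simp add: add_divide_distrib power2_eq_square)
    finally show ?thesis by simp
  qed
  \<comment> \<open>\<open>D' - G\<close> is \<open>a - b\<close>, and the projection displacement
    contributes \<open>- q *\<^sub>R v\<close>.\<close>
  have res: "D' + (1 / \<eta>) *\<^sub>R (w - \<eta> *\<^sub>R G - w') = (a - b) - q *\<^sub>R v"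
    unfolding q(2)[symmetric] using \<eta>0 by (simp add: a_def b_def v_def algebra_simps)
  have "(norm ((a - b) - q *\<^sub>R v))\<^sup>2 = (norm (a - b))\<^sup>2 + q\<^sup>2 * ?X + 2 * q * (- inner a v) + 2 * q * ?P"
  proof -
    have "(norm (y - q *\<^sub>R v))\<^sup>2 = (norm y)\<^sup>2 + q\<^sup>2 * ?X - 2 * q * inner y v" for y
      unfolding power2_norm_eq_inner
      by (simp add: inner_diff_left inner_diff_right inner_commute power2_eq_square)
    then have "(norm ((a - b) - q *\<^sub>R v))\<^sup>2 = (norm (a - b))\<^sup>2 + q\<^sup>2 * ?X - 2 * q * (inner a v - ?P)"
      by (simp only: inner_diff_left)
    then show ?thesis by (simp only: right_diff_distrib mult_minus_right)
  qed
  also have "... \<le> (3 / 2 * (L\<^sup>2 * ?X) + 3 * ?N) + q\<^sup>2 * ?X + 2 * q * (L * ?X) +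
      2 * q * ((g - g') - (q - L) / 2 * ?X)"
    using ad aX av P q(1) by (intro add_mono mult_left_mono) auto
  \<comment> \<open>The terms with \<open>q\<^sup>2\<close> cancel: the decrease obtained from
    \<open>P\<close> consumes the squared step term.\<close>
  also have "... = 3 * ?N + 2 * q * (g - g') + (3 / 2 * L\<^sup>2 + 3 * q * L) * ?X"
    by (simp add: field_simps power2_eq_square)
  also have "... = 3 * ?N + 3 * \<rho> * L * (g - g') + 3 / 2 * L\<^sup>2 * (1 + 3 * \<rho>) * ?X"
    by (simp add: q_def algebra_simps power2_eq_square)
  finally have main: "(norm ((a - b) - q *\<^sub>R v))\<^sup>2 \<le>
      3 * ?N + 3 * \<rho> * L * (g - g') + 3 / 2 * L\<^sup>2 * (1 + 3 * \<rho>) * ?X" .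
  \<comment> \<open>\<open>(q - L) / 2 - L / 4\<close> equals
    \<open>3 / 4 * L * (\<rho> - 1)\<close>. Positivity of this coefficient is what
    \<open>\<rho> > 1\<close> is for: it turns the bound on \<open>?P\<close> into a bound on the
    squared step length.\<close>
  have X: "3 / 4 * L * (\<rho> - 1) * ?X \<le> (g - g') + ?N / L"
  proof -
    have "3 / 4 * L * (\<rho> - 1) * ?X = (q - L) / 2 * ?X - L / 4 * ?X"
      by (simp add: q_def field_simps)
    then show ?thesis using P young by linarith
  qed
  \<comment> \<open>Trading the squared step length for decrease and error divides by
    \<open>\<rho> - 1\<close> and creates the summand \<open>?k\<close> that both constants
    share.\<close>
  have "3 / 2 * L\<^sup>2 * (1 + 3 * \<rho>) * ?X = 2 * L * (1 + 3 * \<rho>) / (\<rho> - 1) * (3 / 4 * L * (\<rho> - 1) * ?X)"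
    using \<rho> by (simp add: field_simps power2_eq_square)
  also have "... \<le> 2 * L * (1 + 3 * \<rho>) / (\<rho> - 1) * ((g - g') + ?N / L)"
    using X \<rho> L by (intro mult_left_mono) auto
  also have "... = ?k * L * ((g - g') + ?N / L)" by simp
  also have "... = ?k * L * (g - g') + ?k * ?N"
    using L by (simp only: distrib_left) simp
  finally have Y: "3 / 2 * L\<^sup>2 * (1 + 3 * \<rho>) * ?X \<le> ?k * L * (g - g') + ?k * ?N" .
  have N: "(norm (G - D))\<^sup>2 = ?N" by (simp only: b_def power2_norm_eq_inner)
  show ?thesis
    unfolding res N distrib_right using main Y by linarith
qed

section \<open>Measurability of the distance to a set-valued map\<close>

text \<open>A class stable under countable unions, products, intersection with closed sets and
  continuous images, whose members are Borel in Hausdorff spaces. Stability under projections is the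
  property that plain Borel sets do not have.\<close>

definition sigma_compact :: "'a::topological_space set \<Rightarrow> bool" where
  "sigma_compact S \<longleftrightarrow> (\<exists>C :: nat \<Rightarrow> 'a set. (\<forall>n. compact (C n)) \<and> S = (\<Union>n. C n))"

lemma sigma_compact_UN: "(\<And>n::nat. compact (C n)) \<Longrightarrow> S = (\<Union>n. C n) \<Longrightarrow> sigma_compact S"
  unfolding sigma_compact_def by (intro exI[of _ C] conjI allI)

lemma sigma_compactI:
  fixes A :: "'i \<Rightarrow> 'a::topological_space set"
  assumes "countable I" "\<And>i. i \<in> I \<Longrightarrow> sigma_compact (A i)"
  shows "sigma_compact (\<Union>i\<in>I. A i)"
proof (cases "I = {}")
  case True
  then show ?thesis unfolding sigma_compact_def by (intro exI[of _ "\<lambda>_. {}"]) simp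
next
  case False
  have "\<forall>i\<in>I. \<exists>C. (\<forall>n::nat. compact (C n)) \<and> A i = (\<Union>n. C n)"
    using assms(2) unfolding sigma_compact_def by blast
  from bchoice[OF this] obtain C :: "'i \<Rightarrow> nat \<Rightarrow> 'a set"
    where "\<forall>i\<in>I. (\<forall>n. compact (C i n)) \<and> A i = (\<Union>n. C i n)" ..
  then have C: "\<And>i n. i \<in> I \<Longrightarrow> compact (C i n)" "\<And>i. i \<in> I \<Longrightarrow> A i = (\<Union>n. C i n)"
    by blast+
  let ?i = "from_nat_into I"
  let ?C = "\<lambda>k. C (?i (fst (prod_decode k))) (snd (prod_decode k))"
  have r: "range ?i = I" using range_from_nat_into[OF False assms(1)] .
  have "(\<Union>i\<in>I. A i) = (\<Union>k. ?C k)"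
  proof (intro set_eqI iffI)
    fix x assume "x \<in> (\<Union>i\<in>I. A i)"
    then obtain i n where "i \<in> I" "x \<in> C i n" using C(2) by blast
    moreover obtain m where "?i m = i" using r \<open>i \<in> I\<close> by (metis imageE)
    ultimately have "x \<in> ?C (prod_encode (m, n))" by simp
    then show "x \<in> (\<Union>k. ?C k)" by blast
  next
    fix x assume "x \<in> (\<Union>k. ?C k)"
    then obtain k where "x \<in> ?C k" by blast
    moreover have "?i (fst (prod_decode k)) \<in> I" using r by blast
    ultimately show "x \<in> (\<Union>i\<in>I. A i)" using C(2) by blast
  qed
  moreover have "compact (?C k)" for k using r by (intro C(1)) blast
  ultimately show ?thesis unfolding sigma_compact_def by (intro exI[of _ ?C] conjI allI)
qed

lemma compact_imp_sigma_compact: "compact S \<Longrightarrow> sigma_compact S"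
  unfolding sigma_compact_def by (intro exI[of _ "\<lambda>_. S"]) simp

lemma closed_imp_sigma_compact:
  fixes S :: "'a::heine_borel set"
  assumes "closed S"
  shows "sigma_compact S"
proof -
  fix a :: 'a
  have "S = (\<Union>n::nat. S \<inter> cball a (real n))"
    using real_arch_simple by fastforce
  moreover have "compact (S \<inter> cball a (real n))" for n
    using assms by (simp add: closed_Int_compact)
  ultimately show ?thesis by (rule sigma_compact_UN[rotated])
qed

lemma sigma_compact_closed_Int:
  assumes "closed T" "sigma_compact S"
  shows "sigma_compact (T \<inter> S)"
proof -
  obtain C where C: "\<And>n::nat. compact (C n)" "S = (\<Union>n. C n)"
    using assms(2) unfolding sigma_compact_def by blast
  have "T \<inter> S = (\<Union>n. T \<inter> C n)" using C(2) by blast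
  moreover have "compact (T \<inter> C n)" for n using assms(1) C(1) by (rule closed_Int_compact)
  ultimately show ?thesis by (rule sigma_compact_UN[rotated])
qed

lemma sigma_compact_image:
  assumes "continuous_on S f" "sigma_compact S"
  shows "sigma_compact (f ` S)"
proof -
  obtain C where C: "\<And>n::nat. compact (C n)" "S = (\<Union>n. C n)"
    using assms(2) unfolding sigma_compact_def by blast
  have "f ` S = (\<Union>n. f ` C n)" using C(2) by blast
  moreover have "compact (f ` C n)" for n
    using C by (intro compact_continuous_image continuous_on_subset[OF assms(1)]) auto
  ultimately show ?thesis by (rule sigma_compact_UN[rotated])
qed

lemma sigma_compact_Times:
  assumes "sigma_compact S" "sigma_compact T"
  shows "sigma_compact (S \<times> T)"
proof -
  obtain C where C: "\<And>n::nat. compact (C n)" "S = (\<Union>n. C n)"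
    using assms(1) unfolding sigma_compact_def by blast
  obtain D where D: "\<And>n::nat. compact (D n)" "T = (\<Union>n. D n)"
    using assms(2) unfolding sigma_compact_def by blast
  have "S \<times> T = (\<Union>m. \<Union>n. C m \<times> D n)" using C(2) D(2) by blast
  then show ?thesis
    using C(1) D(1)
    by (simp only:) (intro sigma_compactI compact_imp_sigma_compact compact_Times countableI_type)
qed

lemma sigma_compact_borel: "sigma_compact (S :: 'a::t2_space set) \<Longrightarrow> S \<in> sets borel"
proof -
  assume "sigma_compact S"
  then obtain C where C: "\<And>n::nat. compact (C n)" "S = (\<Union>n. C n)"
    unfolding sigma_compact_def by blast
  have "range C \<subseteq> sets borel" using borel_compact[OF C(1)] by blast
  then show ?thesis unfolding C(2) by (rule sets.countable_UN)
qed

text \<open>A distance below \<open>y\<close> means that some fibre point has norm at most a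
  rational \<open>q\<close> below \<open>y\<close>. The sublevel set is therefore a countable union
  of projections of sigma-compact sets.\<close>

lemma sigma_compact_graph_measurable:
  fixes \<Gamma> :: "('a::{t2_space, second_countable_topology} \<times> 'b::euclidean_space) set"
  assumes "sigma_compact \<Gamma>"
  shows "(\<lambda>w. set_dist 0 {z. (w, z) \<in> \<Gamma>}) \<in> borel_measurable borel"
proof (rule borel_measurableI_less)
  fix y :: ennreal
  let ?Q = "{q \<in> \<rat>. ennreal q < y}"
  have "{w \<in> space borel. set_dist 0 {z. (w, z) \<in> \<Gamma>} < y} = (\<Union>q\<in>?Q. fst ` ((UNIV \<times> cball 0 q) \<inter> \<Gamma>))"
    (is "?l = ?r")
  proof (intro set_eqI iffI)
    fix w assume "w \<in> ?l"
    then obtain z where z: "(w, z) \<in> \<Gamma>" "ennreal (norm z) < y"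
      unfolding set_dist_def by (auto simp: INF_less_iff)
    obtain q where "q \<in> \<rat>" "norm z \<le> q" "ennreal q < y"
    proof (cases y)
      case (real c)
      then have "norm z < c" using z(2) by (simp add: ennreal_less_iff)
      then obtain q where q: "q \<in> \<rat>" "norm z < q" "q < c" using Rats_dense_in_real by blast
      moreover have "0 \<le> q" using q(2) norm_ge_zero[of z] by linarith
      then have "ennreal q < y" using q real by (simp add: ennreal_less_iff)
      ultimately show ?thesis using that[of q] by simp
    next
      case top
      obtain n where "norm z \<le> real n" using real_arch_simple by blast
      then show ?thesis using that[of "real n"] top by simp
    qed
    then have "(w, z) \<in> (UNIV \<times> cball 0 q) \<inter> \<Gamma>" using z(1) by simp
    then have "w \<in> fst ` ((UNIV \<times> cball 0 q) \<inter> \<Gamma>)" by (rule image_eqI[rotated]) simp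
    then show "w \<in> ?r" using \<open>q \<in> \<rat>\<close> \<open>ennreal q < y\<close> by blast
  next
    fix w assume "w \<in> ?r"
    then obtain q z where "ennreal q < y" "norm z \<le> q" "(w, z) \<in> \<Gamma>" by auto
    then have "ennreal (norm z) < y" by (meson ennreal_leI le_less_trans)
    then show "w \<in> ?l" using \<open>(w, z) \<in> \<Gamma>\<close> unfolding set_dist_def by (auto simp: INF_less_iff)
  qed
  moreover have "sigma_compact (fst ` ((UNIV \<times> cball 0 q) \<inter> \<Gamma>))" for q
    using assms by (intro sigma_compact_image sigma_compact_closed_Int closed_Times continuous_intros) auto
  then have "fst ` ((UNIV \<times> cball 0 q) \<inter> \<Gamma>) \<in> sets borel" for q by (rule sigma_compact_borel)
  moreover have "countable ?Q" using countable_rat by (rule countable_subset[rotated]) auto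
  ultimately show "{w \<in> space borel. set_dist 0 {z. (w, z) \<in> \<Gamma>} < y} \<in> sets borel"
    by (simp only:) (intro sets.countable_UN', auto)
qed

text \<open>The fibrewise sum is a continuous image of the part of the product on which the two base
  points agree, and that condition is closed.\<close>

lemma sigma_compact_graph_sum:
  fixes \<Gamma>\<^sub>1 \<Gamma>\<^sub>2 :: "('a::euclidean_space \<times> 'b::euclidean_space) set"
  assumes "sigma_compact \<Gamma>\<^sub>1" "sigma_compact \<Gamma>\<^sub>2"
  shows "sigma_compact {(w, g + y) | w g y. (w, g) \<in> \<Gamma>\<^sub>1 \<and> (w, y) \<in> \<Gamma>\<^sub>2}"
proof -
  let ?D = "{p :: ('a \<times> 'b) \<times> ('a \<times> 'b). fst (fst p) = fst (snd p)}"
  let ?f = "\<lambda>p :: ('a \<times> 'b) \<times> ('a \<times> 'b). (fst (fst p), snd (fst p) + snd (snd p))"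
  have "{(w, g + y) | w g y. (w, g) \<in> \<Gamma>\<^sub>1 \<and> (w, y) \<in> \<Gamma>\<^sub>2} = ?f ` (?D \<inter> \<Gamma>\<^sub>1 \<times> \<Gamma>\<^sub>2)"
  proof (intro set_eqI iffI)
    fix p assume "p \<in> {(w, g + y) | w g y. (w, g) \<in> \<Gamma>\<^sub>1 \<and> (w, y) \<in> \<Gamma>\<^sub>2}"
    then obtain w g y where p: "p = (w, g + y)" "(w, g) \<in> \<Gamma>\<^sub>1" "(w, y) \<in> \<Gamma>\<^sub>2" by blast
    then show "p \<in> ?f ` (?D \<inter> \<Gamma>\<^sub>1 \<times> \<Gamma>\<^sub>2)"
      by (intro image_eqI[of _ _ "((w, g), (w, y))"]) auto
  next
    fix p assume "p \<in> ?f ` (?D \<inter> \<Gamma>\<^sub>1 \<times> \<Gamma>\<^sub>2)"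
    then obtain w g y where "p = (w, g + y)" "(w, g) \<in> \<Gamma>\<^sub>1" "(w, y) \<in> \<Gamma>\<^sub>2" by auto
    then show "p \<in> {(w, g + y) | w g y. (w, g) \<in> \<Gamma>\<^sub>1 \<and> (w, y) \<in> \<Gamma>\<^sub>2}" by blast
  qed
  moreover have "closed ?D" by (intro closed_Collect_eq continuous_intros)
  then have "sigma_compact (?f ` (?D \<inter> \<Gamma>\<^sub>1 \<times> \<Gamma>\<^sub>2))"
    using assms by (intro sigma_compact_image sigma_compact_closed_Int sigma_compact_Times continuous_intros)
  ultimately show ?thesis by simp
qed

text \<open>A finite convex combination is built by adding one point of \<open>S\<close> at a time;
  each addition is one binary mixture and moves from \<open>H k\<close> to
  \<open>H (Suc k)\<close>.\<close>

lemma convex_hull_subset_iterates: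
  fixes H :: "nat \<Rightarrow> 'b::euclidean_space set"
  assumes base: "H 0 = S"
    and step: "\<And>k a b t. a \<in> H k \<Longrightarrow> b \<in> S \<Longrightarrow> 0 \<le> t \<Longrightarrow> t \<le> 1 \<Longrightarrow> (1 - t) *\<^sub>R a + t *\<^sub>R b \<in> H (Suc k)"
  shows "convex hull S \<subseteq> (\<Union>k. H k)"
proof
  fix z assume "z \<in> convex hull S"
  \<comment> \<open>The Caratheodory theorem serves here to reduce to a finite \<open>T\<close>; the
    bound on its size is dropped.\<close>
  then obtain T where T: "finite T" "T \<subseteq> S" "z \<in> convex hull T"
    unfolding caratheodory[of S] by blast
  have "convex hull T \<subseteq> (\<Union>k. H k)"
    using T(1,2)
  proof (induction T)
    case (insert b T)
    show ?case
    proof (cases "T = {}")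
      case True
      then show ?thesis using insert.prems base by auto
    next
      case False
      show ?thesis
      proof
        fix x assume "x \<in> convex hull (insert b T)"
        then obtain u v a where uv: "0 \<le> u" "0 \<le> v" "u + v = 1" "a \<in> convex hull T" "x = u *\<^sub>R b + v *\<^sub>R a"
          unfolding convex_hull_insert[OF False] by blast
        then obtain k where "a \<in> H k" using insert by auto
        moreover have "b \<in> S" "u \<le> 1" using insert.prems uv by auto
        moreover have "x = (1 - u) *\<^sub>R a + u *\<^sub>R b"
        proof -
          have "v = 1 - u" using uv(3) by linarith
          then show ?thesis using uv(5) by (simp only: add.commute)
        qed
        ultimately have "x \<in> H (Suc k)" using step[of a k b u] uv(1) by (simp only:)
        then show "x \<in> (\<Union>k. H k)" by blast
      qed
    qed
  qed simp
  then show "z \<in> (\<Union>k. H k)" using T(3) by blast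
qed

text \<open>\<open>G k\<close> is the graph of \<open>k\<close>-fold mixtures: each round mixes a
  point reached so far with a fresh point over the same base point, which is a continuous image of a
  sigma-compact set. The hull is the countable union of these graphs.\<close>

lemma sigma_compact_graph_convex_hull:
  fixes \<Phi> :: "'a::euclidean_space \<Rightarrow> 'b::euclidean_space set"
  assumes \<Phi>: "sigma_compact {(w, z). z \<in> \<Phi> w}"
  shows "sigma_compact {(w, z). z \<in> convex hull \<Phi> w}"
proof -
  let ?\<Gamma> = "{(w, z). z \<in> \<Phi> w}"
  let ?D = "{p :: (('a \<times> 'b) \<times> ('a \<times> 'b)) \<times> real. fst (fst (fst p)) = fst (snd (fst p))}"
  let ?f = "\<lambda>p :: (('a \<times> 'b) \<times> ('a \<times> 'b)) \<times> real.
    (fst (fst (fst p)), (1 - snd p) *\<^sub>R snd (fst (fst p)) + snd p *\<^sub>R snd (snd (fst p)))"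
  define G where "G = rec_nat ?\<Gamma> (\<lambda>_ X. ?f ` (?D \<inter> (X \<times> ?\<Gamma>) \<times> {0..1}))"
  have G0: "G 0 = ?\<Gamma>" and GS: "G (Suc k) = ?f ` (?D \<inter> (G k \<times> ?\<Gamma>) \<times> {0..1})" for k
    by (simp_all add: G_def)
  have D: "closed ?D" by (intro closed_Collect_eq continuous_intros)
  have I: "sigma_compact {0..1 :: real}" by (intro compact_imp_sigma_compact compact_Icc)
  have sc: "sigma_compact (G k)" for k
  proof (induction k)
    case (Suc k)
    show ?case unfolding GS
      by (intro sigma_compact_image sigma_compact_closed_Int sigma_compact_Times continuous_intros D I \<Phi> Suc.IH)
  qed (simp add: G0 \<Phi>)
  have 1: "z \<in> convex hull \<Phi> w" if "(w, z) \<in> G k" for w z k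
    using that
  proof (induction k arbitrary: z)
    case (Suc k)
    then obtain p where p: "p \<in> ?D \<inter> (G k \<times> ?\<Gamma>) \<times> {0..1}" "(w, z) = ?f p"
      unfolding GS by blast
    obtain w1 a w2 b t where pe: "p = (((w1, a), (w2, b)), t)" by (metis surj_pair)
    have *: "(w, a) \<in> G k" "b \<in> \<Phi> w" "0 \<le> t" "t \<le> 1" "z = (1 - t) *\<^sub>R a + t *\<^sub>R b"
      using p unfolding pe by auto
    have "a \<in> convex hull \<Phi> w" using Suc.IH *(1) by blast
    moreover have "b \<in> convex hull \<Phi> w" using *(2) by (rule hull_inc)
    ultimately show ?case
      unfolding *(5) using *(3,4) by (intro convexD_alt convex_convex_hull)
  qed (simp add: G0 hull_inc)
  have 2: "convex hull \<Phi> w \<subseteq> (\<Union>k. {z. (w, z) \<in> G k})" for w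
  proof (rule convex_hull_subset_iterates)
    show "{z. (w, z) \<in> G 0} = \<Phi> w" by (simp add: G0)
    fix k a b and t :: real assume "a \<in> {z. (w, z) \<in> G k}" "b \<in> \<Phi> w" "0 \<le> t" "t \<le> 1"
    then have "(((w, a), (w, b)), t) \<in> ?D \<inter> (G k \<times> ?\<Gamma>) \<times> {0..1}" by simp
    then have "?f (((w, a), (w, b)), t) \<in> G (Suc k)" unfolding GS by (rule imageI)
    then show "(1 - t) *\<^sub>R a + t *\<^sub>R b \<in> {z. (w, z) \<in> G (Suc k)}" by simp
  qed
  have "{(w, z). z \<in> convex hull \<Phi> w} = (\<Union>k. G k)"
  proof (intro set_eqI iffI)
    fix p assume "p \<in> {(w, z). z \<in> convex hull \<Phi> w}"
    then have "snd p \<in> convex hull \<Phi> (fst p)" by (simp add: case_prod_unfold)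
    with 2[of "fst p"] obtain k where "(fst p, snd p) \<in> G k" by blast
    then show "p \<in> (\<Union>k. G k)" by auto
  next
    fix p assume "p \<in> (\<Union>k. G k)"
    then obtain k where "(fst p, snd p) \<in> G k" by auto
    from 1[OF this] show "p \<in> {(w, z). z \<in> convex hull \<Phi> w}" by (simp add: case_prod_unfold)
  qed
  moreover have "sigma_compact (\<Union>k. G k)" by (rule sigma_compactI) (auto intro: sc)
  ultimately show ?thesis by simp
qed

text \<open>By its sequential definition the Mordukhovich cone has as graph the closure of the graph
  of the Frechet cone over \<open>A\<close>.\<close>

lemma closed_mordukhovich_graph:
  "closed {(w, y). y \<in> mordukhovich_normal_cone w (A :: 'a::euclidean_space set)}"
proof -
  let ?\<Gamma> = "{(x, y). x \<in> A \<and> y \<in> frechet_normal_cone x A}"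
  have "{(w, y). y \<in> mordukhovich_normal_cone w A} = closure ?\<Gamma>"
  proof (intro set_eqI iffI)
    fix p assume "p \<in> {(w, y). y \<in> mordukhovich_normal_cone w A}"
    then obtain w y x ys where p: "p = (w, y)" and *: "\<And>k. x k \<in> A \<and> ys k \<in> frechet_normal_cone (x k) A"
      "x \<longlonglongrightarrow> w" "ys \<longlonglongrightarrow> y"
      unfolding mordukhovich_normal_cone_def by auto
    then show "p \<in> closure ?\<Gamma>"
      unfolding closure_sequential p
      by (intro exI[of _ "\<lambda>k. (x k, ys k)"]) (auto intro: tendsto_Pair)
  next
    fix p assume "p \<in> closure ?\<Gamma>"
    then obtain q where q: "\<And>k. q k \<in> ?\<Gamma>" "q \<longlonglongrightarrow> p"
      unfolding closure_sequential by blast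
    have "\<forall>k. fst (q k) \<in> A \<and> snd (q k) \<in> frechet_normal_cone (fst (q k)) A"
      using q(1) by (simp add: case_prod_unfold)
    then have "snd p \<in> mordukhovich_normal_cone (fst p) A"
      unfolding mordukhovich_normal_cone_def mem_Collect_eq
      using tendsto_fst[OF q(2)] tendsto_snd[OF q(2)]
      by (intro exI[of _ "\<lambda>k. fst (q k)"] exI[of _ "\<lambda>k. snd (q k)"] conjI)
    then show "p \<in> {(w, y). y \<in> mordukhovich_normal_cone w A}"
      by (simp add: case_prod_unfold)
  qed
  then show ?thesis by simp
qed

section \<open>Clarke subdifferentials\<close>

text \<open>With its converse below, this replaces the extended real upper limit by one radius
  \<open>h\<close> for both the base point and the step length.\<close>

lemma clarke_dir_deriv_lessD:
  assumes "clarke_dir_deriv f x v < ereal c"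
  shows "\<exists>h>0. \<forall>y t. dist y x < h \<longrightarrow> 0 < t \<longrightarrow> t < h \<longrightarrow> (f (y + t *\<^sub>R v) - f y) / t < c"
proof -
  have "\<forall>\<^sub>F (y, t) in nhds x \<times>\<^sub>F at_right 0. (f (y + t *\<^sub>R v) - f y) / t < c"
    using Limsup_lessD[OF assms[unfolded clarke_dir_deriv_def]] by (simp add: case_prod_unfold)
  then obtain P Q where P: "eventually P (nhds x)" and Q: "eventually Q (at_right (0::real))"
    and PQ: "\<And>y t. P y \<Longrightarrow> Q t \<Longrightarrow> (f (y + t *\<^sub>R v) - f y) / t < c"
    unfolding eventually_prod_filter by auto
  obtain a where a: "0 < a" "\<And>y. dist y x < a \<Longrightarrow> P y"
    using P unfolding eventually_nhds_metric by auto
  obtain b where b: "0 < b" "\<And>t. 0 < t \<Longrightarrow> t < b \<Longrightarrow> Q t"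
    using Q unfolding eventually_at_right_field by auto
  show ?thesis using a b PQ by (intro exI[of _ "min a b"]) auto
qed

lemma clarke_dir_deriv_leI:
  assumes "0 < h" "\<And>y t. dist y x < h \<Longrightarrow> 0 < t \<Longrightarrow> t < h \<Longrightarrow> (f (y + t *\<^sub>R v) - f y) / t \<le> c"
  shows "clarke_dir_deriv f x v \<le> ereal c"
  unfolding clarke_dir_deriv_def
proof (rule Limsup_bounded)
  have "\<forall>\<^sub>F y in nhds x. dist y x < h"
    unfolding eventually_nhds_metric using assms(1) by blast
  moreover have "\<forall>\<^sub>F t in at_right 0. 0 < t \<and> t < h"
    unfolding eventually_at_right_field using assms(1) by blast
  ultimately show "\<forall>\<^sub>F p in nhds x \<times>\<^sub>F at_right 0. (case p of (y, t) \<Rightarrow> ereal ((f (y + t *\<^sub>R v) - f y) / t)) \<le> ereal c"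
    unfolding eventually_prod_filter using assms(2) by (intro exI conjI) auto
qed

text \<open>Upper semicontinuity in the base point: a bound on the quotients valid within radius
  \<open>h\<close> of \<open>x\<close> is valid around every \<open>x'\<close> in that ball, with
  radius \<open>h - dist x' x\<close>. So each violated inequality persists nearby, and the
  complement of the graph is open.\<close>

lemma closed_clarke_graph:
  "closed {(x, z). z \<in> clarke_subdifferential f (x :: 'a::real_inner)}"
proof -
  have op: "open {(x, z). clarke_dir_deriv f x v < ereal (inner z v)}" for v
  proof (subst open_subopen, intro ballI)
    fix p assume "p \<in> {(x, z). clarke_dir_deriv f x v < ereal (inner z v)}"
    then obtain x z where p: "p = (x, z)" "clarke_dir_deriv f x v < ereal (inner z v)" by auto
    obtain c where c: "clarke_dir_deriv f x v < ereal c" "ereal c < ereal (inner z v)"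
      using ereal_dense2[OF p(2)] by blast
    obtain h where h: "0 < h"
      "\<And>y t. dist y x < h \<Longrightarrow> 0 < t \<Longrightarrow> t < h \<Longrightarrow> (f (y + t *\<^sub>R v) - f y) / t < c"
      using clarke_dir_deriv_lessD[OF c(1)] by blast
    let ?T = "ball x h \<times> {z. c < inner z v}"
    have "clarke_dir_deriv f x' v < ereal (inner z' v)" if "x' \<in> ball x h" "c < inner z' v" for x' z'
    proof -
      have "clarke_dir_deriv f x' v \<le> ereal c"
      proof (rule clarke_dir_deriv_leI)
        show "0 < h - dist x' x" using that(1) by (simp add: dist_commute)
        fix y t assume "dist y x' < h - dist x' x" "0 < t" "t < h - dist x' x"
        moreover have "dist y x \<le> dist y x' + dist x' x" by (rule dist_triangle)
        moreover have "0 \<le> dist x' x" by simp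
        ultimately show "(f (y + t *\<^sub>R v) - f y) / t \<le> c"
          by (intro less_imp_le h(2)) linarith+
      qed
      also have "... < ereal (inner z' v)" using that(2) by simp
      finally show ?thesis .
    qed
    then have "?T \<subseteq> {(x, z). clarke_dir_deriv f x v < ereal (inner z v)}" by auto
    moreover have "open ?T"
      by (intro open_Times open_ball open_Collect_less continuous_intros)
    moreover have "p \<in> ?T" using p c h(1) by simp
    ultimately show "\<exists>T. open T \<and> p \<in> T \<and> T \<subseteq> {(x, z). clarke_dir_deriv f x v < ereal (inner z v)}"
      by blast
  qed
  have "{(x, z). z \<in> clarke_subdifferential f x} = (\<Inter>v. - {(x, z). clarke_dir_deriv f x v < ereal (inner z v)})"
  proof -
    have "z \<in> clarke_subdifferential f x \<longleftrightarrow> (\<forall>v. \<not> clarke_dir_deriv f x v < ereal (inner z v))" for x z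
      by (simp add: clarke_subdifferential_def not_less)
    then show ?thesis by blast
  qed
  then show ?thesis using op by (simp add: closed_INT closed_Compl)
qed

text \<open>The Hahn-Banach theorem in finite dimension, by separating the strict epigraph of \<open>p\<close> from the
  point \<open>(v0, p v0)\<close>.\<close>

lemma sublinear_support:
  fixes p :: "'a::euclidean_space \<Rightarrow> real"
  assumes add: "\<And>x y. p (x + y) \<le> p x + p y" and scale: "\<And>s x. 0 \<le> s \<Longrightarrow> p (s *\<^sub>R x) = s * p x"
  shows "\<exists>z. (\<forall>v. inner z v \<le> p v) \<and> inner z v0 = p v0"
proof -
  let ?S = "{(v, r). p v < r}" and ?T = "{(v0, p v0)}"
  have "convex ?S"
  proof (rule convexI)
    fix x y :: "'a \<times> real" and u v :: real
    assume x: "x \<in> ?S" and y: "y \<in> ?S" and uv: "0 \<le> u" "0 \<le> v" "u + v = 1"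
    have "p (u *\<^sub>R fst x + v *\<^sub>R fst y) \<le> u * p (fst x) + v * p (fst y)"
      using add[of "u *\<^sub>R fst x" "v *\<^sub>R fst y"] scale uv by simp
    also have "... < u * snd x + v * snd y"
    proof (cases "u = 0")
      case True
      then show ?thesis using y uv by auto
    next
      case False
      then have "u * p (fst x) < u * snd x" using x uv by auto
      moreover have "v * p (fst y) \<le> v * snd y" using y uv by (auto intro!: mult_left_mono)
      ultimately show ?thesis by (rule add_less_le_mono)
    qed
    finally show "u *\<^sub>R x + v *\<^sub>R y \<in> ?S" by (auto simp: case_prod_unfold)
  qed
  moreover have "(0, p 0 + 1) \<in> ?S" by simp
  then have "?S \<noteq> {}" by blast
  moreover have "?S \<inter> ?T = {}" by auto
  ultimately obtain a b where a: "a \<noteq> 0" and "\<forall>x\<in>?S. inner a x \<le> b" "\<forall>x\<in>?T. b \<le> inner a x"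
    using separating_hyperplane_sets[of ?S ?T] by auto
  then have sep: "inner (fst a) v + snd a * r \<le> inner (fst a) v0 + snd a * p v0" if "p v < r" for v r
    using that by (force simp: inner_prod_def)
  \<comment> \<open>A vertical hyperplane is impossible because \<open>p\<close> is finite
    everywhere, so the strict epigraph projects onto the whole space. That it is unbounded upwards
    then gives the sign of \<open>snd a\<close>.\<close>
  have s0: "snd a \<noteq> 0"
  proof
    assume 0: "snd a = 0"
    have "inner (fst a) (v0 + fst a) \<le> inner (fst a) v0"
      using sep[of "v0 + fst a" "p (v0 + fst a) + 1"] 0 by simp
    then have "inner (fst a) (fst a) \<le> 0" by (simp add: inner_add_right)
    then have "fst a = 0" using inner_gt_zero_iff[of "fst a"] by (metis not_less)
    then show False using a 0 by (simp add: prod_eq_iff)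
  qed
  moreover have "snd a \<le> 0"
    using sep[of v0 "p v0 + 1"] by (simp add: algebra_simps)
  ultimately have s: "snd a < 0" by simp
  define z where "z = (1 / - snd a) *\<^sub>R fst a"
  have le: "inner z v - p v \<le> inner z v0 - p v0" for v
  proof (rule field_le_epsilon)
    fix e :: real assume "0 < e"
    then have "inner (fst a) v + snd a * (p v + e) \<le> inner (fst a) v0 + snd a * p v0"
      by (intro sep) simp
    then have "(inner (fst a) v + snd a * (p v + e)) / - snd a \<le> (inner (fst a) v0 + snd a * p v0) / - snd a"
      using s by (intro divide_right_mono) auto
    then show "inner z v - p v \<le> inner z v0 - p v0 + e"
      using s by (simp add: z_def add_divide_distrib)
  qed
  \<comment> \<open>Testing with 0 and with \<open>2 *\<^sub>R v0\<close> gives the two inequalities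
    at \<open>v0\<close>, by homogeneity.\<close>
  have "p 0 = 0" using scale[of 0 0] by simp
  then have "0 \<le> inner z v0 - p v0" using le[of 0] by simp
  moreover have "inner z v0 \<le> p v0"
    using le[of "2 *\<^sub>R v0"] scale[of 2 v0] by simp
  ultimately have eq: "inner z v0 = p v0" by simp
  show ?thesis using le eq by (intro exI[of _ z]) auto
qed

text \<open>The \<open>+ 1\<close> keeps the denominator positive when \<open>v\<close> is
  0.\<close>

lemma small_step_norm:
  assumes "0 < t" "t < m / (2 * (norm v + 1))"
  shows "t * norm v < m / 2"
proof -
  have "0 < 2 * (norm v + 1)" by (simp add: add_nonneg_pos)
  then have "t * (2 * (norm v + 1)) < m" using assms(2) by (simp only: pos_less_divide_eq)
  then show ?thesis using assms(1) by (simp add: algebra_simps)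
qed

section \<open>Clarke calculus for locally Lipschitz functions\<close>

context
  fixes f :: "'a::euclidean_space \<Rightarrow> real" and L e :: real and x :: 'a
  assumes lip: "L-lipschitz_on (ball x e) f" and e: "0 < e"
begin

lemma difference_quotient_bound:
  assumes "dist y x < e / 2" "0 < t" "t < e / (2 * (norm v + 1))"
  shows "\<bar>(f (y + t *\<^sub>R v) - f y) / t\<bar> \<le> L * norm v"
proof -
  have "t * norm v < e / 2" by (rule small_step_norm) (fact assms)+
  moreover have "dist x (y + t *\<^sub>R v) \<le> dist x y + dist y (y + t *\<^sub>R v)" by (rule dist_triangle)
  ultimately have "y + t *\<^sub>R v \<in> ball x e" "y \<in> ball x e"
    using assms e by (simp_all add: dist_norm norm_minus_commute)
  from lipschitz_onD[OF lip this] have "\<bar>f (y + t *\<^sub>R v) - f y\<bar> \<le> L * norm v * t"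
    using assms(2) by (simp add: dist_norm mult_ac)
  then show ?thesis using assms(2) by (simp add: abs_divide pos_divide_le_eq)
qed

text \<open>Both bounds together make the directional derivative finite, so that it can be handled
  as a real sublinear function.\<close>

lemma clarke_dir_deriv_abs_le:
  "- ereal (L * norm v) \<le> clarke_dir_deriv f x v \<and> clarke_dir_deriv f x v \<le> ereal (L * norm v)"
proof
  let ?h = "min (e / 2) (e / (2 * (norm v + 1)))"
  have h: "0 < ?h" using e by (simp add: add_nonneg_pos)
  show "clarke_dir_deriv f x v \<le> ereal (L * norm v)"
  proof (rule clarke_dir_deriv_leI[OF h])
    fix y t assume "dist y x < ?h" "0 < t" "t < ?h"
    then have "\<bar>(f (y + t *\<^sub>R v) - f y) / t\<bar> \<le> L * norm v"
      by (intro difference_quotient_bound) linarith+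
    then show "(f (y + t *\<^sub>R v) - f y) / t \<le> L * norm v" by linarith
  qed
  show "- ereal (L * norm v) \<le> clarke_dir_deriv f x v"
  proof (rule ccontr)
    assume "\<not> ?thesis"
    then have "clarke_dir_deriv f x v < ereal (- (L * norm v))" by simp
    then obtain h' where h': "0 < h'"
      "\<And>y t. dist y x < h' \<Longrightarrow> 0 < t \<Longrightarrow> t < h' \<Longrightarrow> (f (y + t *\<^sub>R v) - f y) / t < - (L * norm v)"
      using clarke_dir_deriv_lessD by blast
    let ?t = "min h' ?h / 2"
    have t: "0 < ?t" "?t < h'" "?t < ?h" using h h'(1) by (simp_all add: min_def)
    have "\<bar>(f (x + ?t *\<^sub>R v) - f x) / ?t\<bar> \<le> L * norm v"
      using t e by (intro difference_quotient_bound) auto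
    moreover have "(f (x + ?t *\<^sub>R v) - f x) / ?t < - (L * norm v)"
      using t h' by (intro h'(2)) auto
    ultimately show False by linarith
  qed
qed

lemma clarke_subdifferential_norm_le:
  assumes "z \<in> clarke_subdifferential f x"
  shows "norm z \<le> L"
proof (cases "z = 0")
  case True
  then show ?thesis using lipschitz_on_nonneg[OF lip] by simp
next
  case False
  have "ereal (inner z z) \<le> clarke_dir_deriv f x z" using assms by (simp add: clarke_subdifferential_def)
  also have "... \<le> ereal (L * norm z)" using clarke_dir_deriv_abs_le by simp
  finally have "norm z * norm z \<le> L * norm z" by (simp add: power2_norm_eq_inner[symmetric] power2_eq_square)
  then show ?thesis using False by simp
qed

text \<open>The directional derivative is sublinear, so a linear functional below it touches it at
  \<open>v\<close>. Subadditivity holds because the base point varies in the upper limit: the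
  quotient in direction \<open>v + v'\<close> splits at \<open>y + t *\<^sub>R v\<close>, which is
  again an admissible base point.\<close>

lemma clarke_subdifferential_support:
  "\<exists>z\<in>clarke_subdifferential f x. ereal (inner z v) = clarke_dir_deriv f x v"
proof -
  define p where "p v = real_of_ereal (clarke_dir_deriv f x v)" for v
  have p: "clarke_dir_deriv f x v = ereal (p v)" for v
    using clarke_dir_deriv_abs_le[of v] unfolding p_def
    by (cases "clarke_dir_deriv f x v") auto
  have p_less: "\<exists>h>0. \<forall>y t. dist y x < h \<longrightarrow> 0 < t \<longrightarrow> t < h \<longrightarrow> (f (y + t *\<^sub>R v) - f y) / t < c"
    if "p v < c" for v c
    using clarke_dir_deriv_lessD[of f x v c] that by (simp add: p)
  have p_le: "p v \<le> c"
    if "0 < h" "\<And>y t. dist y x < h \<Longrightarrow> 0 < t \<Longrightarrow> t < h \<Longrightarrow> (f (y + t *\<^sub>R v) - f y) / t \<le> c" for v c h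
    using clarke_dir_deriv_leI[of h x f v c] that by (simp add: p)
  have add: "p (v + v') \<le> p v + p v'" for v v'
  proof (rule field_le_epsilon)
    fix r :: real assume r: "0 < r"
    obtain h where h: "0 < h"
      "\<And>y t. dist y x < h \<Longrightarrow> 0 < t \<Longrightarrow> t < h \<Longrightarrow> (f (y + t *\<^sub>R v) - f y) / t < p v + r / 2"
      using p_less[of v "p v + r / 2"] r by auto
    obtain h' where h': "0 < h'"
      "\<And>y t. dist y x < h' \<Longrightarrow> 0 < t \<Longrightarrow> t < h' \<Longrightarrow> (f (y + t *\<^sub>R v') - f y) / t < p v' + r / 2"
      using p_less[of v' "p v' + r / 2"] r by auto
    let ?m = "min h h'"
    \<comment> \<open>One half of \<open>?m\<close> is for the distance of \<open>y\<close> from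
      \<open>x\<close>, the other for the displacement \<open>t *\<^sub>R v\<close>.\<close>
    let ?d = "min (?m / 2) (?m / (2 * (norm v + 1)))"
    show "p (v + v') \<le> p v + p v' + r"
    proof (rule p_le)
      show "0 < ?d" using h(1) h'(1) by (simp add: add_nonneg_pos)
      fix y t assume y: "dist y x < ?d" and t: "0 < t" "t < ?d"
      have tv: "t * norm v < ?m / 2" by (rule small_step_norm) (use t in linarith)+
      have "dist (y + t *\<^sub>R v) x \<le> dist (y + t *\<^sub>R v) y + dist y x" by (rule dist_triangle)
      then have d: "dist (y + t *\<^sub>R v) x < ?m" using y tv t(1) by (simp add: dist_norm)
      have t': "t < ?m" and y': "dist y x < ?m" using t y h(1) h'(1) by linarith+
      have "(f ((y + t *\<^sub>R v) + t *\<^sub>R v') - f (y + t *\<^sub>R v)) / t < p v' + r / 2"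
        using d t t' by (intro h'(2)) auto
      moreover have "(f (y + t *\<^sub>R v) - f y) / t < p v + r / 2"
        using y' t t' by (intro h(2)) auto
      moreover have "(f (y + t *\<^sub>R (v + v')) - f y) / t =
          (f ((y + t *\<^sub>R v) + t *\<^sub>R v') - f (y + t *\<^sub>R v)) / t + (f (y + t *\<^sub>R v) - f y) / t"
        by (simp add: scaleR_add_right add.assoc add_divide_distrib[symmetric])
      ultimately show "(f (y + t *\<^sub>R (v + v')) - f y) / t \<le> p v + p v' + r" by linarith
    qed
  qed
  have scale_le: "p (s *\<^sub>R v) \<le> s * p v" if s: "0 < s" for s v
  proof (rule field_le_epsilon)
    fix r :: real assume r: "0 < r"
    obtain h where h: "0 < h"
      "\<And>y t. dist y x < h \<Longrightarrow> 0 < t \<Longrightarrow> t < h \<Longrightarrow> (f (y + t *\<^sub>R v) - f y) / t < p v + r / s"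
      using p_less[of v "p v + r / s"] r s by auto
    show "p (s *\<^sub>R v) \<le> s * p v + r"
    proof (rule p_le)
      show "0 < min h (h / s)" using h(1) s by simp
      fix y t assume y: "dist y x < min h (h / s)" and t: "0 < t" "t < min h (h / s)"
      have "(f (y + (s * t) *\<^sub>R v) - f y) / (s * t) < p v + r / s"
        using y t s by (intro h(2)) (auto simp: pos_less_divide_eq mult.commute)
      then have "s * ((f (y + (s * t) *\<^sub>R v) - f y) / (s * t)) \<le> s * (p v + r / s)"
        using s by (intro mult_left_mono) auto
      then show "(f (y + t *\<^sub>R s *\<^sub>R v) - f y) / t \<le> s * p v + r"
        using s t by (simp add: distrib_left mult.commute[of t s])
    qed
  qed
  have p0: "p 0 = 0"
    using clarke_dir_deriv_abs_le[of 0] by (simp add: p zero_ereal_def)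
  have scale: "p (s *\<^sub>R v) = s * p v" if s: "0 \<le> s" for s v
  proof (cases "s = 0")
    case False
    then have "0 < s" using s by simp
    \<comment> \<open>The reverse inequality is the same estimate with factor \<open>1 / s\<close>,
      applied to \<open>s *\<^sub>R v\<close>.\<close>
    have "p ((1 / s) *\<^sub>R s *\<^sub>R v) \<le> 1 / s * p (s *\<^sub>R v)" using \<open>0 < s\<close> by (intro scale_le) simp
    then have "s * p v \<le> p (s *\<^sub>R v)" using \<open>0 < s\<close> by (simp add: pos_le_divide_eq mult.commute)
    then show ?thesis using scale_le[OF \<open>0 < s\<close>, of v] by simp
  qed (simp add: p0)
  obtain z where "\<forall>v. inner z v \<le> p v" "inner z v = p v"
    using sublinear_support[of p v, OF add scale] by blast
  then show ?thesis by (intro bexI[of _ z]) (auto simp: clarke_subdifferential_def p)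
qed

end

text \<open>A finite subcover turns the radii that depend on the point into a single one. Uniformity
  is needed because the difference quotients will be averaged over a whole cube at one common step
  length.\<close>

lemma clarke_uniform_bound:
  assumes K: "compact K" and c: "\<And>x. x \<in> K \<Longrightarrow> clarke_dir_deriv f x v < ereal c"
  shows "\<exists>h>0. \<forall>y\<in>K. \<forall>t. 0 < t \<longrightarrow> t < h \<longrightarrow> (f (y + t *\<^sub>R v) - f y) / t < c"
proof -
  have "\<forall>x\<in>K. \<exists>h>0. \<forall>y t. dist y x < h \<longrightarrow> 0 < t \<longrightarrow> t < h \<longrightarrow> (f (y + t *\<^sub>R v) - f y) / t < c"
    using c clarke_dir_deriv_lessD by blast
  from bchoice[OF this] obtain h where h: "\<forall>x\<in>K. 0 < h x \<and>
      (\<forall>y t. dist y x < h x \<longrightarrow> 0 < t \<longrightarrow> t < h x \<longrightarrow> (f (y + t *\<^sub>R v) - f y) / t < c)" ..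
  obtain D where D: "D \<subseteq> K" "finite D" "K \<subseteq> (\<Union>x\<in>D. ball x (h x))"
  proof (rule compactE_image[OF K, of K "\<lambda>x. ball x (h x)"])
    show "K \<subseteq> (\<Union>x\<in>K. ball x (h x))" using h by force
  qed auto
  \<comment> \<open>The inserted 1 keeps the minimum meaningful when \<open>D\<close> is
    empty.\<close>
  let ?m = "Min (insert 1 (h ` D))"
  have "0 < ?m" using D h by (subst Min_gr_iff) auto
  moreover have "(f (y + t *\<^sub>R v) - f y) / t < c" if y: "y \<in> K" and t: "0 < t" "t < ?m" for y t
  proof -
    obtain x where x: "x \<in> D" "dist y x < h x" using D(3) y by (auto simp: dist_commute)
    have "?m \<le> h x" using D(2) x(1) by (intro Min_le) auto
    then have "t < h x" using t(2) by linarith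
    moreover have "x \<in> K" using D(1) x(1) by blast
    ultimately show ?thesis using h x(2) t(1) by blast
  qed
  ultimately show ?thesis by blast
qed

text \<open>Otherwise a hyperplane separates the gradient from the compact set \<open>C\<close>: in its normal direction
  \<open>v\<close> all difference quotients of \<open>f\<close> near \<open>w\<close>, and with them their averages, stay below
  \<open>inner (smoothing_gradient \<alpha> f w) v\<close>.\<close>

lemma smoothing_gradient_in_clarke_eps:
  fixes f :: "real ^ 'd \<Rightarrow> real"
  assumes \<alpha>: "0 < \<alpha>" and \<epsilon>: "\<epsilon> = sqrt (real CARD('d)) * (\<alpha> / 2)" and e: "0 < e"
    and lip: "L-lipschitz_on (box_around w (\<epsilon> + e)) f"
  shows "smoothing_gradient \<alpha> f w \<in> clarke_eps_subdifferential \<epsilon> f w"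
proof (rule ccontr)
  let ?D = "smoothing_gradient \<alpha> f w" and ?X = "box_around w (\<epsilon> + e)"
  let ?U = "uniform_cube (\<alpha> / 2) :: (real ^ 'd) measure"
  let ?E = "\<Union>x\<in>cball w \<epsilon>. clarke_subdifferential f x"
  let ?C = "clarke_eps_subdifferential \<epsilon> f w"
  interpret U: prob_space ?U by (rule prob_space_uniform_cube) (use \<alpha> in simp)
  have ball_sub: "ball x e \<subseteq> ?X" if "x \<in> cball w \<epsilon>" for x
  proof
    fix z assume "z \<in> ball x e"
    moreover have "dist w z \<le> dist w x + dist x z" by (rule dist_triangle)
    ultimately have "norm (z - w) \<le> \<epsilon> + e" using that by (simp add: dist_norm norm_minus_commute)
    then show "z \<in> ?X" using component_le_norm_cart[of "z - w"] by (auto intro: order_trans)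
  qed
  have lipx: "L-lipschitz_on (ball x e) f" if "x \<in> cball w \<epsilon>" for x
    by (rule lipschitz_on_subset[OF lip ball_sub[OF that]])
  \<comment> \<open>\<open>\<epsilon>\<close> is the half diagonal of the cube, so the ball of
    radius \<open>\<epsilon>\<close> contains everything that the smoothing at \<open>w\<close>
    averages over.\<close>
  have cube_sub: "w + u \<in> cball w \<epsilon>" if "u \<in> cube (ereal (\<alpha> / 2))" for u
  proof -
    have "norm u \<le> sqrt (\<Sum>i\<in>(UNIV :: 'd set). (\<alpha> / 2)\<^sup>2)"
      unfolding norm_vec_def L2_set_def using that by (intro real_sqrt_le_mono sum_mono power_mono) auto
    also have "... = \<epsilon>" using \<alpha> by (simp add: \<epsilon> real_sqrt_mult real_sqrt_divide)
    finally show ?thesis by (simp add: dist_norm)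
  qed
  \<comment> \<open>The graph is closed and subgradients are bounded by \<open>L\<close>; in finite
    dimension the hull of a compact set is compact, so it can be strictly separated from a
    point.\<close>
  have "compact ?E"
  proof -
    have "closed {(x, z). z \<in> clarke_subdifferential f x}" by (rule closed_clarke_graph)
    then have "compact ({(x, z). z \<in> clarke_subdifferential f x} \<inter> cball w \<epsilon> \<times> cball 0 L)"
      by (intro closed_Int_compact compact_Times compact_cball)
    then have "compact (snd ` ({(x, z). z \<in> clarke_subdifferential f x} \<inter> cball w \<epsilon> \<times> cball 0 L))"
      by (rule compact_continuous_image[rotated]) (intro continuous_intros)
    moreover have "snd ` ({(x, z). z \<in> clarke_subdifferential f x} \<inter> cball w \<epsilon> \<times> cball 0 L) = ?E"
      using clarke_subdifferential_norm_le[OF lipx e] by (force simp: image_iff)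
    ultimately show ?thesis by simp
  qed
  then have C: "closed ?C" "convex ?C"
    unfolding clarke_eps_subdifferential_def by (auto intro: compact_imp_closed compact_convex_hull)
  assume "?D \<notin> ?C"
  from separating_hyperplane_closed_point[OF C(2,1) this]
  obtain a b where ab: "inner a ?D < b" "\<forall>z\<in>?C. b < inner a z" by blast
  let ?v = "- a" and ?c = "- b"
  \<comment> \<open>The directional derivative is attained by a subgradient, and subgradients lie
    strictly on the far side of the hyperplane.\<close>
  have "clarke_dir_deriv f x ?v < ereal ?c" if x: "x \<in> cball w \<epsilon>" for x
  proof -
    obtain z where z: "z \<in> clarke_subdifferential f x" "ereal (inner z ?v) = clarke_dir_deriv f x ?v"
      using clarke_subdifferential_support[OF lipx[OF x] e, of ?v] by blast
    have "z \<in> ?C" unfolding clarke_eps_subdifferential_def using z(1) x by (intro hull_inc) blast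
    then have "b < inner a z" using ab(2) by blast
    then have "inner z ?v < ?c" by (simp add: inner_commute)
    then show ?thesis using z(2) by (metis less_ereal.simps(1))
  qed
  from clarke_uniform_bound[OF compact_cball this]
  obtain h where h: "0 < h"
    "\<And>y t. y \<in> cball w \<epsilon> \<Longrightarrow> 0 < t \<Longrightarrow> t < h \<Longrightarrow> (f (y + t *\<^sub>R ?v) - f y) / t < ?c" by blast
  let ?h = "min h (e / (norm ?v + 1))"
  have h0: "0 < ?h" using h(1) e by (simp add: add_nonneg_pos)
  have quot: "(smoothing \<alpha> f (w + t *\<^sub>R ?v) - smoothing \<alpha> f w) / t \<le> ?c" if t: "0 < t" "t < ?h" for t
  proof -
    have in1: "w + u \<in> ?X" if "u \<in> cube (ereal (\<alpha> / 2))" for u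
      using ball_sub[OF cube_sub[OF that]] centre_in_ball e by blast
    have in2: "w + t *\<^sub>R ?v + u \<in> ?X" if u: "u \<in> cube (ereal (\<alpha> / 2))" for u
    proof -
      have "t * (norm ?v + 1) < e" using t(2) by (simp add: pos_less_divide_eq add_nonneg_pos)
      then have "norm (t *\<^sub>R ?v) < e" using t(1) by (simp add: algebra_simps)
      then have "w + u + t *\<^sub>R ?v \<in> ball (w + u) e" by (simp add: dist_norm)
      moreover have "w + t *\<^sub>R ?v + u = w + u + t *\<^sub>R ?v" by simp
      ultimately show ?thesis using ball_sub[OF cube_sub[OF u]] by (simp only:) blast
    qed
    have i1: "integrable ?U (\<lambda>u. f (w + u))" and i2: "integrable ?U (\<lambda>u. f (w + t *\<^sub>R ?v + u))"
      using \<alpha> in1 in2 by (auto intro!: lipschitz_integrable[OF _ lip] continuous_intros simp del: mem_cube_ereal)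
    have "(\<integral>u. f (w + t *\<^sub>R ?v + u) - f (w + u) \<partial>?U) \<le> (\<integral>u. ?c * t \<partial>?U)"
    proof (rule integral_mono)
      fix u assume "u \<in> space ?U"
      then have "(f (w + u + t *\<^sub>R ?v) - f (w + u)) / t < ?c"
        using t by (intro h(2) cube_sub) auto
      then have "f (w + u + t *\<^sub>R ?v) - f (w + u) < ?c * t"
        using t(1) by (simp only: pos_divide_less_eq)
      moreover have "w + u + t *\<^sub>R ?v = w + t *\<^sub>R ?v + u" by simp
      ultimately show "f (w + t *\<^sub>R ?v + u) - f (w + u) \<le> ?c * t"
        by (simp only: less_imp_le)
    qed (use i1 i2 in auto)
    then have "smoothing \<alpha> f (w + t *\<^sub>R ?v) - smoothing \<alpha> f w \<le> ?c * t"
      using i1 i2 by (simp add: smoothing_def U.prob_space[simplified])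
    then show ?thesis using t(1) by (simp add: pos_divide_le_eq)
  qed
  have "GDERIV (smoothing \<alpha> f) w :> ?D"
  proof (rule smoothing_GDERIV[OF \<alpha> _ e])
    have "1 \<le> sqrt (real CARD('d))" using zero_less_card_finite[where 'a = 'd] by simp
    then have "\<alpha> / 2 \<le> \<epsilon>" using \<alpha> mult_right_mono[of 1 "sqrt (real CARD('d))" "\<alpha> / 2"] by (simp add: \<epsilon>)
    then show "L-lipschitz_on (box_around w (\<alpha> / 2 + e)) f"
      by (intro lipschitz_on_subset[OF lip box_around_mono]) simp
  qed
  from GDERIV_quotient[OF this, of ?v]
  have "((\<lambda>t. (smoothing \<alpha> f (w + t *\<^sub>R ?v) - smoothing \<alpha> f w) / t) \<longlongrightarrow> inner ?D ?v) (at_right 0)"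
    by (rule tendsto_within_subset) simp
  moreover have "\<forall>\<^sub>F t in at_right 0. (smoothing \<alpha> f (w + t *\<^sub>R ?v) - smoothing \<alpha> f w) / t \<le> ?c"
    unfolding eventually_at_right_field using quot h0 by blast
  ultimately have "inner ?D ?v \<le> ?c"
    by (rule tendsto_upperbound) simp
  then show False using ab(1) by (simp add: inner_commute)
qed

section \<open>The gradient estimators\<close>

text \<open>The strict inequality in \<open>room\<close> leaves slack \<open>k - b - r\<close> for
  finite radii; on the whole space any \<open>e\<close> works. The slack makes two-sided derivatives
  available even at boundary points of \<open>cube \<beta>\<close>.\<close>

lemma room_margin:
  assumes "room r \<beta> \<kappa>"
  shows "\<exists>e>0. \<forall>w\<in>cube \<beta>. box_around w (r + e) \<subseteq> (cube \<kappa> :: (real ^ 'd) set)"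
  using assms unfolding room_def
proof (elim disjE conjE)
  assume "\<kappa> = \<infinity>"
  then show ?thesis by (intro exI[of _ 1]) simp
next
  assume *: "\<beta> + ereal r < \<kappa>" "\<kappa> < \<infinity>"
  show ?thesis
  proof (cases \<beta>)
    case (real b)
    then obtain k where k: "\<kappa> = ereal k" "b + r < k"
      using * by (cases \<kappa>) auto
    show ?thesis
    proof (intro exI[of _ "k - b - r"] conjI ballI subsetI)
      fix w z :: "real ^ 'd" assume w: "w \<in> cube \<beta>" and z: "z \<in> box_around w (r + (k - b - r))"
      have "\<bar>z $ j\<bar> \<le> k" for j
      proof -
        have "\<bar>w $ j\<bar> \<le> b" "\<bar>z $ j - w $ j\<bar> \<le> k - b" using w z real by simp_all
        then show ?thesis by linarith
      qed
      then show "z \<in> cube \<kappa>" by (simp add: k)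
    qed (use k in simp)
  next
    case MInf
    then have "(cube \<beta> :: (real ^ 'd) set) = {}" by (auto simp: mem_cube)
    then show ?thesis by (intro exI[of _ 1]) simp
  qed (use * in simp)
qed

lemma AE_pair_snd:
  assumes "prob_space M" "prob_space N" "AE x in N. Q x"
  shows "AE p in M \<Otimes>\<^sub>M N. Q (snd p)"
proof -
  interpret M: prob_space M by fact
  interpret N: prob_space N by fact
  have d: "distr (M \<Otimes>\<^sub>M N) N snd = N"
  proof (rule measure_eqI)
    fix A assume "A \<in> sets (distr (M \<Otimes>\<^sub>M N) N snd)"
    then have A: "A \<in> sets N" by simp
    have "snd -` A \<inter> space (M \<Otimes>\<^sub>M N) = space M \<times> A"
      using sets.sets_into_space[OF A] by (auto simp: space_pair_measure)
    then show "emeasure (distr (M \<Otimes>\<^sub>M N) N snd) A = emeasure N A"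
      using A by (simp add: emeasure_distr N.emeasure_pair_measure_Times M.emeasure_space_1)
  qed simp
  have "AE x in distr (M \<Otimes>\<^sub>M N) N snd. Q x" unfolding d by (rule assms(3))
  from AE_distrD[OF measurable_snd this] show ?thesis .
qed

text \<open>In the direction \<open>g\<close> the difference quotients converge to the squared norm
  of \<open>g\<close>, and the Lipschitz bound keeps them below \<open>L * norm g\<close>.\<close>

lemma GDERIV_norm_le:
  assumes g: "GDERIV h z :> g" and e: "0 < e" and L: "0 \<le> L"
    and lip: "\<And>y. y \<in> ball z e \<Longrightarrow> \<bar>h y - h z\<bar> \<le> L * norm (y - z)"
  shows "norm g \<le> L"
proof (cases "g = 0")
  case True
  then show ?thesis using L by simp
next
  case False
  from GDERIV_quotient[OF g, of g]
  have "((\<lambda>t. (h (z + t *\<^sub>R g) - h z) / t) \<longlongrightarrow> inner g g) (at_right 0)"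
    by (rule tendsto_within_subset) simp
  moreover have "\<forall>\<^sub>F t in at_right 0. (h (z + t *\<^sub>R g) - h z) / t \<le> L * norm g"
    unfolding eventually_at_right_field
  proof (intro exI[of _ "e / norm g"] conjI allI impI)
    show "0 < e / norm g" using e False by simp
    fix t assume t: "0 < t" "t < e / norm g"
    then have "t * norm g < e" using False by (simp add: pos_less_divide_eq)
    then have "\<bar>h (z + t *\<^sub>R g) - h z\<bar> \<le> L * norm (z + t *\<^sub>R g - z)"
      using t by (intro lip) (simp add: dist_norm)
    then have "\<bar>h (z + t *\<^sub>R g) - h z\<bar> \<le> L * norm g * t" using t by (simp add: mult_ac)
    then show "(h (z + t *\<^sub>R g) - h z) / t \<le> L * norm g" using t by (simp add: pos_divide_le_eq)
  qed
  ultimately have "inner g g \<le> L * norm g" by (rule tendsto_upperbound) simp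
  then have "norm g * norm g \<le> L * norm g" by (simp add: power2_norm_eq_inner[symmetric] power2_eq_square)
  then show ?thesis using False by simp
qed

lemma borel_measurable_vec:
  fixes f :: "'a \<Rightarrow> real ^ 'd"
  assumes "\<And>i. (\<lambda>x. f x $ i) \<in> borel_measurable M"
  shows "f \<in> borel_measurable M"
  unfolding borel_measurable_euclidean_space[of f] using assms
  by (auto simp: Basis_vec_def inner_axis)

lemma norm_vec_square: "(norm (v :: real ^ 'd))\<^sup>2 = (\<Sum>i\<in>UNIV. (v $ i)\<^sup>2)"
  by (simp add: norm_vec_def L2_set_def sum_nonneg)

text \<open>The factor \<open>1 / \<alpha>\<close> of the finite difference is absorbed here, so
  that both updates become the same step along a mean of estimators of one gradient.\<close>

definition estimator ::
    "spa_update \<Rightarrow> (real ^ 'd \<Rightarrow> real ^ 'p \<Rightarrow> real) \<Rightarrow> (real ^ 'd \<Rightarrow> real ^ 'p \<Rightarrow> real ^ 'd)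
      \<Rightarrow> real \<Rightarrow> real ^ 'd \<Rightarrow> (real ^ 'd) \<times> (real ^ 'p) \<Rightarrow> real ^ 'd" where
  "estimator upd F G \<alpha> w p =
     (case upd of
        Finite_Difference \<Rightarrow> (1 / \<alpha>) *\<^sub>R finite_difference \<alpha> F w (fst p) (snd p)
      | Approximate_Gradient \<Rightarrow> G (w + fst p) (snd p))"

lemma finite_difference_nth:
  "finite_difference \<alpha> F w u x $ i = F (w + put i (\<alpha> / 2) u) x - F (w + put i (- (\<alpha> / 2)) u) x"
proof -
  have "(\<chi> j. if j = i then w $ i + \<alpha> / 2 else w $ j + u $ j) = w + put i (\<alpha> / 2) u"
    "(\<chi> j. if j = i then w $ i - \<alpha> / 2 else w $ j + u $ j) = w + put i (- (\<alpha> / 2)) u"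
    by (auto simp: vec_eq_iff)
  then show ?thesis by (simp add: finite_difference_def)
qed

lemma spa_step_eq:
  "spa_step upd F G \<alpha> \<eta> M us xs w =
    w - \<eta> *\<^sub>R ((1 / real M) *\<^sub>R (\<Sum>i = 1..M. estimator upd F G \<alpha> w (us i, xs i)))"
  by (cases upd) (simp_all add: spa_step_def estimator_def scaleR_sum_right[symmetric])

locale spa_problem = stochastic_lipschitz P F ell \<kappa>
  for P :: "(real ^ 'p) measure" and F :: "real ^ 'd \<Rightarrow> real ^ 'p \<Rightarrow> real" and ell \<kappa> +
  fixes d \<alpha> :: real and \<beta> :: ereal and G :: "real ^ 'd \<Rightarrow> real ^ 'p \<Rightarrow> real ^ 'd" and upd :: spa_update
  assumes d: "d = real CARD('d)" and alpha: "0 < \<alpha>" and room: "room (\<alpha> / 2) \<beta> \<kappa>"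
    and ell_mean: "0 < (\<integral>x. ell x \<partial>P)"
    and G: "upd = Approximate_Gradient \<Longrightarrow> approximate_gradient P F \<alpha> \<beta> G"
begin

abbreviation "U \<equiv> uniform_cube (\<alpha> / 2) :: (real ^ 'd) measure"
abbreviation "est \<equiv> estimator upd F G \<alpha>"
abbreviation "\<nu> \<equiv> U \<Otimes>\<^sub>M P"
abbreviation "f \<equiv> expected_loss P F"
abbreviation "L0 \<equiv> \<integral>x. ell x \<partial>P"
abbreviation "Q \<equiv> \<integral>x. (ell x)\<^sup>2 \<partial>P"
abbreviation "D \<equiv> smoothing_gradient \<alpha> f"
abbreviation "L \<equiv> 2 * sqrt d * L0 / \<alpha>"

lemma prob_U: "prob_space U"
  by (rule prob_space_uniform_cube) (use alpha in simp)

lemma prob_\<nu>: "prob_space \<nu>"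
proof -
  interpret U: prob_space U by (rule prob_U)
  interpret pair_prob_space U P ..
  show ?thesis by (rule prob_space_axioms)
qed

section \<open>Regularity of the expected loss and of its smoothing\<close>

definition margin :: real where
  "margin = (SOME e. 0 < e \<and> (\<forall>w\<in>cube \<beta>. box_around w (\<alpha> / 2 + e) \<subseteq> (cube \<kappa> :: (real ^ 'd) set)))"

lemma margin: "0 < margin" "w \<in> cube \<beta> \<Longrightarrow> box_around (w :: real ^ 'd) (\<alpha> / 2 + margin) \<subseteq> cube \<kappa>"
  using someI_ex[OF room_margin[OF room, where 'd = 'd, unfolded Bex_def]] unfolding margin_def by auto

lemma box_in_cube: "w \<in> cube \<beta> \<Longrightarrow> box_around (w :: real ^ 'd) (\<alpha> / 2) \<subseteq> cube \<kappa>"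
  using margin(1) by (intro order_trans[OF box_around_mono margin(2)]) auto

lemma shift_in_cube:
  fixes w u :: "real ^ 'd"
  assumes "w \<in> cube \<beta>" "u \<in> cube (ereal (\<alpha> / 2))"
  shows "w + u \<in> cube \<kappa>" "w + put i (\<alpha> / 2) u \<in> cube \<kappa>" "w + put i (- (\<alpha> / 2)) u \<in> cube \<kappa>"
  by (rule subsetD[OF box_in_cube[OF assms(1)]]; use assms(2) alpha in simp)+

lemma ball_in_cube:
  fixes w u :: "real ^ 'd"
  assumes "w \<in> cube \<beta>" "u \<in> cube (ereal (\<alpha> / 2))"
  shows "ball (w + u) margin \<subseteq> cube \<kappa>"
proof
  fix z assume z: "z \<in> ball (w + u) margin"
  have "\<bar>z $ j - w $ j\<bar> \<le> \<alpha> / 2 + margin" for j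
  proof -
    have "\<bar>(z - (w + u)) $ j\<bar> \<le> norm (z - (w + u))" by (rule component_le_norm_cart)
    then have "\<bar>z $ j - w $ j - u $ j\<bar> \<le> margin" using z by (simp add: dist_norm norm_minus_commute diff_diff_eq)
    moreover have "\<bar>u $ j\<bar> \<le> \<alpha> / 2" using assms(2) by simp
    ultimately show ?thesis by linarith
  qed
  then show "z \<in> cube \<kappa>" by (intro subsetD[OF margin(2)[OF assms(1)]]) simp
qed

lemma ell_measurable_P [measurable]: "ell \<in> borel_measurable P"
  using ell_measurable measurable_cong_sets[OF sets_P refl] by blast

lemma ell_integrable: "integrable P ell"
  by (rule square_integrable_imp_integrable) (auto intro: ell_square_integrable)

lemma lipschitz_f: "L0-lipschitz_on (cube \<kappa>) f"
proof (rule lipschitz_onI)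
  fix w w' :: "real ^ 'd" assume w: "w \<in> cube \<kappa>" "w' \<in> cube \<kappa>"
  have "\<bar>\<integral>x. F w x - F w' x \<partial>P\<bar> \<le> (\<integral>x. \<bar>F w x - F w' x\<bar> \<partial>P)"
    by (rule integral_abs_bound)
  also have "... \<le> (\<integral>x. ell x * norm (w - w') \<partial>P)"
    using F_lipschitz w F_integrable ell_integrable
    by (intro integral_mono_AE) (auto elim!: eventually_mono)
  finally show "dist (f w) (f w') \<le> L0 * dist w w'"
    using F_integrable w by (simp add: expected_loss_def dist_norm)
qed (use ell_mean in simp)

lemma smoothing_GDERIV_f: "w \<in> cube \<beta> \<Longrightarrow> GDERIV (smoothing \<alpha> f) w :> D w"
  by (rule smoothing_GDERIV[OF alpha lipschitz_on_subset[OF lipschitz_f margin(2)] margin(1)])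

lemma gradient_smoothing_f: "w \<in> cube \<beta> \<Longrightarrow> gradient (smoothing \<alpha> f) w = D w"
  by (rule gradient_eq[OF smoothing_GDERIV_f])

lemma D_lipschitz:
  "w \<in> cube \<beta> \<Longrightarrow> w' \<in> cube \<beta> \<Longrightarrow> norm (D w - D w') \<le> L * norm (w - w')"
  unfolding d by (rule smoothing_gradient_lipschitz[OF alpha lipschitz_f box_in_cube box_in_cube])

lemma L_pos: "0 < L"
  using alpha ell_mean by (simp add: d)

lemma D_continuous: "continuous_on (cube \<beta>) D"
proof (rule lipschitz_on_continuous_on, rule lipschitz_onI)
  show "dist (D w) (D w') \<le> L * dist w w'" if "w \<in> cube \<beta>" "w' \<in> cube \<beta>" for w w'
    unfolding dist_norm by (rule D_lipschitz) fact+
qed (rule less_imp_le[OF L_pos])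

lemma smoothing_descent:
  assumes "w \<in> cube \<beta>" "w' \<in> cube \<beta>"
  shows "smoothing \<alpha> f w' \<le> smoothing \<alpha> f w + inner (D w) (w' - w) + L / 2 * (norm (w' - w))\<^sup>2"
  by (rule descent_lemma[OF convex_cube assms smoothing_GDERIV_f D_lipschitz]) (use assms in auto)

text \<open>\<open>F\<close> and \<open>G\<close> are measurable only on restricted spaces, so an
  argument must land in the domain at every point, not just almost everywhere.\<close>

lemma measurable_pair_restrict:
  assumes "T \<in> measurable N (borel :: (real ^ 'd) measure)" "X \<in> measurable N (borel :: (real ^ 'p) measure)"
    and "\<And>p. p \<in> space N \<Longrightarrow> T p \<in> B"
  shows "(\<lambda>p. (T p, X p)) \<in> measurable N (restrict_space borel (B \<times> UNIV))"
proof (rule measurable_restrict_space2)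
  show "(\<lambda>p. (T p, X p)) \<in> measurable N borel"
    unfolding borel_prod[symmetric] using assms(1,2) by (intro measurable_Pair)
qed (use assms(3) in auto)

lemma F_shift_measurable:
  assumes T: "T \<in> measurable N (borel :: (real ^ 'd) measure)" "X \<in> measurable N (borel :: (real ^ 'p) measure)"
    and in_cube: "\<And>p. p \<in> space N \<Longrightarrow> T p \<in> cube \<kappa>"
  shows "(\<lambda>p. F (T p) (X p)) \<in> borel_measurable N"
  using measurable_compose[OF measurable_pair_restrict[OF assms] F_measurable] by simp

lemma G_shift_measurable:
  assumes upd: "upd = Approximate_Gradient"
    and T: "T \<in> measurable N (borel :: (real ^ 'd) measure)" "X \<in> measurable N (borel :: (real ^ 'p) measure)"
    and in_cube: "\<And>p. p \<in> space N \<Longrightarrow> T p \<in> cube (\<beta> + ereal (\<alpha> / 2))"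
  shows "(\<lambda>p. G (T p) (X p)) \<in> borel_measurable N"
  using measurable_compose[OF measurable_pair_restrict[OF T in_cube]
      conjunct1[OF G[OF upd, unfolded approximate_gradient_def]]] by simp

lemma fst_\<nu> [measurable]: "fst \<in> measurable \<nu> borel"
proof -
  have "fst \<in> measurable \<nu> U" by (rule measurable_fst)
  then have "fst \<in> measurable \<nu> (restrict_space borel (cube (ereal (\<alpha> / 2))))"
    by (simp add: measurable_cong_sets[OF refl sets_uniform_cube])
  then show ?thesis by (simp add: measurable_restrict_space2_iff)
qed

lemma snd_\<nu> [measurable]: "snd \<in> measurable \<nu> borel"
  using measurable_snd[of U P] measurable_cong_sets[OF refl sets_P] by blast

lemma fst_\<nu>_cube: "p \<in> space \<nu> \<Longrightarrow> fst p \<in> cube (ereal (\<alpha> / 2))"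
  by (auto simp: space_pair_measure)

section \<open>Integrability, mean and second moment of the estimators\<close>

lemma AE_\<nu>_lipschitz:
  "AE p in \<nu>. \<forall>w\<in>cube \<kappa>. \<forall>w'\<in>cube \<kappa>. \<bar>F w (snd p) - F w' (snd p)\<bar> \<le> ell (snd p) * norm (w - w')"
  by (rule AE_pair_snd[OF prob_U prob_space_axioms F_lipschitz])

lemma integrable_\<nu>_snd:
  fixes h :: "real ^ 'p \<Rightarrow> real"
  assumes h: "integrable P h"
  shows "integrable \<nu> (\<lambda>p. h (snd p))" "(\<integral>p. h (snd p) \<partial>\<nu>) = (\<integral>x. h x \<partial>P)"
proof -
  interpret U: prob_space U by (rule prob_U)
  interpret pair_sigma_finite U P ..
  have "integrable \<nu> (\<lambda>(u, x). h x)"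
    using h by (intro Fubini_integrable) (auto intro: measurable_compose[OF measurable_snd])
  then show "integrable \<nu> (\<lambda>p. h (snd p))" by (simp add: case_prod_unfold)
  then have "(\<integral>p. h (snd p) \<partial>\<nu>) = (\<integral>u. \<integral>x. h x \<partial>P \<partial>U)"
    using integral_fst'[of "\<lambda>p. h (snd p)"] by simp
  then show "(\<integral>p. h (snd p) \<partial>\<nu>) = (\<integral>x. h x \<partial>P)" by (simp add: U.prob_space[simplified])
qed

text \<open>The Lipschitz bound relative to the anchor \<open>T 0\<close> gives a dominating
  function of \<open>x\<close> alone, because \<open>T\<close> moves boundedly on the compact cube.
  Fubini then yields the mean.\<close>

lemma F_shift_integrable:
  assumes T: "continuous_on UNIV T" "\<And>u. u \<in> cube (ereal (\<alpha> / 2)) \<Longrightarrow> T u \<in> cube \<kappa>"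
  shows "integrable \<nu> (\<lambda>p. F (T (fst p)) (snd p))"
    and "(\<integral>p. F (T (fst p)) (snd p) \<partial>\<nu>) = (\<integral>u. f (T u) \<partial>U)"
proof -
  interpret U: prob_space U by (rule prob_U)
  interpret pair_sigma_finite U P ..
  have "0 \<in> cube (ereal (\<alpha> / 2))" using alpha by simp
  then have T0: "T 0 \<in> cube \<kappa>" by (rule T(2))
  have "continuous_on (cube (ereal (\<alpha> / 2))) (\<lambda>u. T u - T 0)"
    by (intro continuous_intros continuous_on_subset[OF T(1)]) simp
  then obtain c where c: "\<forall>u\<in>cube (ereal (\<alpha> / 2)). norm (T u - T 0) \<le> c"
    using compact_imp_bounded[OF compact_continuous_image[OF _ compact_cube]]
    by (metis (no_types, lifting) bounded_iff image_eqI)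
  have meas: "(\<lambda>p. F (T (fst p)) (snd p)) \<in> borel_measurable \<nu>"
  proof (rule F_shift_measurable)
    show "(\<lambda>p. T (fst p)) \<in> borel_measurable \<nu>"
      by (rule measurable_compose[OF fst_\<nu> borel_measurable_continuous_onI[OF T(1)]])
  qed (use T(2) fst_\<nu>_cube in auto)
  let ?h = "\<lambda>x. \<bar>F (T 0) x\<bar> + \<bar>ell x\<bar> * c"
  have h: "integrable P ?h"
    using F_integrable[OF T0] ell_integrable by simp
  show int: "integrable \<nu> (\<lambda>p. F (T (fst p)) (snd p))"
  proof (rule Bochner_Integration.integrable_bound[OF integrable_\<nu>_snd(1)[OF h] meas])
    show "AE p in \<nu>. norm (F (T (fst p)) (snd p)) \<le> norm (?h (snd p))"
      using AE_\<nu>_lipschitz AE_space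
    proof eventually_elim
      case (elim p)
      have u: "fst p \<in> cube (ereal (\<alpha> / 2))" by (rule fst_\<nu>_cube) fact
      have "\<bar>F (T (fst p)) (snd p) - F (T 0) (snd p)\<bar> \<le> ell (snd p) * norm (T (fst p) - T 0)"
        using elim(1) T(2)[OF u] T0 by blast
      also have "... \<le> \<bar>ell (snd p)\<bar> * c"
        using c u by (intro mult_mono) auto
      finally show ?case by simp
    qed
  qed
  show "(\<integral>p. F (T (fst p)) (snd p) \<partial>\<nu>) = (\<integral>u. f (T u) \<partial>U)"
    using integral_fst'[OF int] by (simp add: expected_loss_def)
qed

text \<open>The point \<open>w\<close> varies with the sample as well, because along a run the
  estimator is evaluated at a random iterate.\<close>

lemma estimator_measurable:
  assumes w: "w \<in> measurable N borel" "\<And>p. p \<in> space N \<Longrightarrow> w p \<in> cube \<beta>"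
    and q: "q \<in> measurable N \<nu>"
  shows "(\<lambda>p. est (w p) (q p)) \<in> borel_measurable N"
proof -
  have q1: "(\<lambda>p. fst (q p)) \<in> measurable N borel" and q2: "(\<lambda>p. snd (q p)) \<in> measurable N borel"
    using measurable_compose[OF q fst_\<nu>] measurable_compose[OF q snd_\<nu>] by simp_all
  have u: "fst (q p) \<in> cube (ereal (\<alpha> / 2))" if "p \<in> space N" for p
    by (rule fst_\<nu>_cube) (rule measurable_space[OF q that])
  show ?thesis
  proof (cases upd)
    case Finite_Difference
    have put: "(\<lambda>p. w p + put i t (fst (q p))) \<in> borel_measurable N" for i t
      using w(1) by (intro borel_measurable_add measurable_compose[OF q1] borel_measurable_continuous_onI
          continuous_intros)
    have "(\<lambda>p. finite_difference \<alpha> F (w p) (fst (q p)) (snd (q p))) \<in> borel_measurable N"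
      unfolding finite_difference_nth
      by (intro borel_measurable_vec, unfold finite_difference_nth,
          intro borel_measurable_diff F_shift_measurable put q2 shift_in_cube w(2) u)
    then show ?thesis using Finite_Difference by (simp add: estimator_def)
  next
    case Approximate_Gradient
    have "(\<lambda>p. G (w p + fst (q p)) (snd (q p))) \<in> borel_measurable N"
    proof (rule G_shift_measurable[OF Approximate_Gradient])
      show "(\<lambda>p. w p + fst (q p)) \<in> borel_measurable N" using w(1) q1 by simp
      fix p assume p: "p \<in> space N"
      show "w p + fst (q p) \<in> cube (\<beta> + ereal (\<alpha> / 2))"
        unfolding mem_cube
      proof
        fix i
        have "ereal \<bar>w p $ i + fst (q p) $ i\<bar> \<le> ereal \<bar>w p $ i\<bar> + ereal \<bar>fst (q p) $ i\<bar>"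
          by (simp add: abs_triangle_ineq)
        also have "... \<le> \<beta> + ereal (\<alpha> / 2)"
          using w(2)[OF p] u[OF p] by (intro add_mono) (auto simp: mem_cube)
        finally show "ereal \<bar>(w p + fst (q p)) $ i\<bar> \<le> \<beta> + ereal (\<alpha> / 2)" by simp
      qed
    qed (rule q2)
    then show ?thesis using Approximate_Gradient by (simp add: estimator_def)
  qed
qed

abbreviation "\<upsilon> \<equiv> (case upd of Finite_Difference \<Rightarrow> d | Approximate_Gradient \<Rightarrow> 1)"

lemma estimator_fixed_measurable: "w \<in> cube \<beta> \<Longrightarrow> est w \<in> borel_measurable \<nu>"
  using estimator_measurable[of "\<lambda>_. w" \<nu> "\<lambda>p. p"] by simp

text \<open>The two points in each component of the finite difference are at distance
  \<open>\<alpha>\<close>, so after scaling each of the \<open>d\<close> components is at most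
  \<open>ell\<close>, and the squared norm picks up the factor \<open>d\<close>. A gradient is
  bounded by \<open>ell\<close> as a vector, with factor 1.\<close>

lemma estimator_norm_AE:
  assumes w: "w \<in> cube \<beta>"
  shows "AE p in \<nu>. (norm (est w p))\<^sup>2 \<le> \<upsilon> * (ell (snd p))\<^sup>2"
proof (cases upd)
  case Finite_Difference
  show ?thesis
    using AE_\<nu>_lipschitz AE_space
  proof eventually_elim
    case (elim p)
    have u: "fst p \<in> cube (ereal (\<alpha> / 2))" by (rule fst_\<nu>_cube) fact
    have "\<bar>finite_difference \<alpha> F w (fst p) (snd p) $ i\<bar> \<le> ell (snd p) * \<alpha>" for i
    proof -
      have "norm ((w + put i (\<alpha> / 2) (fst p)) - (w + put i (- (\<alpha> / 2)) (fst p))) = \<alpha>"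
        using alpha norm_put_diff[of i "\<alpha> / 2" "fst p" "- (\<alpha> / 2)"] by simp
      then show ?thesis
        unfolding finite_difference_nth using elim(1) shift_in_cube[OF w u] by metis
    qed
    then have "\<bar>est w p $ i\<bar> \<le> ell (snd p)" for i
      using alpha Finite_Difference by (simp add: estimator_def abs_mult pos_divide_le_eq)
    then have "(norm (est w p))\<^sup>2 \<le> (\<Sum>i\<in>(UNIV :: 'd set). (ell (snd p))\<^sup>2)"
      unfolding norm_vec_square
    proof (intro sum_mono)
      fix i
      have "\<bar>est w p $ i\<bar> \<le> \<bar>ell (snd p)\<bar>"
        using \<open>\<And>i. \<bar>est w p $ i\<bar> \<le> ell (snd p)\<close>[of i] by linarith
      then show "(est w p $ i)\<^sup>2 \<le> (ell (snd p))\<^sup>2"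
        by (simp only: abs_le_square_iff)
    qed
    then show ?case using Finite_Difference by (simp add: d)
  qed
next
  case Approximate_Gradient
  have "AE p in \<nu>. GDERIV (\<lambda>y. F y (snd p)) (w + fst p) :> G (w + fst p) (snd p)"
    using G[OF Approximate_Gradient] w by (simp add: approximate_gradient_def case_prod_unfold)
  then show ?thesis
    using AE_\<nu>_lipschitz AE_space
  proof eventually_elim
    case (elim p)
    have u: "fst p \<in> cube (ereal (\<alpha> / 2))" by (rule fst_\<nu>_cube) fact
    have "norm (G (w + fst p) (snd p)) \<le> \<bar>ell (snd p)\<bar>"
    proof (rule GDERIV_norm_le[OF elim(1) margin(1)])
      show "0 \<le> \<bar>ell (snd p)\<bar>" by simp
      fix y assume "y \<in> ball (w + fst p) margin"
      then have "y \<in> cube \<kappa>" using ball_in_cube[OF w u] by blast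
      then have "\<bar>F y (snd p) - F (w + fst p) (snd p)\<bar> \<le> ell (snd p) * norm (y - (w + fst p))"
        using elim(2) shift_in_cube(1)[OF w u] by blast
      also have "... \<le> \<bar>ell (snd p)\<bar> * norm (y - (w + fst p))"
        by (intro mult_right_mono) auto
      finally show "\<bar>F y (snd p) - F (w + fst p) (snd p)\<bar> \<le> \<bar>ell (snd p)\<bar> * norm (y - (w + fst p))" .
    qed
    then show ?case using Approximate_Gradient abs_le_square_iff[of "norm (G (w + fst p) (snd p))"]
      by (simp add: estimator_def)
  qed
qed

lemma estimator_second_moment:
  assumes w: "w \<in> cube \<beta>"
  shows "integrable \<nu> (\<lambda>p. (norm (est w p))\<^sup>2)"
    and "(\<integral>p. (norm (est w p))\<^sup>2 \<partial>\<nu>) \<le> \<upsilon> * Q"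
proof -
  have h: "integrable \<nu> (\<lambda>p. \<upsilon> * (ell (snd p))\<^sup>2)" "(\<integral>p. \<upsilon> * (ell (snd p))\<^sup>2 \<partial>\<nu>) = \<upsilon> * Q"
    using integrable_\<nu>_snd[OF ell_square_integrable] by simp_all
  show int: "integrable \<nu> (\<lambda>p. (norm (est w p))\<^sup>2)"
  proof (rule Bochner_Integration.integrable_bound[OF h(1)])
    show "(\<lambda>p. (norm (est w p))\<^sup>2) \<in> borel_measurable \<nu>"
      using estimator_fixed_measurable[OF w] by measurable
    show "AE p in \<nu>. norm ((norm (est w p))\<^sup>2) \<le> norm (\<upsilon> * (ell (snd p))\<^sup>2)"
      using estimator_norm_AE[OF w] by eventually_elim simp
  qed
  have "(\<integral>p. (norm (est w p))\<^sup>2 \<partial>\<nu>) \<le> (\<integral>p. \<upsilon> * (ell (snd p))\<^sup>2 \<partial>\<nu>)"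
    by (rule integral_mono_AE[OF int h(1) estimator_norm_AE[OF w]])
  then show "(\<integral>p. (norm (est w p))\<^sup>2 \<partial>\<nu>) \<le> \<upsilon> * Q" by (simp only: h(2))
qed

lemma estimator_integrable: "w \<in> cube \<beta> \<Longrightarrow> integrable \<nu> (est w)"
  by (rule integrable_of_norm_square[OF prob_\<nu> estimator_fixed_measurable estimator_second_moment(1)])

text \<open>For the gradient estimator, both sides are limits of the means of the difference quotients of
  \<open>F\<close> in a coordinate direction.\<close>

lemma estimator_mean:
  assumes w: "w \<in> cube \<beta>"
  shows "(\<integral>p. est w p \<partial>\<nu>) = D w"
proof (rule vec_eq_iff[THEN iffD2], rule allI)
  fix i
  let ?Z = "est w"
  have "(\<integral>p. ?Z p \<partial>\<nu>) $ i = (\<integral>p. ?Z p $ i \<partial>\<nu>)"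
    using integral_bounded_linear[OF bounded_linear_vec_nth estimator_integrable[OF w], of i] by simp
  also have "... = D w $ i"
  proof (cases upd)
    case Finite_Difference
    have T: "continuous_on UNIV (\<lambda>u. w + put i t u)" for t by (intro continuous_intros)
    have i1: "integrable \<nu> (\<lambda>p. F (w + put i (\<alpha> / 2) (fst p)) (snd p))"
      and i2: "integrable \<nu> (\<lambda>p. F (w + put i (- (\<alpha> / 2)) (fst p)) (snd p))"
      by (rule F_shift_integrable[OF T], rule shift_in_cube[OF w], assumption)+
    have e1: "(\<integral>p. F (w + put i (\<alpha> / 2) (fst p)) (snd p) \<partial>\<nu>) = (\<integral>u. f (w + put i (\<alpha> / 2) u) \<partial>U)"
      and e2: "(\<integral>p. F (w + put i (- (\<alpha> / 2)) (fst p)) (snd p) \<partial>\<nu>) = (\<integral>u. f (w + put i (- (\<alpha> / 2)) u) \<partial>U)"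
      by (rule F_shift_integrable[OF T], rule shift_in_cube[OF w], assumption)+
    have j: "integrable U (\<lambda>u. f (w + put i (\<alpha> / 2) u))" "integrable U (\<lambda>u. f (w + put i (- (\<alpha> / 2)) u))"
      by (rule lipschitz_integrable[OF _ lipschitz_f T], use alpha in simp, rule shift_in_cube[OF w], assumption)+
    have "(\<integral>p. ?Z p $ i \<partial>\<nu>) = (\<integral>p. (F (w + put i (\<alpha> / 2) (fst p)) (snd p) - F (w + put i (- (\<alpha> / 2)) (fst p)) (snd p)) / \<alpha> \<partial>\<nu>)"
      using Finite_Difference by (simp add: estimator_def finite_difference_nth)
    also have "... = ((\<integral>u. f (w + put i (\<alpha> / 2) u) \<partial>U) - (\<integral>u. f (w + put i (- (\<alpha> / 2)) u) \<partial>U)) / \<alpha>"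
      using i1 i2 by (simp add: e1 e2)
    also have "... = D w $ i"
      using j by (simp add: smoothing_gradient_def)
    finally show ?thesis .
  next
    case Approximate_Gradient
    let ?e = "axis i 1 :: real ^ 'd"
    \<comment> \<open>A null sequence strictly between 0 and \<open>margin\<close>, so that
      \<open>w + u + h n *\<^sub>R ?e\<close> never leaves \<open>cube \<kappa>\<close>.\<close>
    define h where "h n = margin / 2 * inverse (real (Suc n))" for n
    have h: "0 < h n" "h n < margin" for n
    proof -
      show "0 < h n" using margin(1) by (simp add: h_def)
      have "margin / 2 * inverse (real (Suc n)) \<le> margin / 2 * 1"
        using margin(1) by (intro mult_left_mono) (auto simp: inverse_eq_divide)
      then show "h n < margin" using margin(1) unfolding h_def by linarith
    qed
    have "h \<longlonglongrightarrow> 0"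
      unfolding h_def by (intro tendsto_mult_right_zero LIMSEQ_inverse_real_of_nat)
    then have hlim: "filterlim h (at 0) sequentially"
      unfolding filterlim_at using h(1) by (auto intro!: always_eventually simp: less_imp_neq[symmetric])
    have in2: "w + u + h n *\<^sub>R ?e \<in> cube \<kappa>" if "u \<in> cube (ereal (\<alpha> / 2))" for u n
      using h[of n] by (intro subsetD[OF ball_in_cube[OF w that]]) (simp add: dist_norm)
    have T: "continuous_on UNIV (\<lambda>u. w + u + h n *\<^sub>R ?e)" "continuous_on UNIV (\<lambda>u. w + u)" for n
      by (intro continuous_intros)+
    let ?q = "\<lambda>n p. (F (w + fst p + h n *\<^sub>R ?e) (snd p) - F (w + fst p) (snd p)) / h n"
    have i1: "integrable \<nu> (\<lambda>p. F (w + fst p + h n *\<^sub>R ?e) (snd p))"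
      and e1: "(\<integral>p. F (w + fst p + h n *\<^sub>R ?e) (snd p) \<partial>\<nu>) = (\<integral>u. f (w + u + h n *\<^sub>R ?e) \<partial>U)" for n
      by (rule F_shift_integrable[OF T(1)], rule in2, assumption)+
    have i2: "integrable \<nu> (\<lambda>p. F (w + fst p) (snd p))"
      and e2: "(\<integral>p. F (w + fst p) (snd p) \<partial>\<nu>) = (\<integral>u. f (w + u) \<partial>U)"
      by (rule F_shift_integrable[OF T(2)], rule shift_in_cube[OF w], assumption)+
    have s1: "smoothing \<alpha> f (w + h n *\<^sub>R ?e) = (\<integral>p. F (w + fst p + h n *\<^sub>R ?e) (snd p) \<partial>\<nu>)" for n
      unfolding smoothing_def e1 by (rule Bochner_Integration.integral_cong) (simp_all add: add_ac)
    have s2: "smoothing \<alpha> f w = (\<integral>p. F (w + fst p) (snd p) \<partial>\<nu>)"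
      by (simp only: smoothing_def e2)
    have qint: "(\<integral>p. ?q n p \<partial>\<nu>) = (smoothing \<alpha> f (w + h n *\<^sub>R ?e) - smoothing \<alpha> f w) / h n" for n
      using i1[of n] i2 by (simp add: s1 s2)
    have "(\<lambda>n. \<integral>p. ?q n p \<partial>\<nu>) \<longlonglongrightarrow> (\<integral>p. ?Z p $ i \<partial>\<nu>)"
    proof (rule integral_dominated_convergence)
      show "(\<lambda>p. ?Z p $ i) \<in> borel_measurable \<nu>"
        by (rule measurable_compose[OF estimator_fixed_measurable[OF w]])
          (intro borel_measurable_continuous_onI continuous_intros)
      show "?q n \<in> borel_measurable \<nu>" for n
        using i1[of n] i2 by simp
      \<comment> \<open>The Lipschitz constant dominates all difference quotients along the unit
        vector \<open>?e\<close>.\<close>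
      show "integrable \<nu> (\<lambda>p. ell (snd p))" by (rule integrable_\<nu>_snd(1)[OF ell_integrable])
      have "AE p in \<nu>. GDERIV (\<lambda>y. F y (snd p)) (w + fst p) :> G (w + fst p) (snd p)"
        using G[OF Approximate_Gradient] w by (simp add: approximate_gradient_def case_prod_unfold)
      then show "AE p in \<nu>. (\<lambda>n. ?q n p) \<longlonglongrightarrow> ?Z p $ i"
      proof eventually_elim
        case (elim p)
        from filterlim_compose[OF GDERIV_quotient[OF elim, of ?e] hlim] show ?case
          using Approximate_Gradient by (simp add: estimator_def inner_axis)
      qed
      show "AE p in \<nu>. norm (?q n p) \<le> ell (snd p)" for n
        using AE_\<nu>_lipschitz AE_space
      proof eventually_elim
        case (elim p)
        have u: "fst p \<in> cube (ereal (\<alpha> / 2))" by (rule fst_\<nu>_cube) fact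
        have "\<bar>F (w + fst p + h n *\<^sub>R ?e) (snd p) - F (w + fst p) (snd p)\<bar> \<le>
            ell (snd p) * norm (w + fst p + h n *\<^sub>R ?e - (w + fst p))"
          using elim(1) in2[OF u] shift_in_cube(1)[OF w u] by blast
        also have "... = ell (snd p) * h n" using h(1)[of n] by simp
        finally show ?case using h(1)[of n] by (simp add: pos_divide_le_eq)
      qed
    qed
    moreover have "(\<lambda>n. \<integral>p. ?q n p \<partial>\<nu>) \<longlonglongrightarrow> D w $ i"
    proof -
      from filterlim_compose[OF GDERIV_quotient[OF smoothing_GDERIV_f[OF w], of ?e] hlim] show ?thesis
        unfolding qint by (simp add: inner_axis)
    qed
    ultimately show ?thesis by (rule LIMSEQ_unique)
  qed
  finally show "(\<integral>p. ?Z p \<partial>\<nu>) $ i = D w $ i" .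
qed

lemma minibatch_error:
  assumes w: "w \<in> cube \<beta>" and J: "finite J" "J \<noteq> {}"
  shows "(\<integral>\<^sup>+y. ennreal ((norm ((1 / real (card J)) *\<^sub>R (\<Sum>j\<in>J. est w (y j)) - D w))\<^sup>2)
      \<partial>PiM J (\<lambda>_. \<nu>)) \<le> ennreal (\<upsilon> * Q / real (card J))"
proof -
  have "(\<integral>\<^sup>+y. ennreal ((norm ((1 / real (card J)) *\<^sub>R (\<Sum>j\<in>J. est w (y j)) - D w))\<^sup>2)
      \<partial>PiM J (\<lambda>_. \<nu>)) \<le> ennreal ((\<integral>p. (norm (est w p))\<^sup>2 \<partial>\<nu>) / real (card J))"
    using minibatch_variance[OF prob_\<nu> estimator_fixed_measurable[OF w] estimator_second_moment(1)[OF w] J]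
    by (simp only: estimator_mean[OF w])
  also have "... \<le> ennreal (\<upsilon> * Q / real (card J))"
    by (intro ennreal_leI divide_right_mono estimator_second_moment(2)[OF w]) simp
  finally show ?thesis .
qed

end

section \<open>Runs of the algorithm\<close>

text \<open>Iterate \<open>k\<close> depends on the steps before \<open>k\<close> only. This gives
  the independence of an iterate from its fresh batch, and it permits ignoring samples that a run
  never reads.\<close>

lemma spa_iterate_cong:
  assumes "\<And>j w. 1 \<le> j \<Longrightarrow> j < k \<Longrightarrow> step j w = step' j w"
  shows "spa_iterate step proj w1 k = spa_iterate step' proj w1 k"
  using assms by (induction k) auto

text \<open>\<open>ennreal\<close> sends negative reals to 0, so additivity weakens to an inequality
  that holds for either sign of \<open>a\<close>.\<close>

lemma ennreal_add_le: "0 \<le> b \<Longrightarrow> ennreal (a + b) \<le> ennreal a + ennreal b"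
proof (cases "0 \<le> a")
  case False
  then have "ennreal (a + b) \<le> ennreal b" by (intro ennreal_leI) simp
  then show ?thesis using False by (simp add: ennreal_neg)
qed simp

lemma nn_integral_uniform_count_measure:
  assumes "finite A"
  shows "(\<integral>\<^sup>+x. g x \<partial>uniform_count_measure A) = ennreal (1 / real (card A)) * (\<Sum>x\<in>A. g x)"
  unfolding uniform_count_measure_def
  by (simp add: nn_integral_point_measure_finite[OF assms] sum_distrib_left)

lemma am_gm:
  fixes t c :: real
  assumes "0 < c"
  shows "t \<le> t\<^sup>2 / (2 * c) + c / 2"
proof -
  have "0 \<le> (t - c)\<^sup>2 / (2 * c)" using assms by simp
  then show ?thesis using assms by (simp add: power2_eq_square field_simps)
qed

text \<open>The bound \<open>r \<le> r\<^sup>2 / (2 * \<epsilon>) + \<epsilon> / 2\<close> replaces Jensen's inequality, and the function values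
  telescope along the path.\<close>

lemma telescoping_bound:
  fixes r g e :: "nat \<Rightarrow> real"
  assumes eps: "0 < \<epsilon>" and c: "0 \<le> c\<^sub>1"
    and r: "\<And>k. 1 \<le> k \<Longrightarrow> (r k)\<^sup>2 \<le> c\<^sub>1 * (g k - g (Suc k)) + c\<^sub>2 * e k"
    and \<Delta>: "g 1 - g (Suc K) \<le> \<Delta>"
  shows "(\<Sum>k = 1..K. r k) \<le> (c\<^sub>1 * \<Delta> / (2 * \<epsilon>) + real K * (\<epsilon> / 2)) + (\<Sum>k = 1..K. c\<^sub>2 / (2 * \<epsilon>) * e k)"
proof -
  have "r k \<le> c\<^sub>1 / (2 * \<epsilon>) * (g k - g (Suc k)) + c\<^sub>2 / (2 * \<epsilon>) * e k + \<epsilon> / 2" if "k \<in> {1..K}" for k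
  proof -
    have "(r k)\<^sup>2 / (2 * \<epsilon>) \<le> (c\<^sub>1 * (g k - g (Suc k)) + c\<^sub>2 * e k) / (2 * \<epsilon>)"
      by (rule divide_right_mono[OF r]) (use that eps in auto)
    then show ?thesis using am_gm[OF eps, of "r k"] by (simp add: add_divide_distrib)
  qed
  then have "(\<Sum>k = 1..K. r k) \<le> (\<Sum>k = 1..K. c\<^sub>1 / (2 * \<epsilon>) * (g k - g (Suc k)) + c\<^sub>2 / (2 * \<epsilon>) * e k + \<epsilon> / 2)"
    by (rule sum_mono)
  also have "... = c\<^sub>1 / (2 * \<epsilon>) * (\<Sum>k = 1..K. g k - g (Suc k)) + (\<Sum>k = 1..K. c\<^sub>2 / (2 * \<epsilon>) * e k) + real K * (\<epsilon> / 2)"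
    by (simp only: sum.distrib sum_distrib_left sum_constant card_atLeastAtMost diff_Suc_1)
  also have "(\<Sum>k = 1..K. g k - g (Suc k)) = g 1 - g (Suc K)"
    by (induction K) auto
  finally have "(\<Sum>k = 1..K. r k) \<le> c\<^sub>1 / (2 * \<epsilon>) * (g 1 - g (Suc K)) +
      (\<Sum>k = 1..K. c\<^sub>2 / (2 * \<epsilon>) * e k) + real K * (\<epsilon> / 2)" .
  moreover have "c\<^sub>1 / (2 * \<epsilon>) * (g 1 - g (Suc K)) \<le> c\<^sub>1 / (2 * \<epsilon>) * \<Delta>"
    using c eps by (intro mult_left_mono \<Delta>) auto
  ultimately show ?thesis by simp
qed

text \<open>\<open>eta\<close> is the step size of the theorem written in terms of \<open>L\<close>,
  and \<open>lower\<close> is the form in which the minimizer enters. The selection of the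
  projection may change with \<open>k\<close>.\<close>

locale spa_run = spa_problem P F ell \<kappa> d \<alpha> \<beta> G upd
  for P :: "(real ^ 'p) measure" and F :: "real ^ 'd \<Rightarrow> real ^ 'p \<Rightarrow> real" and ell \<kappa> d \<alpha> \<beta> G upd +
  fixes A :: "(real ^ 'd) set" and w1 :: "real ^ 'd" and proj :: "nat \<Rightarrow> real ^ 'd \<Rightarrow> real ^ 'd"
    and \<eta> \<rho> \<Delta> :: real and M :: nat
  assumes A: "A \<subseteq> cube \<beta>" and w1: "w1 \<in> A" and proj: "\<And>k. projection_selection A (proj k)"
    and rho: "1 < \<rho>" and eta: "\<eta> = 2 / (3 * \<rho> * L)" and M: "0 < M"
    and lower: "\<And>w. w \<in> A \<Longrightarrow> smoothing \<alpha> f w1 - smoothing \<alpha> f w \<le> \<Delta>"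
begin

abbreviation "samples I \<equiv> PiM I (\<lambda>_ :: nat \<times> nat. \<nu>)"
abbreviation "output \<equiv> spa_output upd F G \<alpha> \<eta> M proj w1"
abbreviation "C1 \<equiv> 2 * (1 + 3 * \<rho>) / (\<rho> - 1) + 3 * \<rho>"
abbreviation "C2 \<equiv> 2 * (1 + 3 * \<rho>) / (\<rho> - 1) + 3"

text \<open>A run as a deterministic function of the sample array, so that expectations become
  integrals over a product measure.\<close>

definition iterate :: "nat \<Rightarrow> (nat \<times> nat \<Rightarrow> (real ^ 'd) \<times> (real ^ 'p)) \<Rightarrow> real ^ 'd" where
  "iterate k s = spa_iterate
     (\<lambda>k. spa_step upd F G \<alpha> \<eta> M (\<lambda>i. fst (s (k, i))) (\<lambda>i. snd (s (k, i)))) proj w1 k"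

definition batch_gradient :: "nat \<Rightarrow> (nat \<times> nat \<Rightarrow> (real ^ 'd) \<times> (real ^ 'p)) \<Rightarrow> real ^ 'd \<Rightarrow> real ^ 'd" where
  "batch_gradient k s w = (1 / real M) *\<^sub>R (\<Sum>i = 1..M. est w (s (k, i)))"

definition error :: "nat \<Rightarrow> (nat \<times> nat \<Rightarrow> (real ^ 'd) \<times> (real ^ 'p)) \<Rightarrow> real ^ 'd" where
  "error k s = batch_gradient k s (iterate k s) - D (iterate k s)"

lemma iterate_1: "k \<le> 1 \<Longrightarrow> iterate k s = w1"
  by (cases k) (auto simp: iterate_def)

lemma iterate_Suc:
  "1 \<le> k \<Longrightarrow> iterate (Suc k) s = proj k (iterate k s - \<eta> *\<^sub>R batch_gradient k s (iterate k s))"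
  by (simp add: iterate_def batch_gradient_def spa_step_eq)

lemma proj_in: "proj k x \<in> projection A x"
  using proj unfolding projection_selection_def by blast

lemma iterate_in: "iterate k s \<in> A"
proof (cases "k \<le> 1")
  case True
  then show ?thesis using w1 by (simp add: iterate_1)
next
  case False
  then obtain j where "k = Suc j" "1 \<le> j" by (cases k) auto
  then show ?thesis using proj_in by (simp add: iterate_Suc projection_def)
qed

lemma iterate_in_cube: "iterate k s \<in> cube \<beta>"
  using iterate_in A by blast

lemma iterate_cong:
  assumes "\<And>j i. 1 \<le> j \<Longrightarrow> j < k \<Longrightarrow> i \<in> {1..M} \<Longrightarrow> s (j, i) = s' (j, i)"
  shows "iterate k s = iterate k s'"
  unfolding iterate_def
  by (rule spa_iterate_cong) (auto simp: spa_step_eq assms intro!: sum.cong)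

lemma batch_gradient_measurable:
  assumes w: "w \<in> measurable (samples I) borel" "\<And>s. w s \<in> cube \<beta>" and I: "{k} \<times> {1..M} \<subseteq> I"
  shows "(\<lambda>s. batch_gradient k s (w s)) \<in> borel_measurable (samples I)"
proof -
  have "(\<lambda>s. est (w s) (s (k, i))) \<in> borel_measurable (samples I)" if "i \<in> {1..M}" for i
    by (rule estimator_measurable[OF w(1) w(2)], rule measurable_component_singleton) (use I that in auto)
  then have "(\<lambda>s. \<Sum>i = 1..M. est (w s) (s (k, i))) \<in> borel_measurable (samples I)"
    by (rule borel_measurable_sum)
  then show ?thesis
    unfolding batch_gradient_def by (rule borel_measurable_scaleR[OF borel_measurable_const])
qed

lemma iterate_measurable:
  "{1..<k} \<times> {1..M} \<subseteq> I \<Longrightarrow> iterate k \<in> borel_measurable (samples I)"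
proof (induction k)
  case 0
  then show ?case by (simp add: iterate_1 cong: measurable_cong)
next
  case (Suc k)
  show ?case
  proof (cases "k = 0")
    case True
    then show ?thesis by (simp add: iterate_1 cong: measurable_cong)
  next
    case False
    have k: "{1..<k} \<times> {1..M} \<subseteq> I" "{k} \<times> {1..M} \<subseteq> I" using Suc.prems False by auto
    have m: "iterate k \<in> borel_measurable (samples I)" by (rule Suc.IH[OF k(1)])
    have "proj k \<in> borel_measurable borel" using proj unfolding projection_selection_def by blast
    then have "(\<lambda>s. proj k (iterate k s - \<eta> *\<^sub>R batch_gradient k s (iterate k s)))
        \<in> borel_measurable (samples I)"
      by (rule measurable_compose[rotated])
        (intro borel_measurable_diff borel_measurable_scaleR borel_measurable_const m
          batch_gradient_measurable iterate_in_cube k(2))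
    then show ?thesis using False by (simp add: iterate_Suc cong: measurable_cong)
  qed
qed

lemma error_measurable:
  assumes "{1..k} \<times> {1..M} \<subseteq> I" "1 \<le> k"
  shows "error k \<in> borel_measurable (samples I)"
proof -
  have I: "{1..<k} \<times> {1..M} \<subseteq> I" "{k} \<times> {1..M} \<subseteq> I" using assms by auto
  have m: "iterate k \<in> borel_measurable (samples I)" by (rule iterate_measurable[OF I(1)])
  \<comment> \<open>\<open>D\<close> is known to be continuous on \<open>cube \<beta>\<close> only,
    hence the detour through the restricted space.\<close>
  have "iterate k \<in> measurable (samples I) (restrict_space borel (cube \<beta>))"
    using m iterate_in_cube by (intro measurable_restrict_space2) auto
  from measurable_compose[OF this borel_measurable_continuous_on_restrict[OF D_continuous]]
  have "(\<lambda>s. D (iterate k s)) \<in> borel_measurable (samples I)" .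
  then have "(\<lambda>s. batch_gradient k s (iterate k s) - D (iterate k s)) \<in> borel_measurable (samples I)"
    by (intro borel_measurable_diff batch_gradient_measurable m iterate_in_cube I(2))
  then show ?thesis by (simp add: error_def[abs_def])
qed

text \<open>The iterate \<open>k\<close> depends on the rows of samples before \<open>k\<close> only, so integrating over row \<open>k\<close>
  first leaves a mini-batch at a fixed point.\<close>

lemma error_bound:
  assumes k: "1 \<le> k" "k \<le> K"
  shows "(\<integral>\<^sup>+s. ennreal ((norm (error k s))\<^sup>2) \<partial>samples ({1..K} \<times> {1..M})) \<le> ennreal (\<upsilon> * Q / real M)"
proof -
  let ?J = "{k} \<times> {1..M}" and ?I = "({1..K} - {k}) \<times> {1..M}"
  interpret \<nu>: prob_space \<nu> by (rule prob_\<nu>)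
  interpret product_sigma_finite "\<lambda>_ :: nat \<times> nat. \<nu>"
    by (simp add: product_sigma_finite_def \<nu>.sigma_finite_measure_axioms)
  interpret I: prob_space "samples ?I" by (rule prob_space_PiM) (rule prob_\<nu>)
  have IJ: "?I \<union> ?J = {1..K} \<times> {1..M}" "?I \<inter> ?J = {}" using k by auto
  have "(\<integral>\<^sup>+s. ennreal ((norm (error k s))\<^sup>2) \<partial>samples ({1..K} \<times> {1..M})) =
      (\<integral>\<^sup>+s. ennreal ((norm (error k s))\<^sup>2) \<partial>samples (?I \<union> ?J))" by (simp only: IJ(1))
  also have "... = (\<integral>\<^sup>+x. \<integral>\<^sup>+y. ennreal ((norm (error k (merge ?I ?J (x, y))))\<^sup>2) \<partial>samples ?J \<partial>samples ?I)"
  proof (rule product_nn_integral_fold[OF IJ(2)])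
    have "error k \<in> borel_measurable (samples (?I \<union> ?J))"
      using k by (intro error_measurable) (auto simp: IJ(1))
    then show "(\<lambda>s. ennreal ((norm (error k s))\<^sup>2)) \<in> borel_measurable (samples (?I \<union> ?J))" by measurable
  qed auto
  also have "... \<le> (\<integral>\<^sup>+x. ennreal (\<upsilon> * Q / real M) \<partial>samples ?I)"
  proof (rule nn_integral_mono)
    fix x
    let ?w = "iterate k x"
    have "error k (merge ?I ?J (x, y)) =
        (1 / real (card ?J)) *\<^sub>R (\<Sum>j\<in>?J. est ?w (y j)) - D ?w" for y
    proof -
      have w: "iterate k (merge ?I ?J (x, y)) = ?w"
        using k by (intro iterate_cong) (auto simp: merge_def)
      have "(\<Sum>j\<in>?J. est ?w (y j)) = (\<Sum>i = 1..M. est ?w (y (k, i)))"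
      proof -
        have "?J = Pair k ` {1..M}" by auto
        moreover have "inj_on (Pair k) {1..M}" by (simp add: inj_on_def)
        ultimately show ?thesis by (simp only: sum.reindex o_def)
      qed
      also have "... = (\<Sum>i = 1..M. est ?w (merge ?I ?J (x, y) (k, i)))"
        by (intro sum.cong) (auto simp: merge_def)
      finally show ?thesis
        by (simp add: error_def w batch_gradient_def card_cartesian_product del: One_nat_def)
    qed
    then show "(\<integral>\<^sup>+y. ennreal ((norm (error k (merge ?I ?J (x, y))))\<^sup>2) \<partial>samples ?J) \<le> ennreal (\<upsilon> * Q / real M)"
      using minibatch_error[OF iterate_in_cube[of k x], of ?J] M
      by (simp add: card_cartesian_product del: One_nat_def)
  qed
  also have "... = ennreal (\<upsilon> * Q / real M)" by (simp only: nn_integral_const I.emeasure_space_1 mult_1_right)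
  finally show ?thesis .
qed

lemma iterate_step_bound:
  assumes "1 \<le> k"
  shows "\<exists>y\<in>frechet_normal_cone (iterate (Suc k) s) A. (norm (D (iterate (Suc k) s) + y))\<^sup>2 \<le>
    C1 * L * (smoothing \<alpha> f (iterate k s) - smoothing \<alpha> f (iterate (Suc k) s)) + C2 * (norm (error k s))\<^sup>2"
proof -
  let ?w = "iterate k s" and ?w' = "iterate (Suc k) s" and ?g = "batch_gradient k s (iterate k s)"
  have p: "?w' \<in> projection A (?w - \<eta> *\<^sub>R ?g)"
    using proj_in by (simp add: iterate_Suc[OF assms])
  have "0 < \<eta>"
    unfolding eta using rho by (intro divide_pos_pos mult_pos_pos L_pos) auto
  then have "0 \<le> 1 / \<eta>" by simp
  then have n: "(1 / \<eta>) *\<^sub>R (?w - \<eta> *\<^sub>R ?g - ?w') \<in> frechet_normal_cone ?w' A"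
    by (rule projection_frechet_normal[OF p])
  have sm: "smoothing \<alpha> f ?w' \<le> smoothing \<alpha> f ?w + inner (D ?w) (?w' - ?w) + L / 2 * (norm (?w' - ?w))\<^sup>2"
    by (rule smoothing_descent) (rule iterate_in_cube)+
  have l: "norm (D ?w' - D ?w) \<le> L * norm (?w' - ?w)"
    by (rule D_lipschitz) (rule iterate_in_cube)+
  have "(norm (D ?w' + (1 / \<eta>) *\<^sub>R (?w - \<eta> *\<^sub>R ?g - ?w')))\<^sup>2 \<le>
      C1 * L * (smoothing \<alpha> f ?w - smoothing \<alpha> f ?w') + C2 * (norm (error k s))\<^sup>2"
    unfolding error_def by (rule projected_step_bound[OF L_pos rho eta iterate_in p sm l])
  with n show ?thesis by (intro bexI)
qed

text \<open>A bound for every fixed sample array; randomness enters only afterwards. The function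
  \<open>h\<close> stands for the distance to either of the two stationarity sets, so one argument
  serves both notions.\<close>

lemma sum_stationarity_pointwise:
  assumes eps: "0 < \<epsilon>"
    and h: "\<And>w y. w \<in> A \<Longrightarrow> y \<in> frechet_normal_cone w A \<Longrightarrow> h w \<le> ennreal (norm (D w + y))"
  shows "(\<Sum>k = 1..K. h (iterate (Suc k) s)) \<le>
    ennreal (C1 * L * \<Delta> / (2 * \<epsilon>) + real K * (\<epsilon> / 2)) +
    (\<Sum>k = 1..K. ennreal (C2 / (2 * \<epsilon>)) * ennreal ((norm (error k s))\<^sup>2))"
proof -
  let ?g = "\<lambda>k. smoothing \<alpha> f (iterate k s)"
  have C: "0 < C1" "0 < C2" using rho by (auto intro!: add_pos_pos divide_pos_pos)
  have "\<exists>r. 0 \<le> r \<and> h (iterate (Suc k) s) \<le> ennreal r \<and>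
      r\<^sup>2 \<le> C1 * L * (?g k - ?g (Suc k)) + C2 * (norm (error k s))\<^sup>2" if "1 \<le> k" for k
    using iterate_step_bound[OF that, of s] h[OF iterate_in] by (meson norm_ge_zero)
  \<comment> \<open>The residuals are chosen for a fixed \<open>s\<close>. They need not depend
    measurably on \<open>s\<close>, since they disappear between the two sides of the
    estimate.\<close>
  then obtain r where r: "\<And>k. 1 \<le> k \<Longrightarrow> 0 \<le> r k" "\<And>k. 1 \<le> k \<Longrightarrow> h (iterate (Suc k) s) \<le> ennreal (r k)"
    "\<And>k. 1 \<le> k \<Longrightarrow> (r k)\<^sup>2 \<le> C1 * L * (?g k - ?g (Suc k)) + C2 * (norm (error k s))\<^sup>2"
    by metis
  have "(\<Sum>k = 1..K. h (iterate (Suc k) s)) \<le> (\<Sum>k = 1..K. ennreal (r k))"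
    using r(2) by (intro sum_mono) auto
  also have "... = ennreal (\<Sum>k = 1..K. r k)"
    using r(1) by (intro sum_ennreal) auto
  also have "... \<le> ennreal ((C1 * L * \<Delta> / (2 * \<epsilon>) + real K * (\<epsilon> / 2)) +
      (\<Sum>k = 1..K. C2 / (2 * \<epsilon>) * (norm (error k s))\<^sup>2))"
  proof (rule ennreal_leI)
    show "(\<Sum>k = 1..K. r k) \<le> (C1 * L * \<Delta> / (2 * \<epsilon>) + real K * (\<epsilon> / 2)) +
      (\<Sum>k = 1..K. C2 / (2 * \<epsilon>) * (norm (error k s))\<^sup>2)"
    proof (rule telescoping_bound[where g = ?g and e = "\<lambda>k. (norm (error k s))\<^sup>2"])
      show "0 < \<epsilon>" by (rule eps)
      show "(r k)\<^sup>2 \<le> C1 * L * (?g k - ?g (Suc k)) + C2 * (norm (error k s))\<^sup>2" if "1 \<le> k" for k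
        using that by (rule r(3))
      show "0 \<le> C1 * L" using mult_pos_pos[OF C(1) L_pos] by (rule less_imp_le)
      show "?g 1 - ?g (Suc K) \<le> \<Delta>" using lower[OF iterate_in[of "Suc K" s]] by (simp add: iterate_1)
    qed
  qed
  also have "... \<le> ennreal (C1 * L * \<Delta> / (2 * \<epsilon>) + real K * (\<epsilon> / 2)) +
      ennreal (\<Sum>k = 1..K. C2 / (2 * \<epsilon>) * (norm (error k s))\<^sup>2)"
    using C(2) eps by (intro ennreal_add_le sum_nonneg) auto
  also have "ennreal (\<Sum>k = 1..K. C2 / (2 * \<epsilon>) * (norm (error k s))\<^sup>2) =
      (\<Sum>k = 1..K. ennreal (C2 / (2 * \<epsilon>)) * ennreal ((norm (error k s))\<^sup>2))"
  proof -
    have c: "0 \<le> C2 / (2 * \<epsilon>)"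
      by (rule divide_nonneg_pos) (use less_imp_le[OF C(2)] eps in simp_all)
    have "ennreal (\<Sum>k = 1..K. C2 / (2 * \<epsilon>) * (norm (error k s))\<^sup>2) =
        (\<Sum>k = 1..K. ennreal (C2 / (2 * \<epsilon>) * (norm (error k s))\<^sup>2))"
      by (rule sum_ennreal[symmetric]) (intro mult_nonneg_nonneg c zero_le_power2)
    then show ?thesis
      by (simp only: ennreal_mult[OF c zero_le_power2])
  qed
  finally show ?thesis .
qed

text \<open>Per iteration the tolerance is spent as follows: a quarter on the telescoped decrease, a
  quarter on the sampling error, and half on the constant term of the inequality that replaces
  Jensen.\<close>

lemma sum_stationarity:
  assumes eps: "0 < \<epsilon>" and hm: "h \<in> borel_measurable borel"
    and h: "\<And>w y. w \<in> A \<Longrightarrow> y \<in> frechet_normal_cone w A \<Longrightarrow> h w \<le> ennreal (norm (D w + y))"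
    and K: "C1 * L * \<Delta> \<le> real K * (\<epsilon>\<^sup>2 / 2)" and Mq: "C2 * (\<upsilon> * Q) \<le> real M * (\<epsilon>\<^sup>2 / 2)"
  shows "(\<Sum>k = 1..K. \<integral>\<^sup>+s. h (iterate (Suc k) s) \<partial>samples ({1..K} \<times> {1..M})) \<le> ennreal (real K * \<epsilon>)"
proof -
  let ?N = "samples ({1..K} \<times> {1..M})"
  let ?a = "C1 * L * \<Delta> / (2 * \<epsilon>) + real K * (\<epsilon> / 2)"
  interpret N: prob_space ?N by (rule prob_space_PiM) (rule prob_\<nu>)
  have C: "0 < C2" using rho by (auto intro!: add_pos_pos divide_pos_pos)
  have em: "(\<lambda>s. ennreal ((norm (error k s))\<^sup>2)) \<in> borel_measurable ?N" if "k \<in> {1..K}" for k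
  proof -
    have "error k \<in> borel_measurable ?N" using that by (intro error_measurable) auto
    then show ?thesis by measurable
  qed
  have im: "(\<lambda>s. h (iterate (Suc k) s)) \<in> borel_measurable ?N" if "k \<in> {1..K}" for k
    by (rule measurable_compose[OF iterate_measurable hm]) (use that in auto)
  have "(\<Sum>k = 1..K. \<integral>\<^sup>+s. h (iterate (Suc k) s) \<partial>?N) = (\<integral>\<^sup>+s. (\<Sum>k = 1..K. h (iterate (Suc k) s)) \<partial>?N)"
    by (rule nn_integral_sum[symmetric]) (rule im)
  also have "... \<le> (\<integral>\<^sup>+s. ennreal ?a + (\<Sum>k = 1..K. ennreal (C2 / (2 * \<epsilon>)) * ennreal ((norm (error k s))\<^sup>2)) \<partial>?N)"
    by (intro nn_integral_mono sum_stationarity_pointwise[OF eps h])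
  also have "... = ennreal ?a + (\<integral>\<^sup>+s. (\<Sum>k = 1..K. ennreal (C2 / (2 * \<epsilon>)) * ennreal ((norm (error k s))\<^sup>2)) \<partial>?N)"
  proof (subst nn_integral_add)
    show "(\<lambda>s. \<Sum>k = 1..K. ennreal (C2 / (2 * \<epsilon>)) * ennreal ((norm (error k s))\<^sup>2)) \<in> borel_measurable ?N"
      by (intro borel_measurable_sum borel_measurable_times_ennreal borel_measurable_const em)
  qed (simp_all only: nn_integral_const N.emeasure_space_1 mult_1_right borel_measurable_const)
  also have "... = ennreal ?a + (\<Sum>k = 1..K. ennreal (C2 / (2 * \<epsilon>)) * (\<integral>\<^sup>+s. ennreal ((norm (error k s))\<^sup>2) \<partial>?N))"
    by (subst nn_integral_sum)
      (auto intro!: borel_measurable_times_ennreal em arg_cong2[of _ _ _ _ "(+)"] sum.cong nn_integral_cmult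
        simp del: One_nat_def)
  also have "... \<le> ennreal ?a + (\<Sum>k = 1..K. ennreal (C2 / (2 * \<epsilon>)) * ennreal (\<upsilon> * Q / real M))"
    by (intro add_left_mono sum_mono mult_left_mono error_bound) auto
  also have "... \<le> ennreal (real K * \<epsilon>)"
  proof -
    have q0: "0 \<le> \<upsilon> * Q" by (intro mult_nonneg_nonneg integral_nonneg) (auto simp: d split: spa_update.split)
    have "(\<Sum>k = 1..K. ennreal (C2 / (2 * \<epsilon>)) * ennreal (\<upsilon> * Q / real M)) =
        ennreal (real K * (C2 / (2 * \<epsilon>) * (\<upsilon> * Q / real M)))"
      using C eps q0 by (simp add: ennreal_mult''[symmetric] ennreal_of_nat_eq_real_of_nat ennreal_mult[symmetric])
    also have "... \<le> ennreal (real K * (\<epsilon> / 4))"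
    proof (intro ennreal_leI mult_left_mono)
      have "C2 * (\<upsilon> * Q) / (real M * (2 * \<epsilon>)) \<le> real M * (\<epsilon>\<^sup>2 / 2) / (real M * (2 * \<epsilon>))"
        using Mq M eps by (intro divide_right_mono) auto
      also have "... = \<epsilon> / 4" using M eps by (simp add: power2_eq_square)
      finally show "C2 / (2 * \<epsilon>) * (\<upsilon> * Q / real M) \<le> \<epsilon> / 4" by (simp add: mult_ac)
    qed simp
    finally have 1: "(\<Sum>k = 1..K. ennreal (C2 / (2 * \<epsilon>)) * ennreal (\<upsilon> * Q / real M)) \<le> ennreal (real K * (\<epsilon> / 4))" .
    have "C1 * L * \<Delta> / (2 * \<epsilon>) \<le> real K * (\<epsilon>\<^sup>2 / 2) / (2 * \<epsilon>)"
      using K eps by (intro divide_right_mono) auto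
    also have "... = real K * (\<epsilon> / 4)" using eps by (simp add: power2_eq_square)
    finally have "ennreal ?a \<le> ennreal (real K * (\<epsilon> / 4) + real K * (\<epsilon> / 2))"
      by (intro ennreal_leI) linarith
    then have "ennreal ?a + (\<Sum>k = 1..K. ennreal (C2 / (2 * \<epsilon>)) * ennreal (\<upsilon> * Q / real M)) \<le>
        ennreal (real K * (\<epsilon> / 4) + real K * (\<epsilon> / 2)) + ennreal (real K * (\<epsilon> / 4))"
      using 1 by (rule add_mono)
    also have "... = ennreal (real K * (\<epsilon> / 4) + real K * (\<epsilon> / 2) + real K * (\<epsilon> / 4))"
      using eps by (intro ennreal_plus[symmetric]) auto
    also have "real K * (\<epsilon> / 4) + real K * (\<epsilon> / 2) + real K * (\<epsilon> / 4) = real K * \<epsilon>" by simp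
    finally show ?thesis .
  qed
  finally show ?thesis .
qed

text \<open>Averaging over the uniform index \<open>R\<close> divides the sum over all iterations by
  \<open>K\<close>. The joint law moves the expectation from \<open>\<Omega>\<close> to the product
  space, where index and samples separate.\<close>

lemma spa_output_stationarity:
  assumes eps: "0 < \<epsilon>" and hm: "h \<in> borel_measurable borel"
    and h: "\<And>w y. w \<in> A \<Longrightarrow> y \<in> frechet_normal_cone w A \<Longrightarrow> h w \<le> ennreal (norm (D w + y))"
    and K: "C1 * L * \<Delta> \<le> real K * (\<epsilon>\<^sup>2 / 2)" and Mq: "C2 * (\<upsilon> * Q) \<le> real M * (\<epsilon>\<^sup>2 / 2)"
    and K0: "0 < K" and samp: "spa_sampling \<Omega> P \<alpha> K M V X R"
  shows "output V X R \<in> borel_measurable \<Omega>"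
    and "\<And>\<omega>. \<omega> \<in> space \<Omega> \<Longrightarrow> output V X R \<omega> \<in> A"
    and "(\<integral>\<^sup>+\<omega>. h (output V X R \<omega>) \<partial>\<Omega>) \<le> ennreal \<epsilon>"
proof -
  let ?N = "samples ({1..K} \<times> {1..M})" and ?U = "uniform_count_measure {2..K + 1}"
  let ?out = "output V X R"
  define T where "T \<omega> = (R \<omega>, \<lambda>(k, i)\<in>{1..K} \<times> {1..M}. (V k i \<omega>, X k i \<omega>))" for \<omega>
  have law: "spa_law P \<alpha> K M = ?U \<Otimes>\<^sub>M ?N" by (simp add: spa_law_def)
  have T: "T \<in> measurable \<Omega> (?U \<Otimes>\<^sub>M ?N)" "distr \<Omega> (?U \<Otimes>\<^sub>M ?N) T = ?U \<Otimes>\<^sub>M ?N"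
    using samp unfolding spa_sampling_def law T_def[abs_def] Let_def by auto
  have \<Phi>: "(\<lambda>(r, s). iterate r s) \<in> borel_measurable (?U \<Otimes>\<^sub>M ?N)"
  proof -
    have "(\<lambda>(r, s). iterate r s) \<in> borel_measurable (count_space {2..K + 1} \<Otimes>\<^sub>M ?N)"
      by (rule measurable_pair_measure_countable1) (auto intro!: iterate_measurable)
    moreover have "sets (?U \<Otimes>\<^sub>M ?N) = sets (count_space {2..K + 1} \<Otimes>\<^sub>M ?N)"
      by (intro sets_pair_measure_cong) (simp_all add: sets_uniform_count_measure)
    ultimately show ?thesis using measurable_cong_sets by blast
  qed
  \<comment> \<open>The array in \<open>T \<omega>\<close> is undefined outside its index set, but
    \<open>R \<omega> \<le> K + 1\<close> means that only rows up to \<open>K\<close> are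
    read.\<close>
  have out: "?out \<omega> = (case T \<omega> of (r, s) \<Rightarrow> iterate r s)" if "\<omega> \<in> space \<Omega>" for \<omega>
  proof -
    have "T \<omega> \<in> space (?U \<Otimes>\<^sub>M ?N)" using T(1) that by (rule measurable_space)
    then have "R \<omega> \<le> K + 1" by (simp add: T_def space_pair_measure space_uniform_count_measure)
    then show ?thesis
      unfolding T_def iterate_def spa_output_def prod.case
      by (intro spa_iterate_cong) (auto simp: spa_step_eq intro!: sum.cong)
  qed
  have "(\<lambda>\<omega>. case T \<omega> of (r, s) \<Rightarrow> iterate r s) \<in> borel_measurable \<Omega>"
    by (rule measurable_compose[OF T(1) \<Phi>])
  then show "?out \<in> borel_measurable \<Omega>" by (simp add: out cong: measurable_cong)
  show "?out \<omega> \<in> A" if "\<omega> \<in> space \<Omega>" for \<omega>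
    unfolding out[OF that] by (simp add: case_prod_unfold iterate_in)
  interpret N: prob_space ?N by (rule prob_space_PiM) (rule prob_\<nu>)
  have hf: "(\<lambda>p. h (case p of (r, s) \<Rightarrow> iterate r s)) \<in> borel_measurable (?U \<Otimes>\<^sub>M ?N)"
    by (rule measurable_compose[OF \<Phi> hm])
  have "(\<integral>\<^sup>+\<omega>. h (?out \<omega>) \<partial>\<Omega>) = (\<integral>\<^sup>+\<omega>. h (case T \<omega> of (r, s) \<Rightarrow> iterate r s) \<partial>\<Omega>)"
    by (intro nn_integral_cong) (simp only: out)
  also have "... = (\<integral>\<^sup>+p. h (case p of (r, s) \<Rightarrow> iterate r s) \<partial>distr \<Omega> (?U \<Otimes>\<^sub>M ?N) T)"
    using hf by (intro nn_integral_distr[OF T(1), symmetric]) simp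
  also have "... = (\<integral>\<^sup>+p. h (case p of (r, s) \<Rightarrow> iterate r s) \<partial>(?U \<Otimes>\<^sub>M ?N))"
    by (simp only: T(2))
  also have "... = (\<integral>\<^sup>+r. \<integral>\<^sup>+s. h (iterate r s) \<partial>?N \<partial>?U)"
    by (subst N.nn_integral_fst[OF hf, symmetric]) simp
  also have "... = ennreal (1 / real K) * (\<Sum>r\<in>{2..K + 1}. \<integral>\<^sup>+s. h (iterate r s) \<partial>?N)"
    by (subst nn_integral_uniform_count_measure) auto
  \<comment> \<open>The output index is \<open>r = k + 1\<close>: the residual is bounded at the
    iterate that step \<open>k\<close> produces, so \<open>w1\<close> itself is never
    returned.\<close>
  also have "(\<Sum>r\<in>{2..K + 1}. \<integral>\<^sup>+s. h (iterate r s) \<partial>?N) = (\<Sum>k = 1..K. \<integral>\<^sup>+s. h (iterate (Suc k) s) \<partial>?N)"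
    using sum.shift_bounds_cl_Suc_ivl[of "\<lambda>r. \<integral>\<^sup>+s. h (iterate r s) \<partial>?N" 1 K] by (simp add: numeral_2_eq_2)
  also have "ennreal (1 / real K) * ... \<le> ennreal (1 / real K) * ennreal (real K * \<epsilon>)"
    by (intro mult_left_mono sum_stationarity[OF eps hm h K Mq]) auto
  also have "... = ennreal \<epsilon>"
    using K0 eps by (simp add: ennreal_mult[symmetric])
  finally show "(\<integral>\<^sup>+\<omega>. h (?out \<omega>) \<partial>\<Omega>) \<le> ennreal \<epsilon>" .
qed

end

section \<open>Stationarity of the output and complexity\<close>

text \<open>The slab formula with \<open>h = r\<close>, applied to the square and the cube of a
  coordinate: in each case the highest moment cancels, and what remains is a linear equation for the
  first and then for the second moment.\<close>

lemma uniform_cube_moments: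
  assumes r: "0 < r"
  shows "(\<integral>u. u $ i \<partial>(uniform_cube r :: (real ^ 'd) measure)) = 0"
    and "(\<integral>u. (u $ i)\<^sup>2 \<partial>(uniform_cube r :: (real ^ 'd) measure)) = r\<^sup>2 / 3"
proof -
  let ?U = "uniform_cube r :: (real ^ 'd) measure"
  interpret U: prob_space ?U by (rule prob_space_uniform_cube[OF r])
  have one: "U.prob (cube (ereal r)) = 1" using U.prob_space by simp
  have int [simp]: "integrable ?U (\<lambda>u. u $ i)" "integrable ?U (\<lambda>u. (u $ i)\<^sup>2)" "integrable ?U (\<lambda>u. (u $ i) ^ 3)"
    by (intro integrable_uniform_cube[OF r] continuous_intros)+
  let ?m = "\<integral>u. u $ i \<partial>?U" and ?n = "\<integral>u. (u $ i)\<^sup>2 \<partial>?U"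
  have s: "r * (x + r) / (2 * r) = (x + r) / 2" for x using r by simp
  have shift: "(\<integral>u. (u $ i + r) ^ k \<partial>?U) - (\<integral>u. (u $ i) ^ k \<partial>?U) =
      1 / 2 * ((\<integral>u. (r + (u $ i + r) / 2) ^ k \<partial>?U) - (\<integral>u. (- r + (u $ i + r) / 2) ^ k \<partial>?U))" for k
  proof -
    have "continuous_on (cube (ereal (r + r))) (\<lambda>x :: real ^ 'd. (x $ i) ^ k)"
      by (intro continuous_intros)
    from uniform_cube_shift[OF r r this, of i] r show ?thesis by (simp add: s)
  qed
  have alg2: "2 * x + y = x + y"
    if "a = n + 2 * x + y" "b = n / 4 + 3 / 2 * x + 9 * y / 4" "c = n / 4 - 1 / 2 * x + y / 4"
      "a - n = 1 / 2 * (b - c)" for a b c n x y :: real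
    using that by (simp add: field_simps)
  have alg3: "3 * x + y = 3 / 4 * x + 7 * y / 4"
    if "a = n + 3 * x + y" "b = n / 8 + 9 / 8 * x + 27 * y / 8" "c = n / 8 - 3 / 8 * x - y / 8"
      "a - n = 1 / 2 * (b - c)" for a b c n x y :: real
    using that by (simp add: field_simps)
  have "2 * (r * ?m) + r\<^sup>2 = r * ?m + r\<^sup>2"
  proof -
    have "(\<integral>u. (u $ i + r)\<^sup>2 \<partial>?U) = ?n + 2 * (r * ?m) + r\<^sup>2"
      by (simp add: power2_sum one mult_ac)
    moreover have "(\<integral>u. (r + (u $ i + r) / 2)\<^sup>2 \<partial>?U) = ?n / 4 + 3 / 2 * (r * ?m) + 9 * r\<^sup>2 / 4"
    proof -
      have "(r + (x + r) / 2)\<^sup>2 = x\<^sup>2 / 4 + (3 * r / 2 * x + 9 * r\<^sup>2 / 4)" for x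
        by (simp add: power2_eq_square field_simps)
      then show ?thesis by (simp add: one)
    qed
    moreover have "(\<integral>u. (- r + (u $ i + r) / 2)\<^sup>2 \<partial>?U) = ?n / 4 - 1 / 2 * (r * ?m) + r\<^sup>2 / 4"
    proof -
      have "(- r + (x + r) / 2)\<^sup>2 = x\<^sup>2 / 4 + (- (r / 2) * x + r\<^sup>2 / 4)" for x
        by (simp add: power2_eq_square field_simps)
      then show ?thesis by (simp add: one)
    qed
    ultimately show ?thesis by (rule alg2[OF _ _ _ shift[of 2]])
  qed
  then show m: "?m = 0" using r by simp
  have "3 * (r * ?n) + r ^ 3 = 3 / 4 * (r * ?n) + 7 * r ^ 3 / 4"
  proof -
    have "(\<integral>u. (u $ i + r) ^ 3 \<partial>?U) = (\<integral>u. (u $ i) ^ 3 \<partial>?U) + 3 * (r * ?n) + r ^ 3"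
    proof -
      have "(x + r) ^ 3 = x ^ 3 + (3 * r * x\<^sup>2 + (3 * r\<^sup>2 * x + r ^ 3))" for x
        by (simp add: power2_eq_square power3_eq_cube algebra_simps)
      then show ?thesis by (simp add: one m)
    qed
    moreover have "(\<integral>u. (r + (u $ i + r) / 2) ^ 3 \<partial>?U) = (\<integral>u. (u $ i) ^ 3 \<partial>?U) / 8 + 9 / 8 * (r * ?n) + 27 * r ^ 3 / 8"
    proof -
      have "(r + (x + r) / 2) ^ 3 = x ^ 3 / 8 + (9 * r / 8 * x\<^sup>2 + (27 * r\<^sup>2 / 8 * x + 27 * r ^ 3 / 8))" for x
        by (simp add: power2_eq_square power3_eq_cube field_simps)
      then show ?thesis by (simp add: one m)
    qed
    moreover have "(\<integral>u. (- r + (u $ i + r) / 2) ^ 3 \<partial>?U) = (\<integral>u. (u $ i) ^ 3 \<partial>?U) / 8 - 3 / 8 * (r * ?n) - r ^ 3 / 8"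
    proof -
      have "(- r + (x + r) / 2) ^ 3 = x ^ 3 / 8 + (- (3 * r / 8) * x\<^sup>2 + (3 * r\<^sup>2 / 8 * x + - (r ^ 3 / 8)))" for x
        by (simp add: power2_eq_square power3_eq_cube field_simps)
      then show ?thesis by (simp add: one m)
    qed
    ultimately show ?thesis by (rule alg3[OF _ _ _ shift[of 3]])
  qed
  then have "r * ?n = r * (r\<^sup>2 / 3)" by (simp add: power2_eq_square power3_eq_cube field_simps)
  then show "?n = r\<^sup>2 / 3" using r by (simp only: mult_cancel_left) simp
qed

context spa_problem
begin

text \<open>Each coordinate has second moment \<open>\<alpha>\<^sup>2 / 12\<close>, so the mean
  squared norm of the perturbation is \<open>c\<^sup>2\<close> with
  \<open>c = \<alpha> * sqrt (d / 12)\<close>; the Lipschitz constant multiplies the mean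
  norm.\<close>

lemma smoothing_error:
  assumes v: "v \<in> cube \<beta>"
  shows "\<bar>smoothing \<alpha> f v - f v\<bar> \<le> L0 * (\<alpha> * sqrt (d / 12))"
proof -
  interpret U: prob_space U by (rule prob_U)
  have one: "U.prob (cube (ereal (\<alpha> / 2))) = 1" using U.prob_space by simp
  define c where "c = \<alpha> * sqrt (d / 12)"
  have c: "0 < c" using alpha by (simp add: c_def d)
  have v\<kappa>: "v \<in> cube \<kappa>" by (rule subsetD[OF box_in_cube[OF v]]) (use alpha in simp)
  have i1: "integrable U (\<lambda>u. f (v + u))"
    by (rule lipschitz_integrable[OF _ lipschitz_f]) (use alpha shift_in_cube(1)[OF v] in \<open>auto intro!: continuous_intros\<close>)
  have i2: "integrable U (\<lambda>u. norm u)" "integrable U (\<lambda>u. (norm u)\<^sup>2)"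
    using alpha by (intro integrable_uniform_cube continuous_intros; simp)+
  have "(\<integral>u. (norm u)\<^sup>2 \<partial>U) = (\<Sum>i\<in>(UNIV :: 'd set). (\<integral>u. (u $ i)\<^sup>2 \<partial>U))"
    unfolding norm_vec_square using alpha
    by (intro Bochner_Integration.integral_sum integrable_uniform_cube continuous_intros) simp
  also have "... = c\<^sup>2"
    using alpha by (simp add: uniform_cube_moments(2) c_def d power_mult_distrib power_divide)
  finally have sq: "(\<integral>u. (norm u)\<^sup>2 \<partial>U) = c\<^sup>2" .
  \<comment> \<open>\<open>am_gm\<close> at the value \<open>c\<close> stands in for the
    Cauchy-Schwarz inequality and loses nothing, since both summands integrate to
    \<open>c / 2\<close>.\<close>
  have "(\<integral>u. norm u \<partial>U) \<le> (\<integral>u. (norm u)\<^sup>2 / (2 * c) + c / 2 \<partial>U)"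
    using i2 am_gm[OF c] by (intro integral_mono) auto
  also have "... = c\<^sup>2 / (2 * c) + c / 2"
    using i2 by (simp add: sq one)
  also have "... = c" using c by (simp add: power2_eq_square)
  finally have mean: "(\<integral>u. norm u \<partial>U) \<le> c" .
  have "\<bar>smoothing \<alpha> f v - f v\<bar> = \<bar>\<integral>u. f (v + u) - f v \<partial>U\<bar>"
    using i1 by (simp add: smoothing_def one)
  also have "... \<le> (\<integral>u. \<bar>f (v + u) - f v\<bar> \<partial>U)" by (rule integral_abs_bound)
  also have "... \<le> (\<integral>u. L0 * norm u \<partial>U)"
  proof (rule integral_mono)
    fix u assume "u \<in> space U"
    then have "v + u \<in> cube \<kappa>" by (intro shift_in_cube(1)[OF v]) simp
    from lipschitz_onD[OF lipschitz_f this v\<kappa>] show "\<bar>f (v + u) - f v\<bar> \<le> L0 * norm u"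
      by (simp add: dist_norm)
  qed (use i1 i2 in auto)
  also have "... = L0 * (\<integral>u. norm u \<partial>U)" by simp
  also have "... \<le> L0 * c" using mean ell_mean by (intro mult_left_mono) auto
  finally show ?thesis by (simp only: c_def)
qed

end

text \<open>Before taking hulls, the graph is the projection of a closed set of triples: a base
  point \<open>w\<close>, a point \<open>x\<close> within \<open>\<epsilon>\<close> of it, and a
  subgradient at \<open>x\<close>.\<close>

lemma sigma_compact_clarke_eps_graph:
  "sigma_compact {(w, g). g \<in> clarke_eps_subdifferential \<epsilon> f (w :: 'a::euclidean_space)}"
  unfolding clarke_eps_subdifferential_def
proof (rule sigma_compact_graph_convex_hull)
  let ?T = "{p :: ('a \<times> 'a) \<times> 'a. dist (snd p) (fst (fst p)) \<le> \<epsilon>} \<inter>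
    ({(x, \<zeta>). \<zeta> \<in> clarke_subdifferential f x} \<times> UNIV)"
  have "{(w, z). z \<in> (\<Union>x\<in>cball w \<epsilon>. clarke_subdifferential f x)} = (\<lambda>p. (snd p, snd (fst p))) ` ?T"
    by (force simp: image_iff)
  moreover have "closed ?T"
    by (intro closed_Int closed_Times closed_UNIV closed_clarke_graph closed_Collect_le continuous_intros)
  then have "sigma_compact ?T" by (rule closed_imp_sigma_compact)
  then have "sigma_compact ((\<lambda>p. (snd p, snd (fst p))) ` ?T)"
    by (rule sigma_compact_image[rotated]) (intro continuous_intros)
  ultimately show "sigma_compact {(w, z). z \<in> (\<Union>x\<in>cball w \<epsilon>. clarke_subdifferential f x)}"
    by (simp only:)
qed

context spa_run
begin

text \<open>The common end of (a) and (b). \<open>C\<close> has to agree with the fibres of a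
  sigma-compact graph only on \<open>A\<close>, where the output lies.\<close>

lemma expected_dist_output:
  assumes eps: "0 < \<epsilon>" and \<Gamma>: "sigma_compact \<Gamma>" and C: "\<And>w. w \<in> A \<Longrightarrow> C w = {z. (w, z) \<in> \<Gamma>}"
    and DC: "\<And>w y. w \<in> A \<Longrightarrow> y \<in> mordukhovich_normal_cone w A \<Longrightarrow> D w + y \<in> C w"
    and K: "C1 * L * \<Delta> \<le> real K * (\<epsilon>\<^sup>2 / 2)" and Mq: "C2 * (\<upsilon> * Q) \<le> real M * (\<epsilon>\<^sup>2 / 2)"
    and K0: "0 < K" and samp: "spa_sampling \<Omega> P \<alpha> K M V X R"
  shows "output V X R \<in> borel_measurable \<Omega> \<and>
    expected_dist_le \<Omega> (\<lambda>\<omega>. C (output V X R \<omega>)) \<epsilon>"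
proof -
  let ?out = "output V X R"
  let ?h = "\<lambda>w. set_dist 0 {z. (w, z) \<in> \<Gamma>}"
  have hm: "?h \<in> borel_measurable borel" by (rule sigma_compact_graph_measurable[OF \<Gamma>])
  have h: "?h w \<le> ennreal (norm (D w + y))" if "w \<in> A" "y \<in> frechet_normal_cone w A" for w y
  proof -
    have "D w + y \<in> {z. (w, z) \<in> \<Gamma>}"
      using DC[OF that(1)] frechet_subset_mordukhovich[OF that(1)] that(2) C[OF that(1)] by blast
    then show ?thesis unfolding set_dist_def by (intro INF_lower2) auto
  qed
  have out: "?out \<in> borel_measurable \<Omega>" "\<And>\<omega>. \<omega> \<in> space \<Omega> \<Longrightarrow> ?out \<omega> \<in> A"
    "(\<integral>\<^sup>+\<omega>. ?h (?out \<omega>) \<partial>\<Omega>) \<le> ennreal \<epsilon>"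
    by (rule spa_output_stationarity[OF eps hm h K Mq K0 samp]; assumption)+
  have eq: "set_dist 0 (C (?out \<omega>)) = ?h (?out \<omega>)" if "\<omega> \<in> space \<Omega>" for \<omega>
    using C[OF out(2)[OF that]] by simp
  have "(\<lambda>\<omega>. ?h (?out \<omega>)) \<in> borel_measurable \<Omega>"
    by (rule measurable_compose[OF out(1) hm])
  moreover have "(\<integral>\<^sup>+\<omega>. set_dist 0 (C (?out \<omega>)) \<partial>\<Omega>) = (\<integral>\<^sup>+\<omega>. ?h (?out \<omega>) \<partial>\<Omega>)"
    by (rule nn_integral_cong) (rule eq)
  ultimately show ?thesis
    using out(1,3) unfolding expected_dist_le_def by (simp add: eq cong: measurable_cong)
qed

lemma smoothed_stationary_output:
  assumes eps: "0 < \<epsilon>" and clA: "closed A" "A = S \<inter> cube \<beta>"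
    and e1: "L0 * (\<alpha> * sqrt (d / 12)) \<le> \<epsilon>\<^sub>1"
    and K: "C1 * L * \<Delta> \<le> real K * (\<epsilon>\<^sup>2 / 2)" and Mq: "C2 * (\<upsilon> * Q) \<le> real M * (\<epsilon>\<^sup>2 / 2)"
    and K0: "0 < K" and samp: "spa_sampling \<Omega> P \<alpha> K M V X R"
  shows "smoothed_stationary \<Omega> \<alpha> \<beta> S f \<epsilon>\<^sub>1 \<epsilon> (output V X R)"
proof -
  let ?N = "{(w, y). y \<in> mordukhovich_normal_cone w A}"
  let ?\<Gamma> = "{(w, g + y) | w g y. (w, g) \<in> (\<lambda>w. (w, D w)) ` A \<and> (w, y) \<in> ?N}"
  let ?C = "\<lambda>w. {gradient (smoothing \<alpha> f) w + y | y. y \<in> mordukhovich_normal_cone w (S \<inter> cube \<beta>)}"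
  have \<Gamma>: "sigma_compact ?\<Gamma>"
    by (intro sigma_compact_graph_sum sigma_compact_image closed_imp_sigma_compact closed_mordukhovich_graph clA(1)
        continuous_intros continuous_on_subset[OF D_continuous A])
  have C: "?C w = {z. (w, z) \<in> ?\<Gamma>}" if "w \<in> A" for w
  proof -
    have "w \<in> cube \<beta>" using that A by blast
    then show ?thesis
      unfolding clA(2)[symmetric] gradient_smoothing_f[OF \<open>w \<in> cube \<beta>\<close>] using that by blast
  qed
  have DC: "D w + y \<in> ?C w" if "w \<in> A" "y \<in> mordukhovich_normal_cone w A" for w y
    unfolding C[OF that(1)] using that by blast
  from expected_dist_output[OF eps \<Gamma> C DC K Mq K0 samp] show ?thesis
    unfolding smoothed_stationary_def using smoothing_error e1 by (blast intro: order_trans)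
qed

lemma clarke_stationary_output:
  assumes eps: "0 < \<epsilon>" and clA: "A = S \<inter> cube \<beta>"
    and e3: "sqrt d * (\<alpha> / 2) = \<epsilon>\<^sub>3" "room \<epsilon>\<^sub>3 \<beta> \<kappa>"
    and K: "C1 * L * \<Delta> \<le> real K * (\<epsilon>\<^sup>2 / 2)" and Mq: "C2 * (\<upsilon> * Q) \<le> real M * (\<epsilon>\<^sup>2 / 2)"
    and K0: "0 < K" and samp: "spa_sampling \<Omega> P \<alpha> K M V X R"
  shows "clarke_stationary \<Omega> \<alpha> \<beta> S f \<epsilon>\<^sub>3 \<epsilon> (output V X R)"
proof -
  let ?N = "{(w, y). y \<in> mordukhovich_normal_cone w A}"
  let ?\<Gamma> = "{(w, g + y) | w g y. (w, g) \<in> {(w, g). g \<in> clarke_eps_subdifferential \<epsilon>\<^sub>3 f w} \<and> (w, y) \<in> ?N}"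
  let ?C = "\<lambda>w. {g + y | g y. g \<in> clarke_eps_subdifferential \<epsilon>\<^sub>3 f w \<and> y \<in> mordukhovich_normal_cone w (S \<inter> cube \<beta>)}"
  have \<Gamma>: "sigma_compact ?\<Gamma>"
    by (intro sigma_compact_graph_sum sigma_compact_clarke_eps_graph closed_imp_sigma_compact closed_mordukhovich_graph)
  have C: "?C w = {z. (w, z) \<in> ?\<Gamma>}" for w
    unfolding clA[symmetric] by blast
  obtain e where e: "0 < e" "\<And>w. w \<in> cube \<beta> \<Longrightarrow> box_around w (\<epsilon>\<^sub>3 + e) \<subseteq> (cube \<kappa> :: (real ^ 'd) set)"
    using room_margin[OF e3(2), where 'd = 'd] by blast
  have DC: "D w + y \<in> ?C w" if "w \<in> A" "y \<in> mordukhovich_normal_cone w A" for w y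
  proof -
    have "w \<in> cube \<beta>" using that A by blast
    have "D w \<in> clarke_eps_subdifferential \<epsilon>\<^sub>3 f w"
      by (rule smoothing_gradient_in_clarke_eps[OF alpha e3(1)[symmetric, unfolded d] e(1)])
        (rule lipschitz_on_subset[OF lipschitz_f e(2)[OF \<open>w \<in> cube \<beta>\<close>]])
    then show ?thesis using that(2) unfolding clA[symmetric] by blast
  qed
  from expected_dist_output[OF eps \<Gamma> C DC K Mq K0 samp] show ?thesis
    unfolding clarke_stationary_def Let_def d[symmetric] e3(1) by simp
qed

end

section \<open>Complexity bounds\<close>

lemma real_nat_ceiling_le:
  assumes "0 \<le> c" "0 < t" "t \<le> 1"
  shows "real (nat \<lceil>c / t\<rceil>) \<le> (c + 1) / t"
proof -
  have "real (nat \<lceil>c / t\<rceil>) \<le> c / t + 1"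
    using assms of_int_ceiling_le_add_one[of "c / t"] by simp
  \<comment> \<open>For \<open>t \<le> 1\<close> the rounding error 1 is at most
    \<open>1 / t\<close>.\<close>
  also have "... \<le> (c + 1) / t" using assms by (simp add: add_divide_distrib)
  finally show ?thesis .
qed

lemma gradient_call_complexity_le:
  assumes "0 < K"
  shows "gradient_call_complexity K M \<le> K * M"
proof -
  have "gradient_calls M r \<le> K * M" if "r \<in> {2..K + 1}" for r
  proof -
    have "{(k, i). k \<in> {1..<r} \<and> i \<in> {1..M}} = {1..<r} \<times> {1..M}" by auto
    then have "gradient_calls M r = (r - 1) * M" by (simp add: gradient_calls_def card_cartesian_product)
    moreover have "r - 1 \<le> K" using that by auto
    ultimately show ?thesis by (simp only: mult_le_mono1)
  qed
  then show ?thesis unfolding gradient_call_complexity_def using assms by (intro Max.boundedI) auto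
qed

lemma projection_complexity_le:
  assumes "0 < K"
  shows "projection_complexity K \<le> K"
  unfolding projection_complexity_def projections_def using assms by (intro Max.boundedI) auto

lemma eventually_unit_square:
  "\<forall>\<^sub>F p in at_right (0 :: real) \<times>\<^sub>F at_right (0 :: real). 0 < fst p \<and> fst p \<le> 1 \<and> 0 < snd p \<and> snd p \<le> (1 :: real)"
proof -
  have "\<forall>\<^sub>F x in at_right (0 :: real). 0 < x \<and> x \<le> 1"
    unfolding eventually_at_right_field by (intro exI[of _ 1]) auto
  from eventually_prodI[OF this this] show ?thesis by (rule eventually_mono) auto
qed

lemma complexity_bigo:
  fixes K :: "real \<Rightarrow> real \<Rightarrow> nat" and M :: "real \<Rightarrow> nat"
  assumes c: "0 < c" "0 < c'"
    and K: "\<And>a b. K a b = nat \<lceil>c / (a * b\<^sup>2)\<rceil>" and M: "\<And>b. M b = nat \<lceil>c' / b\<^sup>2\<rceil>"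
  shows "(\<lambda>(a, b). real (gradient_call_complexity (K a b) (M b)))
      \<in> O[at_right 0 \<times>\<^sub>F at_right 0](\<lambda>(a, b). 1 / (a * b ^ 4))"
    and "(\<lambda>(a, b). real (projection_complexity (K a b)))
      \<in> O[at_right 0 \<times>\<^sub>F at_right 0](\<lambda>(a, b). 1 / (a * b ^ 2))"
proof -
  have pos: "0 < K a b" if "0 < a" "0 < b" for a b
    using c that by (simp add: K)
  have Kle: "real (K a b) \<le> (c + 1) / (a * b\<^sup>2)" if "0 < a" "a \<le> 1" "0 < b" "b \<le> 1" for a b
    unfolding K using c that by (intro real_nat_ceiling_le mult_le_one power_le_one) auto
  have Mle: "real (M b) \<le> (c' + 1) / b\<^sup>2" if "0 < b" "b \<le> 1" for b
    unfolding M using c that by (intro real_nat_ceiling_le power_le_one) auto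
  show "(\<lambda>(a, b). real (gradient_call_complexity (K a b) (M b)))
      \<in> O[at_right 0 \<times>\<^sub>F at_right 0](\<lambda>(a, b). 1 / (a * b ^ 4))"
  proof (rule bigoI[where c = "(c + 1) * (c' + 1)"])
    show "\<forall>\<^sub>F p in at_right 0 \<times>\<^sub>F at_right 0.
      norm (case p of (a, b) \<Rightarrow> real (gradient_call_complexity (K a b) (M b))) \<le>
      (c + 1) * (c' + 1) * norm (case p of (a, b) \<Rightarrow> 1 / (a * b ^ 4))"
      using eventually_unit_square
    proof eventually_elim
      case (elim p)
      obtain a b where p: "p = (a, b)" by (cases p)
      have ab: "0 < a" "a \<le> 1" "0 < b" "b \<le> 1" using elim by (auto simp: p)
      have "real (gradient_call_complexity (K a b) (M b)) \<le> real (K a b) * real (M b)"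
        using gradient_call_complexity_le[OF pos[OF ab(1,3)]] by (metis of_nat_le_iff of_nat_mult)
      also have "... \<le> (c + 1) / (a * b\<^sup>2) * ((c' + 1) / b\<^sup>2)"
        using ab c by (intro mult_mono Kle Mle) auto
      also have "... = (c + 1) * (c' + 1) * (1 / (a * b ^ 4))"
        by (simp add: power2_eq_square power4_eq_xxxx)
      finally show ?case using ab by (simp add: p)
    qed
  qed
  show "(\<lambda>(a, b). real (projection_complexity (K a b)))
      \<in> O[at_right 0 \<times>\<^sub>F at_right 0](\<lambda>(a, b). 1 / (a * b ^ 2))"
  proof (rule bigoI[where c = "c + 1"])
    show "\<forall>\<^sub>F p in at_right 0 \<times>\<^sub>F at_right 0.
      norm (case p of (a, b) \<Rightarrow> real (projection_complexity (K a b))) \<le>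
      (c + 1) * norm (case p of (a, b) \<Rightarrow> 1 / (a * b ^ 2))"
      using eventually_unit_square
    proof eventually_elim
      case (elim p)
      obtain a b where p: "p = (a, b)" by (cases p)
      have ab: "0 < a" "a \<le> 1" "0 < b" "b \<le> 1" using elim by (auto simp: p)
      have "real (projection_complexity (K a b)) \<le> real (K a b)"
        using projection_complexity_le[OF pos[OF ab(1,3)]] by simp
      also have "... \<le> (c + 1) * (1 / (a * b\<^sup>2))" using Kle[OF ab] by simp
      finally show ?case using ab by (simp add: p)
    qed
  qed
qed

theorem corollary14:
  fixes P :: "(real ^ 'p) measure"
    and F :: "real ^ 'd \<Rightarrow> real ^ 'p \<Rightarrow> real"
    and ell :: "real ^ 'p \<Rightarrow> real"
    and \<beta> \<kappa> :: ereal
    and S :: "(real ^ 'd) set"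
    and w1 :: "real ^ 'd"
    and upd :: spa_update
    and f :: "real ^ 'd \<Rightarrow> real"
    and d L\<^sub>0 Q \<rho> \<Delta> \<upsilon> C\<^sub>1 C\<^sub>2 :: real
    and \<alpha>\<^sub>a \<alpha>\<^sub>b :: "real \<Rightarrow> real"
    and \<eta> :: "real \<Rightarrow> real"
    and K\<^sub>a K\<^sub>b :: "real \<Rightarrow> real \<Rightarrow> nat"
    and batch :: "real \<Rightarrow> nat"
  assumes problem: "stochastic_lipschitz P F ell \<kappa>"
    and beta: "0 < \<beta>"
    and d: "d = real CARD('d)"
    and f: "f = expected_loss P F"
    and L0: "L\<^sub>0 = (\<integral>x. ell x \<partial>P)" "0 < L\<^sub>0"
    and Q: "Q = (\<integral>x. (ell x)\<^sup>2 \<partial>P)"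
    and S: "closed S" "w1 \<in> S \<inter> cube \<beta>"
    and rho: "1 < \<rho>"
    and Delta: "0 < \<Delta>"
    and upsilon: "\<upsilon> = (case upd of Finite_Difference \<Rightarrow> d | Approximate_Gradient \<Rightarrow> 1)"
    and C1: "C\<^sub>1 = 2 * (1 + 3 * \<rho>) / (\<rho> - 1) + 3 * \<rho>"
    and C2: "C\<^sub>2 = 2 * (1 + 3 * \<rho>) / (\<rho> - 1) + 3"
    and eta: "\<And>\<alpha>. \<eta> \<alpha> = \<alpha> / (3 * \<rho> * sqrt d * L\<^sub>0)"
    and batch: "\<And>\<epsilon>. batch \<epsilon> = nat \<lceil>C\<^sub>2 * (2 * \<upsilon> * Q / \<epsilon>\<^sup>2)\<rceil>"
    and alpha_a: "\<And>\<epsilon>\<^sub>1. \<alpha>\<^sub>a \<epsilon>\<^sub>1 = \<epsilon>\<^sub>1 / (L\<^sub>0 * sqrt (d / 12))"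
    and K_a: "\<And>\<epsilon>\<^sub>1 \<epsilon>\<^sub>2. K\<^sub>a \<epsilon>\<^sub>1 \<epsilon>\<^sub>2 =
                nat \<lceil>C\<^sub>1 * sqrt (4 / 3) * (d * L\<^sub>0\<^sup>2 * \<Delta> / (\<epsilon>\<^sub>1 * \<epsilon>\<^sub>2\<^sup>2))\<rceil>"
    and alpha_b: "\<And>\<epsilon>\<^sub>3. \<alpha>\<^sub>b \<epsilon>\<^sub>3 = 2 * \<epsilon>\<^sub>3 / sqrt d"
    and K_b: "\<And>\<epsilon>\<^sub>3 \<epsilon>\<^sub>4. K\<^sub>b \<epsilon>\<^sub>3 \<epsilon>\<^sub>4 =
                nat \<lceil>C\<^sub>1 * (2 * d * L\<^sub>0 * \<Delta> / (\<epsilon>\<^sub>3 * \<epsilon>\<^sub>4\<^sup>2))\<rceil>"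
  shows
    "(\<forall>\<epsilon>\<^sub>1 \<epsilon>\<^sub>2 \<alpha> K M wmin G proj (\<Omega> :: 'a measure) U X R.
        0 < \<epsilon>\<^sub>1 \<and> 0 < \<epsilon>\<^sub>2 \<and>
        \<alpha> = \<alpha>\<^sub>a \<epsilon>\<^sub>1 \<and> K = K\<^sub>a \<epsilon>\<^sub>1 \<epsilon>\<^sub>2 \<and> M = batch \<epsilon>\<^sub>2 \<and>
        room (\<alpha> / 2) \<beta> \<kappa> \<and>
        is_arg_min (smoothing \<alpha> f) (\<lambda>w. w \<in> S \<inter> cube \<beta>) wmin \<and>
        smoothing \<alpha> f w1 - smoothing \<alpha> f wmin \<le> \<Delta> \<and>
        (upd = Approximate_Gradient \<longrightarrow> approximate_gradient P F \<alpha> \<beta> G) \<and>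
        (\<forall>k. projection_selection (S \<inter> cube \<beta>) (proj k)) \<and>
        spa_sampling \<Omega> P \<alpha> K M U X R
        \<longrightarrow> smoothed_stationary \<Omega> \<alpha> \<beta> S f \<epsilon>\<^sub>1 \<epsilon>\<^sub>2
              (spa_output upd F G \<alpha> (\<eta> \<alpha>) M proj w1 U X R))
     \<and>
     (\<forall>\<epsilon>\<^sub>3 \<epsilon>\<^sub>4 \<alpha> K M wmin G proj (\<Omega> :: 'a measure) U X R.
        0 < \<epsilon>\<^sub>3 \<and> 0 < \<epsilon>\<^sub>4 \<and>
        \<alpha> = \<alpha>\<^sub>b \<epsilon>\<^sub>3 \<and> K = K\<^sub>b \<epsilon>\<^sub>3 \<epsilon>\<^sub>4 \<and> M = batch \<epsilon>\<^sub>4 \<and>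
        room (\<alpha> / 2) \<beta> \<kappa> \<and> room \<epsilon>\<^sub>3 \<beta> \<kappa> \<and>
        is_arg_min (smoothing \<alpha> f) (\<lambda>w. w \<in> S \<inter> cube \<beta>) wmin \<and>
        smoothing \<alpha> f w1 - smoothing \<alpha> f wmin \<le> \<Delta> \<and>
        (upd = Approximate_Gradient \<longrightarrow> approximate_gradient P F \<alpha> \<beta> G) \<and>
        (\<forall>k. projection_selection (S \<inter> cube \<beta>) (proj k)) \<and>
        spa_sampling \<Omega> P \<alpha> K M U X R
        \<longrightarrow> clarke_stationary \<Omega> \<alpha> \<beta> S f \<epsilon>\<^sub>3 \<epsilon>\<^sub>4
              (spa_output upd F G \<alpha> (\<eta> \<alpha>) M proj w1 U X R))
     \<and>
     (\<lambda>(\<epsilon>\<^sub>1, \<epsilon>\<^sub>2). real (gradient_call_complexity (K\<^sub>a \<epsilon>\<^sub>1 \<epsilon>\<^sub>2) (batch \<epsilon>\<^sub>2)))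
       \<in> O[at_right 0 \<times>\<^sub>F at_right 0](\<lambda>(\<epsilon>\<^sub>1, \<epsilon>\<^sub>2). 1 / (\<epsilon>\<^sub>1 * \<epsilon>\<^sub>2 ^ 4))
     \<and>
     (\<lambda>(\<epsilon>\<^sub>3, \<epsilon>\<^sub>4). real (gradient_call_complexity (K\<^sub>b \<epsilon>\<^sub>3 \<epsilon>\<^sub>4) (batch \<epsilon>\<^sub>4)))
       \<in> O[at_right 0 \<times>\<^sub>F at_right 0](\<lambda>(\<epsilon>\<^sub>3, \<epsilon>\<^sub>4). 1 / (\<epsilon>\<^sub>3 * \<epsilon>\<^sub>4 ^ 4))
     \<and>
     (\<lambda>(\<epsilon>\<^sub>1, \<epsilon>\<^sub>2). real (projection_complexity (K\<^sub>a \<epsilon>\<^sub>1 \<epsilon>\<^sub>2)))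
       \<in> O[at_right 0 \<times>\<^sub>F at_right 0](\<lambda>(\<epsilon>\<^sub>1, \<epsilon>\<^sub>2). 1 / (\<epsilon>\<^sub>1 * \<epsilon>\<^sub>2 ^ 2))
     \<and>
     (\<lambda>(\<epsilon>\<^sub>3, \<epsilon>\<^sub>4). real (projection_complexity (K\<^sub>b \<epsilon>\<^sub>3 \<epsilon>\<^sub>4)))
       \<in> O[at_right 0 \<times>\<^sub>F at_right 0](\<lambda>(\<epsilon>\<^sub>3, \<epsilon>\<^sub>4). 1 / (\<epsilon>\<^sub>3 * \<epsilon>\<^sub>4 ^ 2))"
proof -
  let ?A = "S \<inter> cube \<beta>"
  interpret stochastic_lipschitz P F ell \<kappa> by (rule problem)
  have d0: "0 < d" by (simp add: d)
  have C0: "0 < C\<^sub>1" "0 < C\<^sub>2" using rho unfolding C1 C2 by (auto intro!: add_pos_pos divide_pos_pos)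
  have \<upsilon>0: "0 < \<upsilon>" using d0 by (simp add: upsilon split: spa_update.split)
  have ellP: "ell \<in> borel_measurable P"
    using ell_measurable measurable_cong_sets[OF sets_P refl] by blast
  have elli: "integrable P ell"
    by (rule square_integrable_imp_integrable[OF ellP ell_square_integrable])
  \<comment> \<open>Nonnegativity of the variance makes \<open>Q\<close> positive, so that the batch
    size is at least 1.\<close>
  have "L\<^sub>0\<^sup>2 \<le> Q"
    using variance_eq[OF elli ell_square_integrable] variance_positive[of ell] by (simp add: L0 Q)
  then have Q0: "0 < Q" using L0(2) by (meson less_le_trans zero_less_power)
  have clA: "closed ?A" using S(1) closed_cube by (rule closed_Int)
  have batch_pos: "0 < batch \<epsilon>" if "0 < \<epsilon>" for \<epsilon>
    unfolding batch using that C0 \<upsilon>0 Q0 by simp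
  have batch_ge: "C\<^sub>2 * (\<upsilon> * Q) \<le> real (batch \<epsilon>) * (\<epsilon>\<^sup>2 / 2)" if "0 < \<epsilon>" for \<epsilon>
  proof -
    have "C\<^sub>2 * (2 * \<upsilon> * Q / \<epsilon>\<^sup>2) \<le> real (batch \<epsilon>)" unfolding batch by (rule real_nat_ceiling_ge)
    then have "C\<^sub>2 * (2 * \<upsilon> * Q / \<epsilon>\<^sup>2) * (\<epsilon>\<^sup>2 / 2) \<le> real (batch \<epsilon>) * (\<epsilon>\<^sup>2 / 2)"
      by (rule mult_right_mono) simp
    then show ?thesis using that by simp
  qed
  have run: "spa_run P F ell \<kappa> d \<alpha> \<beta> G upd ?A w1 proj (\<eta> \<alpha>) \<rho> \<Delta> M"
    if "0 < \<alpha>" "room (\<alpha> / 2) \<beta> \<kappa>" "is_arg_min (smoothing \<alpha> f) (\<lambda>w. w \<in> ?A) wmin"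
      "smoothing \<alpha> f w1 - smoothing \<alpha> f wmin \<le> \<Delta>"
      "upd = Approximate_Gradient \<longrightarrow> approximate_gradient P F \<alpha> \<beta> G"
      "\<forall>k. projection_selection ?A (proj k)" "0 < M" for \<alpha> wmin G proj M
  proof (intro spa_run.intro spa_problem.intro spa_problem_axioms.intro spa_run_axioms.intro problem)
    show "smoothing \<alpha> (expected_loss P F) w1 - smoothing \<alpha> (expected_loss P F) w \<le> \<Delta>" if "w \<in> ?A" for w
    proof -
      have "smoothing \<alpha> f wmin \<le> smoothing \<alpha> f w"
        using \<open>is_arg_min _ _ wmin\<close> that unfolding is_arg_min_def by (meson not_less)
      then show ?thesis using \<open>smoothing \<alpha> f w1 - smoothing \<alpha> f wmin \<le> \<Delta>\<close> by (simp add: f)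
    qed
    show "\<eta> \<alpha> = 2 / (3 * \<rho> * (2 * sqrt d * (\<integral>x. ell x \<partial>P) / \<alpha>))"
      using that(1) by (simp add: eta L0(1))
  qed (use that d L0 S rho in auto)
  have K_a_pos: "0 < K\<^sub>a \<epsilon>\<^sub>1 \<epsilon>\<^sub>2" if "0 < \<epsilon>\<^sub>1" "0 < \<epsilon>\<^sub>2" for \<epsilon>\<^sub>1 \<epsilon>\<^sub>2
    unfolding K_a using that C0 d0 L0(2) Delta by simp
  have K_b_pos: "0 < K\<^sub>b \<epsilon>\<^sub>3 \<epsilon>\<^sub>4" if "0 < \<epsilon>\<^sub>3" "0 < \<epsilon>\<^sub>4" for \<epsilon>\<^sub>3 \<epsilon>\<^sub>4
    unfolding K_b using that C0 d0 L0(2) Delta by simp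
  have K_a_ge: "C\<^sub>1 * (2 * sqrt d * L\<^sub>0 / \<alpha>\<^sub>a \<epsilon>\<^sub>1) * \<Delta> \<le> real (K\<^sub>a \<epsilon>\<^sub>1 \<epsilon>\<^sub>2) * (\<epsilon>\<^sub>2\<^sup>2 / 2)"
    if "0 < \<epsilon>\<^sub>1" "0 < \<epsilon>\<^sub>2" for \<epsilon>\<^sub>1 \<epsilon>\<^sub>2
  proof -
    \<comment> \<open>With this \<open>\<alpha>\<close>, \<open>L\<close> equals \<open>2 * d *
      L\<^sub>0\<^sup>2 * sqrt (1 / 12) / \<epsilon>\<^sub>1\<close>; the
      \<open>sqrt (4 / 3)\<close> in \<open>K\<^sub>a\<close> is \<open>4 * sqrt (1 / 12)\<close>,
      its extra factor 2 matching the \<open>\<epsilon>\<^sub>2\<^sup>2 / 2\<close>.\<close>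
    have "sqrt (4 / 3) = sqrt (4\<^sup>2 * (1 / 12 :: real))" by simp
    also have "... = 4 * sqrt (1 / 12)" by (simp only: real_sqrt_mult real_sqrt_abs abs_numeral)
    finally have s: "2 * sqrt (1 / 12 :: real) = sqrt (4 / 3) / 2" by linarith
    have "C\<^sub>1 * (2 * sqrt d * L\<^sub>0 / \<alpha>\<^sub>a \<epsilon>\<^sub>1) * \<Delta> = C\<^sub>1 * (2 * (sqrt d * sqrt (d / 12)) * L\<^sub>0\<^sup>2 / \<epsilon>\<^sub>1) * \<Delta>"
      using that d0 L0(2) by (simp add: alpha_a power2_eq_square)
    also have "sqrt d * sqrt (d / 12) = d * sqrt (1 / 12)"
      using d0 by (simp add: real_sqrt_divide)
    also have "C\<^sub>1 * (2 * (d * sqrt (1 / 12)) * L\<^sub>0\<^sup>2 / \<epsilon>\<^sub>1) * \<Delta> = C\<^sub>1 * d * L\<^sub>0\<^sup>2 * \<Delta> / \<epsilon>\<^sub>1 * (2 * sqrt (1 / 12))"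
      by simp
    also have "... = C\<^sub>1 * d * L\<^sub>0\<^sup>2 * \<Delta> / \<epsilon>\<^sub>1 * (sqrt (4 / 3) / 2)" by (simp only: s)
    also have "... = C\<^sub>1 * sqrt (4 / 3) * (d * L\<^sub>0\<^sup>2 * \<Delta> / (\<epsilon>\<^sub>1 * \<epsilon>\<^sub>2\<^sup>2)) * (\<epsilon>\<^sub>2\<^sup>2 / 2)"
      using that by (simp del: real_sqrt_divide)
    also have "... \<le> real (K\<^sub>a \<epsilon>\<^sub>1 \<epsilon>\<^sub>2) * (\<epsilon>\<^sub>2\<^sup>2 / 2)"
      unfolding K_a by (intro mult_right_mono real_nat_ceiling_ge) simp
    finally show ?thesis .
  qed
  have K_b_ge: "C\<^sub>1 * (2 * sqrt d * L\<^sub>0 / \<alpha>\<^sub>b \<epsilon>\<^sub>3) * \<Delta> \<le> real (K\<^sub>b \<epsilon>\<^sub>3 \<epsilon>\<^sub>4) * (\<epsilon>\<^sub>4\<^sup>2 / 2)"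
    if "0 < \<epsilon>\<^sub>3" "0 < \<epsilon>\<^sub>4" for \<epsilon>\<^sub>3 \<epsilon>\<^sub>4
  proof -
    \<comment> \<open>Here \<open>L\<close> simplifies to
      \<open>d * L\<^sub>0 / \<epsilon>\<^sub>3\<close>, and the 2 in \<open>K\<^sub>b\<close>
      compensates the half of \<open>\<epsilon>\<^sub>4\<^sup>2\<close>.\<close>
    have "C\<^sub>1 * (2 * sqrt d * L\<^sub>0 / \<alpha>\<^sub>b \<epsilon>\<^sub>3) * \<Delta> = C\<^sub>1 * ((sqrt d * sqrt d) * L\<^sub>0 / \<epsilon>\<^sub>3) * \<Delta>"
      using that d0 by (simp add: alpha_b del: real_sqrt_mult_self)
    also have "... = C\<^sub>1 * (2 * d * L\<^sub>0 * \<Delta> / (\<epsilon>\<^sub>3 * \<epsilon>\<^sub>4\<^sup>2)) * (\<epsilon>\<^sub>4\<^sup>2 / 2)"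
      using that d0 by simp
    also have "... \<le> real (K\<^sub>b \<epsilon>\<^sub>3 \<epsilon>\<^sub>4) * (\<epsilon>\<^sub>4\<^sup>2 / 2)"
      unfolding K_b by (intro mult_right_mono real_nat_ceiling_ge) simp
    finally show ?thesis .
  qed
  have a: "smoothed_stationary \<Omega> \<alpha> \<beta> S f \<epsilon>\<^sub>1 \<epsilon>\<^sub>2 (spa_output upd F G \<alpha> (\<eta> \<alpha>) M proj w1 U X R)"
    if e: "0 < \<epsilon>\<^sub>1" "0 < \<epsilon>\<^sub>2" and p: "\<alpha> = \<alpha>\<^sub>a \<epsilon>\<^sub>1" "K = K\<^sub>a \<epsilon>\<^sub>1 \<epsilon>\<^sub>2" "M = batch \<epsilon>\<^sub>2"
      and r: "room (\<alpha> / 2) \<beta> \<kappa>" "is_arg_min (smoothing \<alpha> f) (\<lambda>w. w \<in> ?A) wmin"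
        "smoothing \<alpha> f w1 - smoothing \<alpha> f wmin \<le> \<Delta>"
        "upd = Approximate_Gradient \<longrightarrow> approximate_gradient P F \<alpha> \<beta> G"
        "\<forall>k. projection_selection ?A (proj k)"
      and samp: "spa_sampling \<Omega> P \<alpha> K M U X R"
    for \<epsilon>\<^sub>1 \<epsilon>\<^sub>2 \<alpha> K M wmin G proj and \<Omega> :: "'a measure" and U X R
  proof -
    have alpha: "0 < \<alpha>" using e d0 L0(2) by (simp add: p alpha_a)
    have M: "0 < M" using e by (simp add: p batch_pos)
    have "L\<^sub>0 * (\<alpha> * sqrt (d / 12)) \<le> \<epsilon>\<^sub>1"
      using d0 L0(2) by (simp add: p alpha_a)
    from spa_run.smoothed_stationary_output[OF run[OF alpha r M] e(2) clA refl this[unfolded L0(1)]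
        K_a_ge[OF e, folded p, unfolded C1 L0(1)] batch_ge[OF e(2), folded p, unfolded C2 upsilon Q]
        K_a_pos[OF e, folded p] samp]
    show ?thesis by (simp only: f)
  qed
  have b: "clarke_stationary \<Omega> \<alpha> \<beta> S f \<epsilon>\<^sub>3 \<epsilon>\<^sub>4 (spa_output upd F G \<alpha> (\<eta> \<alpha>) M proj w1 U X R)"
    if e: "0 < \<epsilon>\<^sub>3" "0 < \<epsilon>\<^sub>4" and p: "\<alpha> = \<alpha>\<^sub>b \<epsilon>\<^sub>3" "K = K\<^sub>b \<epsilon>\<^sub>3 \<epsilon>\<^sub>4" "M = batch \<epsilon>\<^sub>4"
      and r: "room (\<alpha> / 2) \<beta> \<kappa>" "is_arg_min (smoothing \<alpha> f) (\<lambda>w. w \<in> ?A) wmin"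
        "smoothing \<alpha> f w1 - smoothing \<alpha> f wmin \<le> \<Delta>"
        "upd = Approximate_Gradient \<longrightarrow> approximate_gradient P F \<alpha> \<beta> G"
        "\<forall>k. projection_selection ?A (proj k)"
      and r3: "room \<epsilon>\<^sub>3 \<beta> \<kappa>" and samp: "spa_sampling \<Omega> P \<alpha> K M U X R"
    for \<epsilon>\<^sub>3 \<epsilon>\<^sub>4 \<alpha> K M wmin G proj and \<Omega> :: "'a measure" and U X R
  proof -
    have alpha: "0 < \<alpha>" using e d0 by (simp add: p alpha_b)
    have M: "0 < M" using e by (simp add: p batch_pos)
    have "sqrt d * (\<alpha> / 2) = \<epsilon>\<^sub>3" using d0 by (simp add: p alpha_b)
    from spa_run.clarke_stationary_output[OF run[OF alpha r M] e(2) refl this r3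
        K_b_ge[OF e, folded p, unfolded C1 L0(1)] batch_ge[OF e(2), folded p, unfolded C2 upsilon Q]
        K_b_pos[OF e, folded p] samp]
    show ?thesis by (simp only: f)
  qed
  have M': "batch \<epsilon> = nat \<lceil>(C\<^sub>2 * (2 * \<upsilon> * Q)) / \<epsilon>\<^sup>2\<rceil>" for \<epsilon> by (simp add: batch)
  have K_a': "K\<^sub>a a b = nat \<lceil>(C\<^sub>1 * sqrt (4 / 3) * (d * L\<^sub>0\<^sup>2 * \<Delta>)) / (a * b\<^sup>2)\<rceil>" for a b
    by (simp only: K_a times_divide_eq_right)
  have K_b': "K\<^sub>b a b = nat \<lceil>(C\<^sub>1 * (2 * d * L\<^sub>0 * \<Delta>)) / (a * b\<^sup>2)\<rceil>" for a b
    by (simp only: K_b times_divide_eq_right)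
  have pos: "0 < C\<^sub>1 * sqrt (4 / 3) * (d * L\<^sub>0\<^sup>2 * \<Delta>)" "0 < C\<^sub>1 * (2 * d * L\<^sub>0 * \<Delta>)" "0 < C\<^sub>2 * (2 * \<upsilon> * Q)"
    using C0 d0 L0(2) Delta \<upsilon>0 Q0 by (auto intro!: mult_pos_pos)
  show ?thesis
  proof (intro conjI allI impI, goal_cases)
    case 1
    then show ?case by (elim conjE) (rule a)
  next
    case 2
    then show ?case by (elim conjE) (rule b)
  qed (rule complexity_bigo[OF pos(1,3) K_a' M'] complexity_bigo[OF pos(2,3) K_b' M'])+
qed

end
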